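(* If $X$ is a metrizable space, then the following statements are equivalent: (1) $A_n(X)$ is a $k$-space for each $n\in\mathbb{N}$; (2) $A_4(X)$ is a $k$-space; (3) each $A_n(X)$ ($n\in\mathbb{N}$) is a $k_R$-space; (4) $A_4(X)$ is a $k_R$-space; (5) either $X$ is locally compact and the set $\mathrm{NI}(X)$ is separable, or $\mathrm{NI}(X)$ is compact.
   Context: $\mathrm{NI}(X)$ denotes the set of all non-isolated points of $X$; $\mathbb{N}$ is the set of positive integers. For a non-empty Tychonoff space $X$, $A(X)$ is the free Abelian topological group over $X$: an Abelian topological group with a continuous map $i:X\to A(X)$ such that $i(X)$ algebraically generates $A(X)$ and every continuous map $f:X\to G$ to an Abelian topological group $G$ has the form $f=\overline{f}\circ i$ for some continuous homomorphism $\overline{f}:A(X)\to G$; $X$ is identified with $i(X)$, and is a free algebraic basis of $A(X)$. Each non-zero $g\in A(X)$ is uniquely $r_1x_1+\cdots+r_kx_k$ with $x_i\in X$ distinct and $r_i\in\mathbb{Z}\setminus\{0\}$; its reduced length is $\sum|r_i|$, and $0$ has reduced length $0$. $A_n(X)$ is the subspace of $A(X)$ of all elements of reduced length at most $n$. A space $Y$ is a $k$-space if a subset $C\subseteq Y$ is closed whenever $C\cap K$ is closed in $K$ for every compact $K\subseteq Y$. $Y$ is a $k_R$-space if $Y$ is Tychonoff and every $f:Y\to\mathbb{R}$ whose restriction to each compact subset is continuous is continuous. A space is locally compact if every point has a compact neighbourhood. *)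

theory Defs
  imports "HOL-Analysis.Analysis" "HOL-Algebra.Free_Abelian_Groups" "HOL-Algebra.Generated_Groups"
begin

section \<open>Topological notions\<close>

definition Tychonoff_space :: "'a topology \<Rightarrow> bool" where
  "Tychonoff_space X \<longleftrightarrow> completely_regular_space X \<and> t1_space X"

definition kR_space :: "'a topology \<Rightarrow> bool" where
  "kR_space Y \<longleftrightarrow>
     Tychonoff_space Y \<and>
     (\<forall>f :: 'a \<Rightarrow> real.
        (\<forall>K. compactin Y K \<longrightarrow> continuous_map (subtopology Y K) euclideanreal f)
        \<longrightarrow> continuous_map Y euclideanreal f)"

definition non_isolated :: "'a topology \<Rightarrow> 'a set" where
  "non_isolated X = {x \<in> topspace X. \<not> openin X {x}}"


section \<open>Free Abelian topological groups\<close>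

text \<open>Groups are those of HOL-Algebra, hence written multiplicatively: the group operation, the
  neutral element and the multiple \<open>r x\<close> of the usual additive notation are \<open>\<otimes>\<close>, \<open>\<one>\<close> and
  \<open>x [^] r\<close>. No separation axiom is imposed on topological groups.\<close>

definition abelian_topological_group :: "('g, 'm) monoid_scheme \<Rightarrow> 'g topology \<Rightarrow> bool" where
  "abelian_topological_group G T \<longleftrightarrow>
     comm_group G \<and> topspace T = carrier G \<and>
     continuous_map (prod_topology T T) T (\<lambda>(x, y). x \<otimes>\<^bsub>G\<^esub> y) \<and>
     continuous_map T T (\<lambda>x. inv\<^bsub>G\<^esub> x)"

text \<open>A formula cannot quantify over all types, so the groups \<open>H\<close> below live on the fixed type
  \<^typ>\<open>'a \<Rightarrow>\<^sub>0 int\<close>. This is no restriction: lemma \<open>free_abelian_topological_group_universal\<close>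
  derives the same factorization for groups over an arbitrary type.\<close>

definition free_abelian_topological_group ::
    "'a topology \<Rightarrow> ('g, 'm) monoid_scheme \<Rightarrow> 'g topology \<Rightarrow> ('a \<Rightarrow> 'g) \<Rightarrow> bool" where
  "free_abelian_topological_group X G T i \<longleftrightarrow>
     abelian_topological_group G T \<and>
     continuous_map X T i \<and>
     generate G (i ` topspace X) = carrier G \<and>
     (\<forall>(H :: ('a \<Rightarrow>\<^sub>0 int) monoid) S f.
        abelian_topological_group H S \<and> continuous_map X S f \<longrightarrow>
        (\<exists>h. h \<in> hom G H \<and> continuous_map T S h \<and> (\<forall>x\<in>topspace X. f x = h (i x))))"

text \<open>The finitely supported function \<open>c\<close> encodes the formal combination
  \<open>r\<^sub>1 x\<^sub>1 + \<dots> + r\<^sub>k x\<^sub>k\<close>: the \<open>x\<^sub>j\<close> are its keys and \<open>r\<^sub>j = lookup c x\<^sub>j \<noteq> 0\<close>.\<close>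

definition combination :: "('g, 'm) monoid_scheme \<Rightarrow> ('a \<Rightarrow> 'g) \<Rightarrow> ('a \<Rightarrow>\<^sub>0 int) \<Rightarrow> 'g" where
  "combination G i c = (\<Otimes>\<^bsub>G\<^esub>x\<in>Poly_Mapping.keys c. i x [^]\<^bsub>G\<^esub> Poly_Mapping.lookup c x)"

text \<open>Existence and uniqueness of the reduced form is lemma \<open>reduced_form_ex1\<close>.\<close>

definition reduced_form ::
    "'a topology \<Rightarrow> ('g, 'm) monoid_scheme \<Rightarrow> ('a \<Rightarrow> 'g) \<Rightarrow> 'g \<Rightarrow> ('a \<Rightarrow>\<^sub>0 int)" where
  "reduced_form X G i g = (THE c. Poly_Mapping.keys c \<subseteq> topspace X \<and> combination G i c = g)"

definition reduced_length ::
    "'a topology \<Rightarrow> ('g, 'm) monoid_scheme \<Rightarrow> ('a \<Rightarrow> 'g) \<Rightarrow> 'g \<Rightarrow> nat" where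
  "reduced_length X G i g =
     (\<Sum>x\<in>Poly_Mapping.keys (reduced_form X G i g).
        nat \<bar>Poly_Mapping.lookup (reduced_form X G i g) x\<bar>)"

text \<open>The subspace \<open>A\<^sub>n(X)\<close> of \<open>A(X) = (G, T)\<close>.\<close>

definition A_sub ::
    "'a topology \<Rightarrow> ('g, 'm) monoid_scheme \<Rightarrow> 'g topology \<Rightarrow> ('a \<Rightarrow> 'g) \<Rightarrow> nat \<Rightarrow> 'g topology" where
  "A_sub X G T i n = subtopology T {g \<in> carrier G. reduced_length X G i g \<le> n}"


section \<open>The definitions are adequate\<close>

lemma abelian_topological_group_pullback:
  assumes F: "comm_group F" and H: "abelian_topological_group H S" and h: "h \<in> hom F H"
  shows "abelian_topological_group F (pullback_topology (carrier F) h S)"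
proof -
  interpret F: comm_group F by fact
  interpret H: comm_group H using H by (simp add: abelian_topological_group_def)
  interpret h: group_hom F H h
    using h by (simp add: group_hom_def group_hom_axioms_def F.is_group H.is_group)
  let ?P = "pullback_topology (carrier F) h S"
  have sp: "topspace S = carrier H" using H by (simp add: abelian_topological_group_def)
  then have spP: "topspace ?P = carrier F"
    by (auto simp: topspace_pullback_topology)
  have hc: "continuous_map ?P S h"
    using continuous_map_pullback[of S S id "carrier F" h] by simp
  have into: "continuous_map Z ?P g"
    if "continuous_map Z S (h \<circ> g)" "g \<in> topspace Z \<rightarrow> carrier F" for Z :: "'z topology" and g
    using that by (intro continuous_map_pullback') auto
  have "continuous_map (prod_topology ?P ?P) ?P (\<lambda>(x, y). x \<otimes>\<^bsub>F\<^esub> y)"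
  proof (rule into)
    have "continuous_map (prod_topology ?P ?P) (prod_topology S S) (\<lambda>(x, y). (h x, h y))"
      using hc by (simp add: continuous_map_prod_top)
    then have "continuous_map (prod_topology ?P ?P) S
        ((\<lambda>(x, y). x \<otimes>\<^bsub>H\<^esub> y) \<circ> (\<lambda>(x, y). (h x, h y)))"
      using H by (intro continuous_map_compose) (auto simp: abelian_topological_group_def)
    then show "continuous_map (prod_topology ?P ?P) S (h \<circ> (\<lambda>(x, y). x \<otimes>\<^bsub>F\<^esub> y))"
      by (rule continuous_map_eq) (auto simp: spP)
  qed (auto simp: spP)
  moreover have "continuous_map ?P ?P (\<lambda>x. inv\<^bsub>F\<^esub> x)"
  proof (rule into)
    have "continuous_map ?P S ((\<lambda>x. inv\<^bsub>H\<^esub> x) \<circ> h)"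
      using H hc by (intro continuous_map_compose) (auto simp: abelian_topological_group_def)
    then show "continuous_map ?P S (h \<circ> (\<lambda>x. inv\<^bsub>F\<^esub> x))"
      by (rule continuous_map_eq) (auto simp: spP)
  qed (auto simp: spP)
  ultimately show ?thesis
    using F spP by (simp add: abelian_topological_group_def)
qed

lemma free_group_pullback:
  fixes X :: "'a topology"
  assumes H: "abelian_topological_group H S" and f: "continuous_map X S f"
  obtains h P where
    "h \<in> hom (free_Abelian_group (topspace X)) H" "\<And>x. x \<in> topspace X \<Longrightarrow> h (frag_of x) = f x"
    "abelian_topological_group (free_Abelian_group (topspace X)) P"
    "continuous_map X P frag_of" "continuous_map P S h"
proof -
  interpret H: comm_group H using H by (simp add: abelian_topological_group_def)
  let ?F = "free_Abelian_group (topspace X)"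
  have "f ` topspace X \<subseteq> carrier H"
    using continuous_map_image_subset_topspace[OF f] H by (simp add: abelian_topological_group_def)
  then obtain h where h: "h \<in> hom ?F H" and hf: "\<And>x. x \<in> topspace X \<Longrightarrow> h (frag_of x) = f x"
    by (rule H.free_Abelian_group_universal) blast
  let ?P = "pullback_topology (carrier ?F) h S"
  have "continuous_map X ?P frag_of"
  proof (rule continuous_map_pullback')
    show "continuous_map X S (h \<circ> frag_of)"
      using f by (rule continuous_map_eq) (simp add: hf)
  qed auto
  moreover have "continuous_map ?P S h"
    using continuous_map_pullback[of S S id "carrier ?F" h] by simp
  ultimately show thesis
    using h hf abelian_topological_group_pullback[OF abelian_free_Abelian_group H h]
    by (intro that[of h ?P]) assumption+
qed

lemma free_abelian_topological_group_universal:
  fixes H :: "('h, 'k) monoid_scheme"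
  assumes A: "free_abelian_topological_group X G T i"
    and H: "abelian_topological_group H S" and f: "continuous_map X S f"
  obtains h where "h \<in> hom G H" "continuous_map T S h" "\<And>x. x \<in> topspace X \<Longrightarrow> f x = h (i x)"
proof -
  let ?F = "free_Abelian_group (topspace X)"
  obtain h P where h: "h \<in> hom ?F H" and hf: "\<And>x. x \<in> topspace X \<Longrightarrow> h (frag_of x) = f x"
    and P: "abelian_topological_group ?F P" "continuous_map X P frag_of" and hc: "continuous_map P S h"
    by (rule free_group_pullback[OF H f]) blast
  obtain k where k: "k \<in> hom G ?F" "continuous_map T P k"
      and ki: "\<And>x. x \<in> topspace X \<Longrightarrow> frag_of x = k (i x)"
  proof -
    have "\<exists>k. k \<in> hom G ?F \<and> continuous_map T P k \<and> (\<forall>x\<in>topspace X. frag_of x = k (i x))"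
      using A P unfolding free_abelian_topological_group_def by blast
    then show thesis using that by blast
  qed
  show thesis
  proof
    show "h \<circ> k \<in> hom G H"
      using k(1) h by (rule Group.hom_compose)
    show "continuous_map T S (h \<circ> k)"
      using k(2) hc by (rule continuous_map_compose)
    show "f x = (h \<circ> k) (i x)" if "x \<in> topspace X" for x
      using that hf ki by simp
  qed
qed

lemma free_abelian_topological_group_exists:
  fixes X :: "'a topology"
  obtains T where
    "free_abelian_topological_group X (free_Abelian_group (topspace X)) T frag_of"
proof -
  let ?F = "free_Abelian_group (topspace X)"
  interpret F: comm_group ?F by (rule abelian_free_Abelian_group)
  define \<T> where "\<T> = {T. abelian_topological_group ?F T \<and> continuous_map X T frag_of}"
  define T where "T = topology_generated_by {U. \<exists>T\<in>\<T>. openin T U}"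
  have ne: "\<exists>T. T \<in> \<T>"
  proof -
    let ?E = "free_Abelian_group ({}::'a set)" and ?D = "discrete_topology {0 :: 'a \<Rightarrow>\<^sub>0 int}"
    have "carrier ?E = {0}" by (auto simp: free_Abelian_group_def)
    then have "abelian_topological_group ?E ?D"
      by (auto simp: abelian_topological_group_def abelian_free_Abelian_group
            simp flip: prod_topology_discrete_topology)
    moreover have "continuous_map X ?D (\<lambda>x. 0)" by simp
    ultimately obtain P where "abelian_topological_group ?F P" "continuous_map X P frag_of"
      by (rule free_group_pullback) blast
    then have "P \<in> \<T>" by (simp add: \<T>_def)
    then show ?thesis ..
  qed
  have sp: "topspace T' = carrier ?F" if "T' \<in> \<T>" for T'
    using that by (simp add: \<T>_def abelian_topological_group_def)
  have spU: "\<Union>{U. \<exists>T\<in>\<T>. openin T U} = carrier ?F"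
  proof
    show "\<Union>{U. \<exists>T\<in>\<T>. openin T U} \<subseteq> carrier ?F"
      using sp by (blast dest: openin_subset)
    obtain T' where T': "T' \<in> \<T>" using ne by blast
    then have "carrier ?F \<in> {U. \<exists>T\<in>\<T>. openin T U}"
      using sp[OF T'] openin_topspace[of T'] by auto
    then show "carrier ?F \<subseteq> \<Union>{U. \<exists>T\<in>\<T>. openin T U}" by (rule Union_upper)
  qed
  then have spT: "topspace T = carrier ?F"
    by (simp only: T_def topology_generated_by_topspace)
  have fine: "continuous_map T T' id" if T': "T' \<in> \<T>" for T'
    unfolding continuous_map_def
  proof (intro conjI allI impI)
    show "id \<in> topspace T \<rightarrow> topspace T'" using sp[OF T'] spT by simp
    fix U assume U: "openin T' U"
    then have "{x \<in> topspace T. id x \<in> U} = U"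
      using openin_subset[OF U] unfolding sp[OF T'] spT by (auto simp del: carrier_free_Abelian_group_iff)
    moreover have "openin T U"
      unfolding T_def by (rule topology_generated_by_Basis) (use U T' in blast)
    ultimately show "openin T {x \<in> topspace T. id x \<in> U}" by simp
  qed
  have intoT: "continuous_map Z T g"
    if g: "\<And>T'. T' \<in> \<T> \<Longrightarrow> continuous_map Z T' g" for Z :: "'z topology" and g
    unfolding T_def
  proof (rule continuous_on_generated_topo)
    fix U assume "U \<in> {U. \<exists>T\<in>\<T>. openin T U}"
    then obtain T' where "T' \<in> \<T>" "openin T' U" by blast
    then show "openin Z (g -` U \<inter> topspace Z)"
      using g[of T'] by (simp add: continuous_map_alt)
  next
    obtain T' where T': "T' \<in> \<T>" using ne by blast
    show "g ` topspace Z \<subseteq> \<Union>{U. \<exists>T\<in>\<T>. openin T U}"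
      unfolding spU using continuous_map_image_subset_topspace[OF g[OF T']] sp[OF T'] by simp
  qed
  have "continuous_map (prod_topology T T) T (\<lambda>(x, y). x \<otimes>\<^bsub>?F\<^esub> y)"
  proof (rule intoT)
    fix T' assume T': "T' \<in> \<T>"
    have "continuous_map (prod_topology T T) (prod_topology T' T') (\<lambda>(x, y). (id x, id y))"
      unfolding continuous_map_prod_top using fine[OF T'] by (simp add: id_def)
    moreover have "continuous_map (prod_topology T' T') T' (\<lambda>(x, y). x \<otimes>\<^bsub>?F\<^esub> y)"
      using T' by (simp add: \<T>_def abelian_topological_group_def)
    ultimately have "continuous_map (prod_topology T T) T'
        ((\<lambda>(x, y). x \<otimes>\<^bsub>?F\<^esub> y) \<circ> (\<lambda>(x, y). (id x, id y)))"
      by (rule continuous_map_compose)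
    then show "continuous_map (prod_topology T T) T' (\<lambda>(x, y). x \<otimes>\<^bsub>?F\<^esub> y)"
      by (rule continuous_map_eq) auto
  qed
  moreover have "continuous_map T T (\<lambda>x. inv\<^bsub>?F\<^esub> x)"
  proof (rule intoT)
    fix T' assume T': "T' \<in> \<T>"
    then have "continuous_map T' T' (\<lambda>x. inv\<^bsub>?F\<^esub> x)"
      by (simp add: \<T>_def abelian_topological_group_def)
    then have "continuous_map T T' ((\<lambda>x. inv\<^bsub>?F\<^esub> x) \<circ> id)"
      using fine[OF T'] by (rule continuous_map_compose[rotated])
    then show "continuous_map T T' (\<lambda>x. inv\<^bsub>?F\<^esub> x)" by simp
  qed
  ultimately have grp: "abelian_topological_group ?F T"
    using spT by (simp add: abelian_topological_group_def F.comm_group_axioms)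
  have frag: "continuous_map X T frag_of"
    by (rule intoT) (simp add: \<T>_def)
  have gen: "generate ?F (frag_of ` topspace X) = carrier ?F"
  proof
    have sub: "frag_of ` topspace X \<subseteq> carrier ?F" by auto
    then show "generate ?F (frag_of ` topspace X) \<subseteq> carrier ?F"
      by (rule F.generate_incl)
    have sg: "subgroup (generate ?F (frag_of ` topspace X)) ?F"
      using sub by (rule F.generate_is_subgroup)
    show "carrier ?F \<subseteq> generate ?F (frag_of ` topspace X)"
    proof
      fix c assume "c \<in> carrier ?F"
      then have "Poly_Mapping.keys c \<subseteq> topspace X" by simp
      then show "c \<in> generate ?F (frag_of ` topspace X)"
      proof (rule free_Abelian_group_induct)
        show "0 \<in> generate ?F (frag_of ` topspace X)"
          using subgroup.one_closed[OF sg] by simp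
      next
        fix x y
        assume y: "Poly_Mapping.keys y \<subseteq> topspace X"
          and xy: "x \<in> generate ?F (frag_of ` topspace X)" "y \<in> generate ?F (frag_of ` topspace X)"
        have "x \<otimes>\<^bsub>?F\<^esub> inv\<^bsub>?F\<^esub> y \<in> generate ?F (frag_of ` topspace X)"
          by (rule subgroup.m_closed[OF sg xy(1) subgroup.m_inv_closed[OF sg xy(2)]])
        then show "x - y \<in> generate ?F (frag_of ` topspace X)" using y by simp
      next
        fix a assume "a \<in> topspace X"
        then show "frag_of a \<in> generate ?F (frag_of ` topspace X)"
          by (intro generate.incl) simp
      qed
    qed
  qed
  have "\<exists>h. h \<in> hom ?F H \<and> continuous_map T S h \<and> (\<forall>x\<in>topspace X. f x = h (frag_of x))"
    if H: "abelian_topological_group H S" and f: "continuous_map X S f"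
    for H :: "('a \<Rightarrow>\<^sub>0 int) monoid" and S f
  proof -
    obtain h P where h: "h \<in> hom ?F H" "\<And>x. x \<in> topspace X \<Longrightarrow> h (frag_of x) = f x"
      and P0: "abelian_topological_group ?F P" "continuous_map X P frag_of"
      and hc: "continuous_map P S h"
      by (rule free_group_pullback[OF H f]) blast
    from P0 have P: "P \<in> \<T>" by (simp add: \<T>_def)
    have "continuous_map T S (h \<circ> id)"
      using fine[OF P] hc by (rule continuous_map_compose)
    with h show ?thesis by auto
  qed
  with grp frag gen have "free_abelian_topological_group X ?F T frag_of"
    unfolding free_abelian_topological_group_def by blast
  then show thesis by (rule that)
qed

lemma hom_eq_combination:
  assumes G: "comm_group G" and h: "h \<in> hom (free_Abelian_group V) G"
    and hi: "\<And>x. x \<in> V \<Longrightarrow> h (frag_of x) = i x" and c: "Poly_Mapping.keys c \<subseteq> V"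
  shows "h c = combination G i c"
proof -
  let ?F = "free_Abelian_group V"
  interpret G: comm_group G by fact
  interpret F: comm_group ?F by (rule abelian_free_Abelian_group)
  interpret h: group_hom ?F G h
    using h by (simp add: group_hom_def group_hom_axioms_def F.is_group G.is_group)
  have iV: "i x \<in> carrier G" if "x \<in> V" for x
    using that hi[OF that] h.hom_closed[of "frag_of x"] by simp
  have "h (\<Sum>x\<in>K. frag_cmul (n x) (frag_of x)) = (\<Otimes>\<^bsub>G\<^esub>x\<in>K. i x [^]\<^bsub>G\<^esub> (n x :: int))"
    if "finite K" "K \<subseteq> V" for K n
    using that
  proof (induction K)
    case empty
    then show ?case using h.hom_one by simp
  next
    case (insert a K)
    let ?s = "\<Sum>x\<in>K. frag_cmul (n x) (frag_of x)"
    have car: "frag_cmul (n a) (frag_of a) \<in> carrier ?F" "?s \<in> carrier ?F"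
    proof -
      have *: "frag_cmul (n x) (frag_of x) \<in> carrier ?F" if "x \<in> V" for x
        using keys_cmul[of "n x" "frag_of x"] that by (auto simp: keys_frag_of)
      show "frag_cmul (n a) (frag_of a) \<in> carrier ?F" using * insert by blast
      show "?s \<in> carrier ?F"
        by (rule sum_closed_free_Abelian_group) (use * insert in blast)
    qed
    have "h (frag_cmul (n a) (frag_of a)) = h (frag_of a [^]\<^bsub>?F\<^esub> n a)"
      using insert by simp
    also have "\<dots> = i a [^]\<^bsub>G\<^esub> n a"
      using insert hi by (subst h.hom_int_pow) auto
    finally have *: "h (frag_cmul (n a) (frag_of a)) = i a [^]\<^bsub>G\<^esub> n a" .
    have "h (\<Sum>x\<in>insert a K. frag_cmul (n x) (frag_of x)) =
        h (frag_cmul (n a) (frag_of a) \<otimes>\<^bsub>?F\<^esub> ?s)"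
      using insert by simp
    also have "\<dots> = i a [^]\<^bsub>G\<^esub> n a \<otimes>\<^bsub>G\<^esub> h ?s"
      using car * by (simp only: h.hom_mult)
    finally show ?case
      using insert iV by (subst G.finprod_insert) auto
  qed
  from this[OF finite_keys c, of "Poly_Mapping.lookup c"]
  have "h (frag_extend frag_of c) = combination G i c"
    by (simp only: combination_def frag_extend_def)
  then show ?thesis by (simp only: frag_expansion[symmetric])
qed

lemma reduced_form_ex1:
  fixes X :: "'a topology"
  assumes A: "free_abelian_topological_group X G T i" and g: "g \<in> carrier G"
  shows "\<exists>!c. Poly_Mapping.keys c \<subseteq> topspace X \<and> combination G i c = g"
proof -
  let ?F = "free_Abelian_group (topspace X)"
  interpret F: comm_group ?F by (rule abelian_free_Abelian_group)
  interpret G: comm_group G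
    using A by (simp add: free_abelian_topological_group_def abelian_topological_group_def)
  have gen: "generate G (i ` topspace X) = carrier G"
    using A by (simp add: free_abelian_topological_group_def)
  have iX: "i ` topspace X \<subseteq> carrier G"
    unfolding gen[symmetric] by (blast intro: generate.incl)
  obtain h where hom: "h \<in> hom ?F G" and hi: "\<And>x. x \<in> topspace X \<Longrightarrow> h (frag_of x) = i x"
    by (rule G.free_Abelian_group_universal[OF iX]) blast
  interpret h: group_hom ?F G h
    using hom by (simp add: group_hom_def group_hom_axioms_def F.is_group G.is_group)
  have eq: "combination G i c = h c" if "Poly_Mapping.keys c \<subseteq> topspace X" for c
    using hom_eq_combination[OF G.comm_group_axioms hom hi that] by simp
  have "carrier G \<subseteq> h ` carrier ?F"
  proof -
    have "i ` topspace X \<subseteq> h ` carrier ?F"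
    proof
      fix y assume "y \<in> i ` topspace X"
      then obtain x where "x \<in> topspace X" "y = h (frag_of x)" using hi by auto
      then show "y \<in> h ` carrier ?F" by simp
    qed
    then have "generate G (i ` topspace X) \<subseteq> h ` carrier ?F"
      by (rule G.generate_subgroup_incl[OF _ h.img_is_subgroup])
    with gen show ?thesis by simp
  qed
  obtain c where c: "Poly_Mapping.keys c \<subseteq> topspace X" "h c = g"
  proof -
    from g have "g \<in> h ` carrier ?F" using \<open>carrier G \<subseteq> h ` carrier ?F\<close> by blast
    then show thesis using that by auto
  qed
  obtain k where "k \<in> hom G ?F" and ki: "\<And>x. x \<in> topspace X \<Longrightarrow> frag_of x = k (i x)"
  proof -
    obtain T' where "free_abelian_topological_group X ?F T' frag_of"
      by (rule free_abelian_topological_group_exists)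
    then have "abelian_topological_group ?F T'" "continuous_map X T' frag_of"
      by (auto simp: free_abelian_topological_group_def)
    from free_abelian_topological_group_universal[OF A this] that show thesis by blast
  qed
  then interpret k: group_hom G ?F k
    by (simp add: group_hom_def group_hom_axioms_def F.is_group G.is_group)
  have kh: "k (h c) = c" if "Poly_Mapping.keys c \<subseteq> topspace X" for c
    using that
  proof (rule free_Abelian_group_induct)
    show "k (h 0) = 0" using h.hom_one k.hom_one by simp
  next
    fix x y
    assume xy: "Poly_Mapping.keys x \<subseteq> topspace X" "Poly_Mapping.keys y \<subseteq> topspace X"
      "k (h x) = x" "k (h y) = y"
    then have car: "x \<in> carrier ?F" "y \<in> carrier ?F" by auto
    then have "k (h (x \<otimes>\<^bsub>?F\<^esub> inv\<^bsub>?F\<^esub> y)) = k (h x) \<otimes>\<^bsub>?F\<^esub> inv\<^bsub>?F\<^esub> (k (h y))"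
      by (simp only: h.hom_mult k.hom_mult h.hom_inv k.hom_inv F.inv_closed h.hom_closed G.inv_closed)
    then show "k (h (x - y)) = x - y" using xy by simp
  next
    fix a assume "a \<in> topspace X"
    then show "k (h (frag_of a)) = frag_of a" using hi ki by simp
  qed
  show ?thesis
  proof (rule ex1I[of _ c])
    show "Poly_Mapping.keys c \<subseteq> topspace X \<and> combination G i c = g"
      using c eq by simp
    fix d assume d: "Poly_Mapping.keys d \<subseteq> topspace X \<and> combination G i d = g"
    have "h d = h c" using c(2) d eq[of d] by simp
    then show "d = c" using kh[of d] kh[of c] c d by simp
  qed
qed

end

(*
  The topology of A(X) is the finest group topology for which X -> A(X) is continuous, so every
  filter base at 0 that satisfies the group axioms and makes this map continuous consists of
  neighbourhoods of 0.

  Sufficiency. If X is locally compact and NI(X) is separable, then NI(X) lies in a clopen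
  k_omega-subspace Y with discrete complement, and the sets with relatively open trace on the compact
  sets of sums of at most n elements of Y and -Y form such a filter base; hence A(X) itself is a
  k-space, and A_n(X) is closed in it. If NI(X) is compact, all neighbourhoods of the diagonal of X
  are controlled by one metric rho; an element of A_n(X) that is a sum of differences x - y of small
  total rho-length is also such a sum with boundedly many terms, so A_n(X) is first countable.
  Since A(X) is completely regular, k-spaces among its subspaces are k_R-spaces.

  Necessity. If condition (5) fails, there are elements e_j = (p_j - q_j) + (a_j - b_j) with 0 in
  their closure, and bump functions at p_j and b_j whose induced homomorphisms u_j, v_j satisfy
  |u_j(e_j) v_j(e_j)| = 1, such that only finitely many products u_j v_j are non-zero on a given
  compact set. The sum of the functions |u_j v_j| is then continuous on compact sets and
  discontinuous at 0.
*)

theory Submission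
  imports Defs
begin

section \<open>Topological Abelian groups are completely regular\<close>

text \<open>Open sets of \<open>A(X)\<close> are never described explicitly: continuity is tested
  through seminorms and filter bases, and only on differences of two generators. The constant 4
  comes from the counterexamples: \<open>e_j\<close> gets close to 0 by two differences of length 2,
  one tracked at \<open>p_j\<close> and one at \<open>b_j\<close>. A compact set can meet infinitely
  many members of a single family of bumps; only the joint condition singles out finitely many
  \<open>j\<close>. What limits a compact set is that a locally finite family of bumps gives a
  continuous seminorm for arbitrary weights: if infinitely many bumps were hit, suitable weights
  would make the seminorm unbounded on the compact set. For compact NI(X), bounded length is
  decisive: a small total rho-length alone need not place a sum in a given neighbourhood of 0; after
  cancellation, with the number of terms bounded by n, a neighbourhood can be shared out among the
  terms. The Tychonoff property belongs to the k_R-property, while no separation is imposed on group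
  topologies; it is derived from Birkhoff-Kakutani seminorms and from bumps that read off single
  coefficients.\<close>

locale additive_topological_group =
  fixes T :: "'b::ab_group_add topology"
  assumes zero_in: "0 \<in> topspace T"
    and diff_cont: "continuous_map (prod_topology T T) T (\<lambda>(x, y). x - y)"
begin

lemma diff_in: "x \<in> topspace T \<Longrightarrow> y \<in> topspace T \<Longrightarrow> x - y \<in> topspace T"
  using continuous_map_funspace[OF diff_cont] by (auto simp: Pi_iff)

lemma minus_in: "x \<in> topspace T \<Longrightarrow> - x \<in> topspace T"
  using diff_in[OF zero_in, of x] by simp

lemma add_in: "x \<in> topspace T \<Longrightarrow> y \<in> topspace T \<Longrightarrow> x + y \<in> topspace T"
  using diff_in[of x "- y"] minus_in by simp

lemma continuous_diff:
  assumes "continuous_map Z T f" "continuous_map Z T g"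
  shows "continuous_map Z T (\<lambda>z. f z - g z)"
  using continuous_map_compose[OF continuous_map_pairedI[OF assms] diff_cont] by (simp add: o_def)

lemma continuous_uminus:
  assumes "continuous_map Z T f"
  shows "continuous_map Z T (\<lambda>z. - f z)"
  using continuous_diff[of Z "\<lambda>_. 0" f] assms zero_in by simp

lemma continuous_add:
  assumes "continuous_map Z T f" "continuous_map Z T g"
  shows "continuous_map Z T (\<lambda>z. f z + g z)"
  using continuous_diff[OF assms(1) continuous_uminus[OF assms(2)]] by simp

lemma openin_translate:
  assumes "openin T U" "g \<in> topspace T"
  shows "openin T {h \<in> topspace T. h - g \<in> U}"
  using continuous_diff[of T "\<lambda>h. h" "\<lambda>_. g"] assms
  by (simp add: openin_continuous_map_preimage)

lemma open_diff_nbhd: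
  assumes "openin T U" "0 \<in> U"
  obtains V where "openin T V" "0 \<in> V" "V \<subseteq> U" "\<And>x y. x \<in> V \<Longrightarrow> y \<in> V \<Longrightarrow> x - y \<in> U"
proof -
  have "openin (prod_topology T T) {z \<in> topspace (prod_topology T T). (case z of (x, y) \<Rightarrow> x - y) \<in> U}"
    using openin_continuous_map_preimage[OF diff_cont assms(1)] .
  moreover have "(0, 0) \<in> {z \<in> topspace (prod_topology T T). (case z of (x, y) \<Rightarrow> x - y) \<in> U}"
    using assms zero_in by simp
  ultimately obtain V W where VW: "openin T V" "openin T W" "0 \<in> V" "0 \<in> W"
    "V \<times> W \<subseteq> {z \<in> topspace (prod_topology T T). (case z of (x, y) \<Rightarrow> x - y) \<in> U}"
    unfolding openin_prod_topology_alt by meson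
  show thesis
  proof (rule that[of "V \<inter> W"])
    show "V \<inter> W \<subseteq> U" using VW(4,5) by force
  qed (use VW in auto)
qed

lemma open_symmetric_nbhd:
  assumes "openin T U" "0 \<in> U"
  obtains V where "openin T V" "0 \<in> V" "V \<subseteq> U" "\<And>x. x \<in> V \<Longrightarrow> - x \<in> V"
    "\<And>x y. x \<in> V \<Longrightarrow> y \<in> V \<Longrightarrow> x + y \<in> U"
proof -
  obtain V where V: "openin T V" "0 \<in> V" "V \<subseteq> U" "\<And>x y. x \<in> V \<Longrightarrow> y \<in> V \<Longrightarrow> x - y \<in> U"
    using open_diff_nbhd[OF assms] by metis
  let ?W = "V \<inter> {x \<in> topspace T. - x \<in> V}"
  have "openin T ?W"
    using V(1) continuous_uminus[of T "\<lambda>x. x"] by (auto intro: openin_continuous_map_preimage)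
  then show thesis
  proof (rule that)
    show "- x \<in> ?W" if "x \<in> ?W" for x
      using that openin_subset[OF V(1)] by auto
    show "x + y \<in> U" if "x \<in> ?W" "y \<in> ?W" for x y
      using V(4)[of x "- y"] that by simp
  qed (use V zero_in in auto)
qed

text \<open>Subadditivity for differences and \<open>N 0 = 0\<close> give
  \<open>N (- x) \<le> N x\<close>, hence \<open>\<bar>N x - N y\<bar> \<le> N (x - y)\<close>.
  Smallness near 0 is thereby translated to continuity at every point.\<close>

lemma seminorm_continuous:
  fixes N :: "'b \<Rightarrow> real"
  assumes N0: "N 0 = 0"
    and sub: "\<And>x y. x \<in> topspace T \<Longrightarrow> y \<in> topspace T \<Longrightarrow> N (x - y) \<le> N x + N y"
    and small: "\<And>\<epsilon>. \<epsilon> > 0 \<Longrightarrow> \<exists>U. openin T U \<and> 0 \<in> U \<and> (\<forall>x\<in>U. N x < \<epsilon>)"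
  shows "continuous_map T euclideanreal N"
  unfolding continuous_map_def
proof (intro conjI allI impI)
  have minus: "N (- x) \<le> N x" if "x \<in> topspace T" for x
    using sub[OF zero_in that] N0 by simp
  have diff: "\<bar>N x - N y\<bar> \<le> N (x - y)" if "x \<in> topspace T" "y \<in> topspace T" for x y
  proof -
    have "N x \<le> N (x - y) + N y"
      using sub[of "x - y" "- y"] minus[of y] that diff_in minus_in by force
    moreover have "N y \<le> N (x - y) + N x"
      using sub[of x "x - y"] that diff_in by (force simp: algebra_simps)
    ultimately show ?thesis by linarith
  qed
  fix V :: "real set" assume "openin euclideanreal V"
  then have V: "open V" by simp
  show "openin T {x \<in> topspace T. N x \<in> V}"
    unfolding openin_subopen[of T "{x \<in> topspace T. N x \<in> V}"]
  proof
    fix g assume "g \<in> {x \<in> topspace T. N x \<in> V}"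
    then have g: "g \<in> topspace T" "N g \<in> V" by auto
    then obtain \<epsilon> where e: "\<epsilon> > 0" "\<And>y. dist y (N g) < \<epsilon> \<Longrightarrow> y \<in> V"
      using V unfolding open_dist by blast
    obtain U where U: "openin T U" "0 \<in> U" "\<And>x. x \<in> U \<Longrightarrow> N x < \<epsilon>"
      using small[OF e(1)] by blast
    have "{h \<in> topspace T. h - g \<in> U} \<subseteq> {x \<in> topspace T. N x \<in> V}"
    proof clarify
      fix h assume h: "h \<in> topspace T" "h - g \<in> U"
      have "\<bar>N h - N g\<bar> < \<epsilon>"
        using diff[OF h(1) g(1)] U(3)[OF h(2)] by linarith
      then show "N h \<in> V" by (intro e(2)) (simp add: dist_real_def)
    qed
    then show "\<exists>W. openin T W \<and> g \<in> W \<and> W \<subseteq> {x \<in> topspace T. N x \<in> V}"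
      using openin_translate[OF U(1) g(1)] g U(2) by (intro exI conjI) auto
  qed
qed auto

end

text \<open>The pivot \<open>x\<close> is the entry at which the partial sums cross half of the
  total weight. The two remaining lists are light enough for an induction that moves one dyadic
  level down.\<close>

lemma split_at_half_weight:
  fixes w :: "'c \<Rightarrow> real"
  assumes "\<And>x. w x > 0" "l \<noteq> []"
  obtains l1 x l2 where "l = l1 @ x # l2" "(\<Sum>y\<leftarrow>l1. w y) \<le> (\<Sum>y\<leftarrow>l. w y) / 2"
    "(\<Sum>y\<leftarrow>l2. w y) \<le> (\<Sum>y\<leftarrow>l. w y) / 2"
proof -
  have *: "\<exists>l1 x l2. l = l1 @ x # l2 \<and> (\<Sum>y\<leftarrow>l1. w y) \<le> s \<and> s \<le> (\<Sum>y\<leftarrow>l1. w y) + w x"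
    if "l \<noteq> []" "0 \<le> s" "s \<le> (\<Sum>y\<leftarrow>l. w y)" for s and l :: "'c list"
    using that
  proof (induction l arbitrary: s)
    case (Cons a l)
    show ?case
    proof (cases "s \<le> w a")
      case True
      then show ?thesis using Cons.prems by (intro exI[of _ "[]"] exI[of _ a] exI[of _ l]) auto
    next
      case False
      then have "l \<noteq> []" using Cons.prems by auto
      then obtain l1 x l2 where "l = l1 @ x # l2" "(\<Sum>y\<leftarrow>l1. w y) \<le> s - w a"
        "s - w a \<le> (\<Sum>y\<leftarrow>l1. w y) + w x"
        using Cons.IH[of "s - w a"] False Cons.prems by auto
      then show ?thesis
        by (intro exI[of _ "a # l1"] exI[of _ x] exI[of _ l2]) auto
    qed
  qed simp
  moreover have "0 \<le> (\<Sum>y\<leftarrow>l. w y)"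
    using assms(1) by (intro sum_list_nonneg) (auto intro: less_imp_le)
  ultimately obtain l1 x l2 where **: "l = l1 @ x # l2" "(\<Sum>y\<leftarrow>l1. w y) \<le> (\<Sum>y\<leftarrow>l. w y) / 2"
    "(\<Sum>y\<leftarrow>l. w y) / 2 \<le> (\<Sum>y\<leftarrow>l1. w y) + w x"
    using *[OF assms(2), of "(\<Sum>y\<leftarrow>l. w y) / 2"] by auto
  show thesis
    by (rule that[OF **(1,2)]) (use ** in auto)
qed

context additive_topological_group
begin

text \<open>The Birkhoff--Kakutani construction: \<open>N g\<close> is twice the infimum of \<open>\<Sum> 2\<^sup>-\<^sup>j\<close> over all ways to write
  \<open>g\<close> as a sum of elements of the neighbourhoods \<open>V\<^sub>j\<close>, where \<open>V\<^sub>j\<^sub>+\<^sub>1 + V\<^sub>j\<^sub>+\<^sub>1 + V\<^sub>j\<^sub>+\<^sub>1 \<subseteq> V\<^sub>j\<close>.\<close>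

lemma continuous_seminorm_below_nbhd:
  assumes U: "openin T U" "0 \<in> U"
  obtains N :: "'b \<Rightarrow> real" where "continuous_map T euclideanreal N" "N 0 = 0"
    "\<And>x. x \<in> topspace T \<Longrightarrow> N x \<ge> 0" "\<And>x. x \<in> topspace T \<Longrightarrow> N x < 1 \<Longrightarrow> x \<in> U"
proof -
  have "\<exists>V. openin T V \<and> 0 \<in> V \<and> (\<forall>x\<in>V. - x \<in> V) \<and> (\<forall>x\<in>V. \<forall>y\<in>V. \<forall>z\<in>V. x + y + z \<in> W)"
    if W: "openin T W" "0 \<in> W" for W
  proof -
    obtain V1 where V1: "openin T V1" "0 \<in> V1" "V1 \<subseteq> W" "\<And>x y. x \<in> V1 \<Longrightarrow> y \<in> V1 \<Longrightarrow> x + y \<in> W"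
      using open_symmetric_nbhd[OF W] by metis
    obtain V2 where V2: "openin T V2" "0 \<in> V2" "V2 \<subseteq> V1" "\<And>x. x \<in> V2 \<Longrightarrow> - x \<in> V2"
      "\<And>x y. x \<in> V2 \<Longrightarrow> y \<in> V2 \<Longrightarrow> x + y \<in> V1"
      using open_symmetric_nbhd[OF V1(1,2)] by metis
    then show ?thesis using V1 by (intro exI[of _ V2]) blast
  qed
  then have step: "\<exists>V. (openin T V \<and> 0 \<in> V \<and> (\<forall>x\<in>V. - x \<in> V)) \<and>
        (\<forall>x\<in>V. \<forall>y\<in>V. \<forall>z\<in>V. x + y + z \<in> W)"
    if "openin T W \<and> 0 \<in> W \<and> (\<forall>x\<in>W. - x \<in> W)" for W
    using that by metis
  obtain U' where U': "openin T U'" "0 \<in> U'" "U' \<subseteq> U" "\<And>x. x \<in> U' \<Longrightarrow> - x \<in> U'"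
    using open_symmetric_nbhd[OF U] by metis
  obtain V0 where V0: "V0 0 = U'" "\<And>n. openin T (V0 n) \<and> 0 \<in> V0 n \<and> (\<forall>x\<in>V0 n. - x \<in> V0 n)"
    "\<And>n. (\<forall>x\<in>V0 (Suc n). \<forall>y\<in>V0 (Suc n). \<forall>z\<in>V0 (Suc n). x + y + z \<in> V0 n)"
  proof -
    have "\<exists>f. \<forall>n. (openin T (f n) \<and> 0 \<in> f n \<and> (\<forall>x\<in>f n. - x \<in> f n) \<and> (n = 0 \<longrightarrow> f n = U')) \<and>
       (\<forall>x\<in>f (Suc n). \<forall>y\<in>f (Suc n). \<forall>z\<in>f (Suc n). x + y + z \<in> f n)"
    proof (rule dependent_nat_choice)
      show "\<exists>x. openin T x \<and> 0 \<in> x \<and> (\<forall>xa\<in>x. - xa \<in> x) \<and> ((0::nat) = 0 \<longrightarrow> x = U')"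
        using U' by blast
    next
      fix W n assume "openin T W \<and> 0 \<in> W \<and> (\<forall>xa\<in>W. - xa \<in> W) \<and> ((n::nat) = 0 \<longrightarrow> W = U')"
      then show "\<exists>y. (openin T y \<and> 0 \<in> y \<and> (\<forall>x\<in>y. - x \<in> y) \<and> (Suc n = 0 \<longrightarrow> y = U')) \<and>
           (\<forall>xa\<in>y. \<forall>ya\<in>y. \<forall>z\<in>y. xa + ya + z \<in> W)"
        using step[of W] by auto
    qed
    then show thesis using that by metis
  qed
  \<comment> \<open>Level 0 is the whole group, so that every element is a one-term sum of weight 1
    and the infimum runs over a non-empty set. The given neighbourhood sits at level 1; the factor 2
    in \<open>N\<close> makes up for this shift, as \<open>N x < 1\<close> means a total weight
    below 1/2.\<close>
  define V where "V n = (case n of 0 \<Rightarrow> topspace T | Suc m \<Rightarrow> V0 m)" for n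
  have Vopen: "openin T (V n)" and V0in: "0 \<in> V n" and Vminus: "\<And>x. x \<in> V n \<Longrightarrow> - x \<in> V n" for n
    using V0(2) zero_in minus_in by (auto simp: V_def split: nat.split)
  have V3: "x + y + z \<in> V n" if "x \<in> V (Suc n)" "y \<in> V (Suc n)" "z \<in> V (Suc n)" for x y z n
  proof (cases n)
    case 0
    then have "{x, y, z} \<subseteq> topspace T"
      using that openin_subset[of T "V0 0"] V0(2)[of 0] by (auto simp: V_def)
    then show ?thesis using 0 by (auto simp: V_def intro: add_in)
  next
    case (Suc m)
    then show ?thesis using that V0(3)[of m] by (auto simp: V_def)
  qed
  have Vdec: "V (Suc n) \<subseteq> V n" for n
    using V3[of _ n 0 0] V0in by auto
  then have Vmono: "V n \<subseteq> V m" if "m \<le> n" for m n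
    using lift_Suc_antimono_le[of V, OF _ that] by blast
  let ?w = "\<lambda>p::nat \<times> 'b. (1/2::real) ^ fst p"
  define good where "good l \<longleftrightarrow> (\<forall>p\<in>set l. snd p \<in> V (fst p))" for l :: "(nat \<times> 'b) list"
  \<comment> \<open>A list of weight below \<open>(1/2) ^ n\<close> splits into a pivot and two
    lists of weight below \<open>(1/2) ^ Suc n\<close>, whose sums lie in \<open>V (Suc n)\<close>
    by induction. The weight of the pivot is below \<open>(1/2) ^ n\<close>, so its level is at
    least \<open>Suc n\<close>; then \<open>V3\<close> applies.\<close>
  have key: "(\<Sum>p\<leftarrow>l. snd p) \<in> V n" if "good l" "(\<Sum>p\<leftarrow>l. ?w p) < (1/2) ^ n" for l n
    using that
  proof (induction l arbitrary: n rule: length_induct)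
    case (1 l)
    show ?case
    proof (cases "l = []")
      case True
      then show ?thesis using V0in by simp
    next
      case False
      obtain l1 p l2 where l: "l = l1 @ p # l2" "(\<Sum>y\<leftarrow>l1. ?w y) \<le> (\<Sum>y\<leftarrow>l. ?w y) / 2"
        "(\<Sum>y\<leftarrow>l2. ?w y) \<le> (\<Sum>y\<leftarrow>l. ?w y) / 2"
        using split_at_half_weight[of ?w l] False by (metis zero_less_power zero_less_divide_1_iff zero_less_numeral)
      have pos: "0 \<le> (\<Sum>y\<leftarrow>l. ?w y)" for l :: "(nat \<times> 'b) list"
        by (intro sum_list_nonneg) auto
      have "(\<Sum>y\<leftarrow>l1. snd y) \<in> V (Suc n)" "(\<Sum>y\<leftarrow>l2. snd y) \<in> V (Suc n)"
        using 1 l by (auto simp: good_def)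
      moreover have "snd p \<in> V (Suc n)"
      proof -
        have "?w p \<le> (\<Sum>y\<leftarrow>l. ?w y)"
          using pos[of l1] pos[of l2] by (simp add: l(1))
        then have "?w p < (1/2) ^ n"
          using 1(3) by linarith
        then have "n < fst p"
          by (simp add: power_strict_decreasing_iff)
        then show ?thesis using Vmono[of "Suc n" "fst p"] 1(2) l(1) by (auto simp: good_def)
      qed
      ultimately have "(\<Sum>y\<leftarrow>l1. snd y) + snd p + (\<Sum>y\<leftarrow>l2. snd y) \<in> V n"
        by (intro V3)
      then show ?thesis by (simp add: l(1) add.assoc)
    qed
  qed
  define R where "R x = {(\<Sum>p\<leftarrow>l. ?w p) |l. good l \<and> (\<Sum>p\<leftarrow>l. snd p) = x}" for x
  define N where "N x = 2 * Inf (R x)" for x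
  have Rpos: "r \<ge> 0" if "r \<in> R x" for r x
    using that by (auto simp: R_def intro!: sum_list_nonneg)
  then have Rbdd: "bdd_below (R x)" for x
    by (meson bdd_belowI)
  have Rne: "R x \<noteq> {}" if "x \<in> topspace T" for x
  proof -
    have "(1/2::real)^0 \<in> R x"
      using that unfolding R_def by (auto simp: good_def V_def intro!: exI[of _ "[(0, x)]"])
    then show ?thesis by blast
  qed
  have Rsub: "\<exists>t\<in>R (x - y). t \<le> r + s" if rR: "r \<in> R x" and sR: "s \<in> R y" for r s x y
  proof -
    obtain l where l: "good l" "(\<Sum>p\<leftarrow>l. snd p) = x" "r = (\<Sum>p\<leftarrow>l. ?w p)"
      using rR by (auto simp: R_def)
    obtain k where k: "good k" "(\<Sum>p\<leftarrow>k. snd p) = y" "s = (\<Sum>p\<leftarrow>k. ?w p)"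
      using sR by (auto simp: R_def)
    let ?k = "map (\<lambda>p. (fst p, - snd p)) k"
    have "good (l @ ?k)" using l k Vminus by (auto simp: good_def)
    moreover have "(\<Sum>p\<leftarrow>l @ ?k. snd p) = x - y"
    proof -
      have "(\<Sum>p\<leftarrow>k. - snd p) = - y"
        unfolding k(2)[symmetric] by (induction k) auto
      then show ?thesis using l by (simp add: o_def)
    qed
    moreover have "(\<Sum>p\<leftarrow>l @ ?k. ?w p) = r + s" using l k by (simp add: o_def)
    ultimately show ?thesis unfolding R_def by force
  qed
  have Nsub: "N (x - y) \<le> N x + N y" if xy: "x \<in> topspace T" "y \<in> topspace T" for x y
  proof -
    have "Inf (R (x - y)) \<le> Inf (R x) + Inf (R y)"
    proof (rule field_le_epsilon)
      fix e :: real assume "e > 0"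
      obtain r s where r: "r \<in> R x" "r < Inf (R x) + e/2" and s: "s \<in> R y" "s < Inf (R y) + e/2"
        using cInf_lessD[OF Rne[OF xy(1)], of "Inf (R x) + e/2"]
          cInf_lessD[OF Rne[OF xy(2)], of "Inf (R y) + e/2"] \<open>e > 0\<close> by auto
      obtain t where t: "t \<in> R (x - y)" "t \<le> r + s" using Rsub[OF r(1) s(1)] by blast
      have "Inf (R (x - y)) \<le> t" using cInf_lower[OF t(1) Rbdd] .
      then show "Inf (R (x - y)) \<le> Inf (R x) + Inf (R y) + e"
        using t r s by linarith
    qed
    then show ?thesis by (simp add: N_def)
  qed
  have Nle: "N x \<le> 2 * (1/2) ^ n" if "x \<in> V n" for x n
  proof -
    have "(1/2::real) ^ n \<in> R x"
      using that unfolding R_def by (auto simp: good_def intro!: exI[of _ "[(n, x)]"])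
    then show ?thesis using cInf_lower[OF _ Rbdd] by (simp add: N_def)
  qed
  have Npos: "N x \<ge> 0" if "x \<in> topspace T" for x
    unfolding N_def using cInf_greatest[OF Rne[OF that], of 0] Rpos by simp
  have N0: "N 0 = 0"
  proof -
    have "0 \<in> R 0" unfolding R_def by (auto simp: good_def intro!: exI[of _ "[]"])
    then have "Inf (R 0) \<le> 0" using cInf_lower[OF _ Rbdd] by blast
    then show ?thesis using Npos[OF zero_in] by (simp add: N_def)
  qed
  show thesis
  proof
    show "continuous_map T euclideanreal N"
    proof (rule seminorm_continuous[of N, OF N0 Nsub])
      fix e :: real assume "e > 0"
      then obtain n where "(1/2::real) ^ n < e/2"
        using real_arch_pow_inv[of "e/2" "1/2"] by auto
      then show "\<exists>U. openin T U \<and> 0 \<in> U \<and> (\<forall>x\<in>U. N x < e)"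
        using Vopen[of n] V0in[of n] Nle[of _ n] by (intro exI[of _ "V n"]) force
    qed
    show "x \<in> U" if x: "x \<in> topspace T" "N x < 1" for x
    proof -
      have "Inf (R x) < 1/2" using x by (simp add: N_def)
      then obtain r where "r \<in> R x" "r < 1/2"
        using cInf_lessD[OF Rne[OF x(1)]] by blast
      then have "x \<in> V 1" using key[of _ 1] by (auto simp: R_def)
      then show ?thesis using V0(1) U'(3) by (auto simp: V_def)
    qed
  qed (use Npos N0 in auto)
qed

text \<open>\<open>N (h - g)\<close> vanishes at \<open>h = g\<close> and is at least 1 on
  \<open>C\<close>, because there \<open>h - g\<close> lies outside the neighbourhood of 0 that
  \<open>N\<close> controls.\<close>

lemma completely_regular: "completely_regular_space T"
  unfolding completely_regular_space_def
proof clarify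
  fix C g assume C: "closedin T C" "g \<in> topspace T" "g \<notin> C"
  let ?U = "{h \<in> topspace T. h - (- g) \<in> topspace T - C}"
  have "openin T ?U"
    using C by (intro openin_translate minus_in) auto
  moreover have "0 \<in> ?U" using C zero_in by simp
  ultimately obtain N :: "'b \<Rightarrow> real" where N: "continuous_map T euclideanreal N" "N 0 = 0"
    "\<And>x. x \<in> topspace T \<Longrightarrow> N x \<ge> 0" "\<And>x. x \<in> topspace T \<Longrightarrow> N x < 1 \<Longrightarrow> x \<in> ?U"
    by (rule continuous_seminorm_below_nbhd) blast
  let ?f = "\<lambda>h. min 1 (N (h - g))"
  have "continuous_map T T (\<lambda>h. h - g)"
    using C by (intro continuous_diff) auto
  then have "continuous_map T euclideanreal (\<lambda>h. N (h - g))"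
    using continuous_map_compose[OF _ N(1), of T "\<lambda>h. h - g"] by (simp add: o_def)
  then have cont: "continuous_map T euclideanreal ?f"
    by (intro continuous_map_real_min) auto
  show "\<exists>f. continuous_map T (top_of_set {0..1}) f \<and> f g = 0 \<and> f ` C \<subseteq> {1::real}"
  proof (intro exI[of _ ?f] conjI)
    show "continuous_map T (top_of_set {0..1}) ?f"
      using cont N(3) C diff_in by (auto simp: continuous_map_in_subtopology)
    have "1 \<le> N (h - g)" if "h \<in> C" for h
    proof (rule ccontr)
      assume "\<not> 1 \<le> N (h - g)"
      then have "h - g \<in> ?U" using N(4)[of "h - g"] that C diff_in closedin_subset by fastforce
      then show False using that by simp
    qed
    then show "?f ` C \<subseteq> {1}" by auto
  qed (use N in auto)
qed

end

section \<open>The free Abelian topological group of a metric space\<close>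

definition frags :: "'a set \<Rightarrow> ('a \<Rightarrow>\<^sub>0 int) set" where
  "frags M = {c. Poly_Mapping.keys c \<subseteq> M}"

lemma zero_in_frags [simp]: "0 \<in> frags M"
  by (simp add: frags_def)

lemma frag_of_in_frags [simp]: "frag_of x \<in> frags M \<longleftrightarrow> x \<in> M"
  by (simp add: frags_def keys_frag_of)

lemma diff_in_frags [simp]: "a \<in> frags M \<Longrightarrow> b \<in> frags M \<Longrightarrow> a - b \<in> frags M"
  unfolding frags_def using keys_diff[of a b] by auto

lemma uminus_in_frags [simp]: "- a \<in> frags M \<longleftrightarrow> a \<in> frags M"
  by (simp add: frags_def)

lemma add_in_frags [simp]: "a \<in> frags M \<Longrightarrow> b \<in> frags M \<Longrightarrow> a + b \<in> frags M"
  unfolding frags_def using keys_add[of a b] by auto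

text \<open>The homomorphism into the additive group of the reals that extends
  \<open>u\<close>.\<close>

definition ev :: "('a \<Rightarrow> real) \<Rightarrow> ('a \<Rightarrow>\<^sub>0 int) \<Rightarrow> real" where
  "ev u c = (\<Sum>x\<in>Poly_Mapping.keys c. of_int (Poly_Mapping.lookup c x) * u x)"

lemma ev_superset:
  assumes "finite A" "Poly_Mapping.keys c \<subseteq> A"
  shows "ev u c = (\<Sum>x\<in>A. of_int (Poly_Mapping.lookup c x) * u x)"
  unfolding ev_def using assms by (intro sum.mono_neutral_left) (auto simp: in_keys_iff)

lemma ev_zero [simp]: "ev u 0 = 0"
  by (simp add: ev_def)

lemma ev_frag_of [simp]: "ev u (frag_of x) = u x"
  by (simp add: ev_def keys_frag_of)

lemma ev_diff [simp]: "ev u (a - b) = ev u a - ev u b"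
proof -
  let ?A = "Poly_Mapping.keys a \<union> Poly_Mapping.keys b"
  have "ev u (a - b) = (\<Sum>x\<in>?A. of_int (Poly_Mapping.lookup (a - b) x) * u x)"
    using keys_diff[of a b] by (intro ev_superset) auto
  then show ?thesis
    by (simp add: ev_superset[of ?A a] ev_superset[of ?A b] lookup_minus algebra_simps sum_subtractf)
qed

lemma ev_uminus [simp]: "ev u (- a) = - ev u a"
  using ev_diff[of u 0 a] by simp

lemma ev_add [simp]: "ev u (a + b) = ev u a + ev u b"
  using ev_diff[of u a "- b"] by simp

lemma ev_eq_0: "(\<And>x. x \<in> Poly_Mapping.keys c \<Longrightarrow> u x = 0) \<Longrightarrow> ev u c = 0"
  by (simp add: ev_def)

lemma ev_indicator:
  assumes "u x = 1" "\<And>y. y \<in> Poly_Mapping.keys c \<Longrightarrow> y \<noteq> x \<Longrightarrow> u y = 0"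
  shows "ev u c = of_int (Poly_Mapping.lookup c x)"
proof -
  have "ev u c = (\<Sum>y\<in>insert x (Poly_Mapping.keys c). of_int (Poly_Mapping.lookup c y) * u y)"
    by (intro ev_superset) auto
  also have "\<dots> = (\<Sum>y\<in>insert x (Poly_Mapping.keys c). if y = x then of_int (Poly_Mapping.lookup c x) else 0)"
    using assms by (intro sum.cong) auto
  finally show ?thesis by simp
qed

text \<open>Becomes \<open>reduced_length\<close> once \<open>A(X)\<close> is identified with
  \<open>frags M\<close>.\<close>

definition len :: "('a \<Rightarrow>\<^sub>0 int) \<Rightarrow> nat" where
  "len c = (\<Sum>x\<in>Poly_Mapping.keys c. nat \<bar>Poly_Mapping.lookup c x\<bar>)"

lemma len_superset:
  assumes "finite A" "Poly_Mapping.keys c \<subseteq> A"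
  shows "len c = (\<Sum>x\<in>A. nat \<bar>Poly_Mapping.lookup c x\<bar>)"
  unfolding len_def using assms by (intro sum.mono_neutral_left) (auto simp: in_keys_iff)

lemma len_zero [simp]: "len 0 = 0"
  by (simp add: len_def)

lemma len_frag_of [simp]: "len (frag_of x) = 1"
  by (simp add: len_def keys_frag_of)

lemma len_uminus [simp]: "len (- a) = len a"
  by (simp add: len_def)

lemma len_add: "len (a + b) \<le> len a + len b"
proof -
  let ?A = "Poly_Mapping.keys a \<union> Poly_Mapping.keys b"
  have "len (a + b) = (\<Sum>x\<in>?A. nat \<bar>Poly_Mapping.lookup (a + b) x\<bar>)"
    using keys_add[of a b] by (intro len_superset) auto
  also have "\<dots> \<le> (\<Sum>x\<in>?A. nat \<bar>Poly_Mapping.lookup a x\<bar> + nat \<bar>Poly_Mapping.lookup b x\<bar>)"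
    by (intro sum_mono) (auto simp: lookup_add)
  finally show ?thesis
    by (simp add: len_superset[of ?A a] len_superset[of ?A b] sum.distrib)
qed

lemma len_diff: "len (a - b) \<le> len a + len b"
  using len_add[of a "- b"] by simp

text \<open>A copy of \<open>A(X)\<close> on the fixed carrier of formal combinations.
  \<open>finest\<close> is what the universal property says about the map \<open>frag_of\<close>
  into this same group under a competing group topology.\<close>

locale free_abelian_metric = Metric_space M d for M :: "'a set" and d +
  fixes T :: "('a \<Rightarrow>\<^sub>0 int) topology"
  assumes topspace_T: "topspace T = frags M"
    and diff_continuous: "continuous_map (prod_topology T T) T (\<lambda>(x, y). x - y)"
    and frag_of_continuous: "continuous_map mtopology T frag_of"
    and finest: "\<And>S U. \<lbrakk>topspace S = frags M; continuous_map (prod_topology S S) S (\<lambda>(x, y). x - y);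
        continuous_map mtopology S frag_of; openin S U\<rbrakk> \<Longrightarrow> openin T U"
begin

sublocale additive_topological_group T
  by unfold_locales (use topspace_T diff_continuous in auto)

lemma frag_of_near:
  assumes "openin T U" "0 \<in> U" "x \<in> M"
  obtains r where "r > 0" "\<And>y. y \<in> mball x r \<Longrightarrow> frag_of y - frag_of x \<in> U"
proof -
  have "openin mtopology {y \<in> M. frag_of y - frag_of x \<in> U}"
    using openin_continuous_map_preimage[OF continuous_diff[OF frag_of_continuous] assms(1), of "\<lambda>_. frag_of x"]
      assms topspace_T by simp
  then show thesis
    using assms that unfolding openin_mtopology by (smt (verit) diff_self mem_Collect_eq subset_eq)
qed

text \<open>A filter base at \<open>0\<close> that makes \<^term>\<open>frag_of\<close> continuous defines a group topology, which is
  coarser than the free one.\<close>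

lemma filter_base_nbhd:
  fixes B :: "('a \<Rightarrow>\<^sub>0 int) set set"
  assumes zero: "\<And>W. W \<in> B \<Longrightarrow> 0 \<in> W"
    and inter: "\<And>V W. V \<in> B \<Longrightarrow> W \<in> B \<Longrightarrow> \<exists>Q\<in>B. Q \<subseteq> V \<inter> W"
    and diff: "\<And>W. W \<in> B \<Longrightarrow> \<exists>V\<in>B. \<forall>x\<in>V. \<forall>y\<in>V. x - y \<in> W"
    and near: "\<And>W x. W \<in> B \<Longrightarrow> x \<in> M \<Longrightarrow> \<exists>r>0. \<forall>y\<in>mball x r. frag_of y - frag_of x \<in> W"
    and W: "W \<in> B"
  obtains U where "openin T U" "0 \<in> U" "U \<subseteq> W"
proof -
  define op where "op U \<longleftrightarrow> U \<subseteq> frags M \<and> (\<forall>g\<in>U. \<exists>V\<in>B. \<forall>h\<in>frags M. h - g \<in> V \<longrightarrow> h \<in> U)" for U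
  have "istopology op"
    unfolding istopology_def
  proof (intro conjI allI impI)
    fix S U assume S: "op S" and U: "op U"
    show "op (S \<inter> U)"
      unfolding op_def
    proof (intro conjI ballI)
      fix g assume "g \<in> S \<inter> U"
      then obtain V V' where V: "V \<in> B" "\<forall>h\<in>frags M. h - g \<in> V \<longrightarrow> h \<in> S"
        "V' \<in> B" "\<forall>h\<in>frags M. h - g \<in> V' \<longrightarrow> h \<in> U"
        using S U unfolding op_def by blast
      obtain Q where "Q \<in> B" "Q \<subseteq> V \<inter> V'" using inter[OF V(1,3)] by blast
      then show "\<exists>V\<in>B. \<forall>h\<in>frags M. h - g \<in> V \<longrightarrow> h \<in> S \<inter> U"
        using V by blast
    qed (use S in \<open>auto simp: op_def\<close>)
  next
    fix \<K> assume "\<forall>K\<in>\<K>. op K"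
    then show "op (\<Union>\<K>)"
      unfolding op_def by (simp add: Sup_le_iff) (meson UnionI)
  qed
  define S where "S = topology op"
  have opS: "openin S = op"
    unfolding S_def using \<open>istopology op\<close> by (rule topology_inverse')
  have spS: "topspace S = frags M"
  proof
    show "topspace S \<subseteq> frags M" unfolding topspace_def opS op_def by auto
    have "op (frags M)" unfolding op_def using W by auto
    then show "frags M \<subseteq> topspace S" unfolding topspace_def opS by auto
  qed
  have int: "\<exists>U. openin S U \<and> g \<in> U \<and> (\<forall>h\<in>U. h - g \<in> W)" if "g \<in> frags M" "W \<in> B" for g W
  proof -
    \<comment> \<open>The members of \<open>B\<close> need not be open, so this is the interior of
      \<open>g + W\<close>. Its openness follows from two uses of \<open>diff\<close>, which produce
      an \<open>R\<close> with \<open>R + R\<close> inside \<open>P\<close>.\<close>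
    let ?U = "{h \<in> frags M. \<exists>P\<in>B. \<forall>k\<in>frags M. k - h \<in> P \<longrightarrow> k - g \<in> W}"
    have "op ?U"
      unfolding op_def
    proof (intro conjI ballI)
      fix h assume "h \<in> ?U"
      then obtain P where P: "h \<in> frags M" "P \<in> B" "\<forall>k\<in>frags M. k - h \<in> P \<longrightarrow> k - g \<in> W" by blast
      obtain Q where Q: "Q \<in> B" "\<forall>x\<in>Q. \<forall>y\<in>Q. x - y \<in> P" using diff[OF P(2)] by blast
      obtain R where R: "R \<in> B" "\<forall>x\<in>R. \<forall>y\<in>R. x - y \<in> Q" using diff[OF Q(1)] by blast
      have *: "k - h \<in> P" if "k - h' \<in> R" "h' - h \<in> R" for k h'
      proof -
        have "(k - h') - 0 \<in> Q" "0 - (h' - h) \<in> Q"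
          using R that zero by blast+
        then have "((k - h') - 0) - (0 - (h' - h)) \<in> P" using Q by blast
        then show ?thesis by simp
      qed
      show "\<exists>V\<in>B. \<forall>h'\<in>frags M. h' - h \<in> V \<longrightarrow> h' \<in> ?U"
        using * P R by (intro bexI[of _ R]) blast+
    qed auto
    moreover have "g \<in> ?U" using that by blast
    moreover have "\<forall>h\<in>?U. h - g \<in> W" using zero by fastforce
    ultimately show ?thesis unfolding opS by blast
  qed
  have "continuous_map (prod_topology S S) S (\<lambda>(x, y). x - y)"
    unfolding continuous_map_def
  proof (intro conjI allI impI)
    fix U assume U: "openin S U"
    show "openin (prod_topology S S) {x \<in> topspace (prod_topology S S). (case x of (x, y) \<Rightarrow> x - y) \<in> U}"
      unfolding openin_prod_topology_alt
    proof clarsimp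
      fix a b assume ab: "a \<in> topspace S" "b \<in> topspace S" "a - b \<in> U"
      then obtain V where V: "V \<in> B" "\<forall>k\<in>frags M. k - (a - b) \<in> V \<longrightarrow> k \<in> U"
        using U unfolding opS op_def by blast
      obtain P where P: "P \<in> B" "\<forall>x\<in>P. \<forall>y\<in>P. x - y \<in> V" using diff[OF V(1)] by blast
      obtain Ua where Ua: "openin S Ua" "a \<in> Ua" "\<forall>h\<in>Ua. h - a \<in> P" using int[OF _ P(1)] ab spS by metis
      obtain Ub where Ub: "openin S Ub" "b \<in> Ub" "\<forall>h\<in>Ub. h - b \<in> P" using int[OF _ P(1)] ab spS by metis
      have sub: "Ua \<subseteq> frags M" "Ub \<subseteq> frags M" using openin_subset spS Ua Ub by auto
      have "x - y \<in> U" if "x \<in> Ua" "y \<in> Ub" for x y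
      proof -
        have "(x - a) - (y - b) \<in> V" using P Ua Ub that by blast
        moreover have "x - y - (a - b) = (x - a) - (y - b)" by simp
        ultimately show ?thesis using V sub that by (metis diff_in_frags subsetD)
      qed
      then show "\<exists>U'. openin S U' \<and> (\<exists>V. openin S V \<and> a \<in> U' \<and> b \<in> V \<and>
           U' \<times> V \<subseteq> {x \<in> topspace S \<times> topspace S. (case x of (x, y) \<Rightarrow> x - y) \<in> U})"
        using Ua Ub sub spS by (intro exI[of _ Ua] conjI exI[of _ Ub]) auto
    qed
  qed (auto simp: spS)
  moreover have "continuous_map mtopology S frag_of"
    unfolding continuous_map_def
  proof (intro conjI allI impI)
    fix U assume U: "openin S U"
    show "openin mtopology {x \<in> topspace mtopology. frag_of x \<in> U}"
      unfolding openin_mtopology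
    proof (intro conjI allI impI)
      fix x assume "x \<in> {x \<in> topspace mtopology. frag_of x \<in> U}"
      then have x: "x \<in> M" "frag_of x \<in> U" by auto
      then obtain V where V: "V \<in> B" "\<forall>k\<in>frags M. k - frag_of x \<in> V \<longrightarrow> k \<in> U"
        using U unfolding opS op_def by blast
      then show "\<exists>r>0. mball x r \<subseteq> {x \<in> topspace mtopology. frag_of x \<in> U}"
        using near[OF V(1) x(1)] by fastforce
    qed auto
  qed (auto simp: spS)
  ultimately have "\<And>U. openin S U \<Longrightarrow> openin T U" using finest spS by blast
  moreover obtain U where "openin S U" "0 \<in> U" "\<forall>h\<in>U. h - 0 \<in> W" using int[OF zero_in_frags W] by blast
  ultimately show thesis by (intro that[of U]) auto
qed

text \<open>The sublevel sets of \<open>N\<close> satisfy the axioms of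
  \<open>filter_base_nbhd\<close>; half of a bound suffices for differences. Continuity on the whole
  group is thus reduced to differences of nearby generators.\<close>

lemma frag_seminorm_continuous:
  fixes N :: "('a \<Rightarrow>\<^sub>0 int) \<Rightarrow> real"
  assumes N0: "N 0 = 0"
    and sub: "\<And>x y. x \<in> frags M \<Longrightarrow> y \<in> frags M \<Longrightarrow> N (x - y) \<le> N x + N y"
    and near: "\<And>x \<epsilon>. x \<in> M \<Longrightarrow> \<epsilon> > 0 \<Longrightarrow> \<exists>r>0. \<forall>y\<in>mball x r. N (frag_of y - frag_of x) < \<epsilon>"
  shows "continuous_map T euclideanreal N"
proof (rule seminorm_continuous[of N, OF N0])
  fix \<epsilon> :: real assume \<epsilon>: "\<epsilon> > 0"
  define B where "B = (\<lambda>\<epsilon>. {c \<in> frags M. N c < \<epsilon>}) ` {0<..}"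
  have "{c \<in> frags M. N c < \<epsilon>} \<in> B" using \<epsilon> by (auto simp: B_def)
  then obtain U where "openin T U" "0 \<in> U" "U \<subseteq> {c \<in> frags M. N c < \<epsilon>}"
  proof (rule filter_base_nbhd[rotated 4])
    show "0 \<in> W" if "W \<in> B" for W using that N0 by (auto simp: B_def)
    show "\<exists>Q\<in>B. Q \<subseteq> V \<inter> W" if "V \<in> B" "W \<in> B" for V W
    proof -
      obtain a b where "a > 0" "b > 0" "V = {c \<in> frags M. N c < a}" "W = {c \<in> frags M. N c < b}"
        using \<open>V \<in> B\<close> \<open>W \<in> B\<close> by (auto simp: B_def)
      then show ?thesis unfolding B_def by (intro bexI[of _ "{c \<in> frags M. N c < min a b}"] image_eqI[of _ _ "min a b"]) auto
    qed
    show "\<exists>V\<in>B. \<forall>x\<in>V. \<forall>y\<in>V. x - y \<in> W" if "W \<in> B" for W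
    proof -
      obtain b where b: "b > 0" "W = {c \<in> frags M. N c < b}"
        using \<open>W \<in> B\<close> by (auto simp: B_def)
      have "N (x - y) < b" if "x \<in> frags M" "y \<in> frags M" "N x < b/2" "N y < b/2" for x y
        using sub[OF that(1,2)] that by linarith
      then show ?thesis using b unfolding B_def by (intro bexI[of _ "{c \<in> frags M. N c < b/2}"] image_eqI[of _ _ "b/2"]) auto
    qed
    show "\<exists>r>0. \<forall>y\<in>mball x r. frag_of y - frag_of x \<in> W" if "W \<in> B" "x \<in> M" for W x
    proof -
      obtain b where b: "b > 0" "W = {c \<in> frags M. N c < b}"
        using \<open>W \<in> B\<close> by (auto simp: B_def)
      then show ?thesis using near[OF that(2) b(1)] that(2) by auto
    qed
  qed blast
  then show "\<exists>U. openin T U \<and> 0 \<in> U \<and> (\<forall>x\<in>U. N x < \<epsilon>)" by blast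
qed (use sub topspace_T in auto)

section \<open>Tent functions and the seminorms that they induce\<close>

definition bump :: "'a \<Rightarrow> real \<Rightarrow> 'a \<Rightarrow> real" where
  "bump x r y = max 0 (1 - d x y / r)"

lemma bump_center: "x \<in> M \<Longrightarrow> bump x r x = 1"
  by (simp add: bump_def)

lemma bump_bounds: "r > 0 \<Longrightarrow> 0 \<le> bump x r y" "r > 0 \<Longrightarrow> bump x r y \<le> 1"
  by (auto simp: bump_def)

lemma bump_eq_0: "r > 0 \<Longrightarrow> r \<le> d x y \<Longrightarrow> bump x r y = 0"
  by (auto simp: bump_def)

lemma bump_lipschitz:
  assumes "x \<in> M" "y \<in> M" "z \<in> M" "r > 0"
  shows "\<bar>bump x r z - bump x r y\<bar> \<le> d y z / r"
proof -
  have "\<bar>d x y - d x z\<bar> \<le> d y z"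
    using triangle[of x y z] triangle[of x z y] commute[of y z] assms by linarith
  then have "\<bar>d x y / r - d x z / r\<bar> \<le> d y z / r"
    using assms(4) by (simp add: diff_divide_distrib[symmetric] divide_right_mono)
  then show ?thesis by (auto simp: bump_def max_def)
qed

text \<open>The weights may grow arbitrarily fast: this is what bounds the supports of the elements of a
  compact set.\<close>

lemma weighted_bumps_continuous:
  fixes x :: "'i \<Rightarrow> 'a" and r w :: "'i \<Rightarrow> real"
  assumes x: "\<And>i. i \<in> I \<Longrightarrow> x i \<in> M" and r: "\<And>i. i \<in> I \<Longrightarrow> r i > 0"
    and w: "\<And>i. i \<in> I \<Longrightarrow> w i \<ge> 0"
    and fin: "\<And>y. y \<in> M \<Longrightarrow> \<exists>\<delta>>0. finite {i \<in> I. mball y \<delta> \<inter> mball (x i) (r i) \<noteq> {}}"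
  shows "continuous_map T euclideanreal
    (\<lambda>c. \<Sum>i | i \<in> I \<and> ev (bump (x i) (r i)) c \<noteq> 0. w i * \<bar>ev (bump (x i) (r i)) c\<bar>)"
    and "c \<in> frags M \<Longrightarrow> finite {i \<in> I. ev (bump (x i) (r i)) c \<noteq> 0}"
proof -
  let ?e = "\<lambda>i. ev (bump (x i) (r i))"
  let ?N = "\<lambda>c. \<Sum>i | i \<in> I \<and> ?e i c \<noteq> 0. w i * \<bar>?e i c\<bar>"
  have finite: "finite {i \<in> I. ?e i c \<noteq> 0}" if c: "c \<in> frags M" for c
  proof (rule finite_subset)
    show "{i \<in> I. ?e i c \<noteq> 0} \<subseteq> (\<Union>y\<in>Poly_Mapping.keys c. {i \<in> I. y \<in> mball (x i) (r i)})"
    proof clarify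
      fix i assume i: "i \<in> I" "?e i c \<noteq> 0"
      then obtain y where y: "y \<in> Poly_Mapping.keys c" "bump (x i) (r i) y \<noteq> 0"
        using ev_eq_0[of c "bump (x i) (r i)"] by metis
      then have "d (x i) y < r i" using bump_eq_0 r[OF i(1)] by force
      then show "i \<in> (\<Union>y\<in>Poly_Mapping.keys c. {i \<in> I. y \<in> mball (x i) (r i)})"
        using y i x c by (auto simp: frags_def)
    qed
    have "finite {i \<in> I. y \<in> mball (x i) (r i)}" if y: "y \<in> M" for y
    proof -
      obtain \<delta> where \<delta>: "\<delta> > 0" "finite {i \<in> I. mball y \<delta> \<inter> mball (x i) (r i) \<noteq> {}}"
        using fin[OF y] by blast
      show ?thesis by (rule finite_subset[OF _ \<delta>(2)]) (use \<delta>(1) y in auto)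
    qed
    then show "finite (\<Union>y\<in>Poly_Mapping.keys c. {i \<in> I. y \<in> mball (x i) (r i)})"
      using c by (auto simp: frags_def)
  qed
  then show "c \<in> frags M \<Longrightarrow> finite {i \<in> I. ev (bump (x i) (r i)) c \<noteq> 0}" .
  have N: "?N c = (\<Sum>i\<in>J. w i * \<bar>?e i c\<bar>)" if "finite J" "{i \<in> I. ?e i c \<noteq> 0} \<subseteq> J" "J \<subseteq> I" for c J
    using that by (intro sum.mono_neutral_left) auto
  show "continuous_map T euclideanreal ?N"
  proof (rule frag_seminorm_continuous)
    fix a b assume ab: "a \<in> frags M" "b \<in> frags M"
    let ?J = "{i \<in> I. ?e i a \<noteq> 0} \<union> {i \<in> I. ?e i b \<noteq> 0}"
    have "finite ?J" using finite ab by blast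
    moreover have "{i \<in> I. ?e i (a - b) \<noteq> 0} \<subseteq> ?J" by auto
    ultimately have "?N (a - b) = (\<Sum>i\<in>?J. w i * \<bar>?e i (a - b)\<bar>)"
      by (intro N) auto
    also have "\<dots> \<le> (\<Sum>i\<in>?J. w i * \<bar>?e i a\<bar> + w i * \<bar>?e i b\<bar>)"
    proof (intro sum_mono)
      fix i assume "i \<in> ?J"
      then have "w i * \<bar>?e i (a - b)\<bar> \<le> w i * (\<bar>?e i a\<bar> + \<bar>?e i b\<bar>)"
        using w by (intro mult_left_mono) auto
      then show "w i * \<bar>?e i (a - b)\<bar> \<le> w i * \<bar>?e i a\<bar> + w i * \<bar>?e i b\<bar>"
        by (simp add: algebra_simps)
    qed
    also have "\<dots> = ?N a + ?N b"
      unfolding sum.distrib using \<open>finite ?J\<close> by (intro arg_cong2[of _ _ _ _ "(+)"] N[symmetric]) auto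
    finally show "?N (a - b) \<le> ?N a + ?N b" .
  next
    fix y and \<epsilon> :: real assume y: "y \<in> M" and \<epsilon>: "\<epsilon> > 0"
    obtain \<delta> where \<delta>: "\<delta> > 0" "finite {i \<in> I. mball y \<delta> \<inter> mball (x i) (r i) \<noteq> {}}"
      using fin[OF y] by blast
    define J where "J = {i \<in> I. mball y \<delta> \<inter> mball (x i) (r i) \<noteq> {}}"
    \<comment> \<open>Only the finitely many tents in \<open>J\<close> can be non-zero at
      \<open>y\<close> or at a point within \<open>\<delta>\<close> of it, and \<open>w i\<close>
      times the tent has Lipschitz constant \<open>w i / r i\<close>. So \<open>C\<close> is a
      Lipschitz constant near \<open>y\<close>; \<open>C + 1\<close> avoids a division by 0.\<close>
    define C where "C = (\<Sum>i\<in>J. w i / r i)"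
    have C0: "C \<ge> 0" unfolding C_def J_def using w r by (intro sum_nonneg) (simp add: less_imp_le)
    show "\<exists>\<rho>>0. \<forall>z\<in>mball y \<rho>. ?N (frag_of z - frag_of y) < \<epsilon>"
    proof (intro exI conjI ballI)
      show "min \<delta> (\<epsilon> / (C + 1)) > 0" using \<delta> \<epsilon> C0 by simp
      fix z assume "z \<in> mball y (min \<delta> (\<epsilon> / (C + 1)))"
      then have z: "z \<in> M" "d y z < \<delta>" "d y z < \<epsilon> / (C + 1)" by auto
      have "{i \<in> I. ?e i (frag_of z - frag_of y) \<noteq> 0} \<subseteq> J"
      proof clarify
        fix i assume i: "i \<in> I" "?e i (frag_of z - frag_of y) \<noteq> 0"
        then have "d (x i) z < r i \<or> d (x i) y < r i"
          using bump_eq_0[OF r[OF i(1)], of "x i"] by force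
        then have "z \<in> mball (x i) (r i) \<or> y \<in> mball (x i) (r i)"
          using z y x i by auto
        moreover have "z \<in> mball y \<delta>" "y \<in> mball y \<delta>" using z y \<delta> by auto
        ultimately show "i \<in> J" unfolding J_def using i by blast
      qed
      then have "?N (frag_of z - frag_of y) = (\<Sum>i\<in>J. w i * \<bar>?e i (frag_of z - frag_of y)\<bar>)"
        using \<delta> by (intro N) (auto simp: J_def)
      also have "\<dots> \<le> (\<Sum>i\<in>J. w i * (d y z / r i))"
        using bump_lipschitz x y z r w by (intro sum_mono mult_left_mono) (auto simp: J_def)
      also have "\<dots> = d y z * C"
        by (simp add: C_def sum_distrib_left algebra_simps)
      also have "\<dots> \<le> d y z * (C + 1)" by (simp add: mult_left_mono)
      also have "\<dots> < \<epsilon>" using z(3) C0 by (simp add: pos_less_divide_eq)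
      finally show "?N (frag_of z - frag_of y) < \<epsilon>" .
    qed
  qed simp
qed

lemma abs_ev_bump_continuous:
  assumes "x \<in> M" "r > 0"
  shows "continuous_map T euclideanreal (\<lambda>c. \<bar>ev (bump x r) c\<bar>)"
proof -
  have "continuous_map T euclideanreal
    (\<lambda>c. \<Sum>i | i \<in> {()} \<and> ev (bump x r) c \<noteq> 0. 1 * \<bar>ev (bump x r) c\<bar>)"
    by (rule weighted_bumps_continuous(1)[of "{()}" "\<lambda>_. x" "\<lambda>_. r" "\<lambda>_. 1"])
      (use assms in \<open>auto intro: exI[of _ 1]\<close>)
  then show ?thesis
    by (rule continuous_map_eq) (auto simp: Collect_conv_if)
qed

lemma separating_radius:
  assumes "finite F" "F \<subseteq> M"
  obtains r where "r > 0" "\<And>x y. x \<in> F \<Longrightarrow> y \<in> F \<Longrightarrow> x \<noteq> y \<Longrightarrow> r \<le> d x y"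
proof -
  \<comment> \<open>The inserted 1 keeps the set non-empty when \<open>F\<close> has at most one
    point.\<close>
  let ?D = "insert 1 ((\<lambda>(x, y). d x y) ` {p \<in> F \<times> F. fst p \<noteq> snd p})"
  have fin: "finite ?D" using assms by simp
  show thesis
  proof (rule that[of "Min ?D"])
    show "Min ?D > 0" using fin assms by (subst Min_gr_iff) (auto simp: subset_iff mdist_pos_less)
    show "Min ?D \<le> d x y" if "x \<in> F" "y \<in> F" "x \<noteq> y" for x y
      using fin that by (intro Min_le) (auto intro!: image_eqI[of _ _ "(x, y)"])
  qed
qed

text \<open>A tent around one key of \<open>g - h\<close>, too narrow to reach the other keys,
  evaluates \<open>g - h\<close> to a single non-zero coefficient. The absolute value of this
  evaluation, translated by \<open>h\<close>, is continuous, vanishes at \<open>h\<close> and is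
  non-zero at \<open>g\<close>.\<close>

lemma Hausdorff: "Hausdorff_space T"
  unfolding Hausdorff_space_def
proof (intro allI impI)
  fix g h assume gh: "g \<in> topspace T \<and> h \<in> topspace T \<and> g \<noteq> h"
  then have "g - h \<noteq> 0" "g - h \<in> frags M" using topspace_T by auto
  then obtain x where x: "x \<in> Poly_Mapping.keys (g - h)" "x \<in> M"
    using keys_eq_empty[of "g - h"] unfolding frags_def by blast
  obtain r where r: "r > 0" "\<And>y. y \<in> Poly_Mapping.keys (g - h) \<Longrightarrow> x \<noteq> y \<Longrightarrow> r \<le> d x y"
    using separating_radius[of "Poly_Mapping.keys (g - h)"] \<open>g - h \<in> frags M\<close> x(1)
    unfolding frags_def by (metis finite_keys mem_Collect_eq)
  have "ev (bump x r) (g - h) = Poly_Mapping.lookup (g - h) x"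
    using r x by (intro ev_indicator) (auto simp: bump_center intro: bump_eq_0)
  then have ne: "ev (bump x r) (g - h) \<noteq> 0" using x(1) by (simp add: in_keys_iff)
  let ?f = "\<lambda>c. \<bar>ev (bump x r) (c - h)\<bar>"
  have cont: "continuous_map T euclideanreal ?f"
    using continuous_map_compose[OF continuous_diff[of T "\<lambda>c. c" "\<lambda>_. h"] abs_ev_bump_continuous[OF x(2) r(1)]] gh
    by (simp add: o_def)
  let ?e = "?f g / 2"
  have "?e > 0" using ne by simp
  then have "g \<in> {c \<in> topspace T. ?f c \<in> {?e<..}}" "h \<in> {c \<in> topspace T. ?f c \<in> {..<?e}}"
    using gh by auto
  moreover have "openin T {c \<in> topspace T. ?f c \<in> {?e<..}}" "openin T {c \<in> topspace T. ?f c \<in> {..<?e}}"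
    by (rule openin_continuous_map_preimage[OF cont]; simp)+
  ultimately show "\<exists>U V. openin T U \<and> openin T V \<and> g \<in> U \<and> h \<in> V \<and> disjnt U V"
    by (intro exI[of _ "{c \<in> topspace T. ?f c \<in> {?e<..}}"] exI[of _ "{c \<in> topspace T. ?f c \<in> {..<?e}}"])
      (auto simp: disjnt_def)
qed

lemma Tychonoff_subtopology: "Tychonoff_space (subtopology T S)"
  unfolding Tychonoff_space_def
  using completely_regular Hausdorff
  by (simp add: completely_regular_space_subtopology t1_space_subtopology Hausdorff_imp_t1_space)

text \<open>The length is lower semicontinuous: for tents with disjoint supports around the keys of
  \<open>c\<close>, the sum \<open>?N\<close> of the absolute evaluations is continuous, never
  exceeds the length, and equals it at \<open>c\<close>. So \<open>?N > n\<close> defines a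
  neighbourhood of \<open>c\<close> that avoids the set.\<close>

lemma closedin_bounded_length: "closedin T {c \<in> frags M. len c \<le> n}"
  unfolding closedin_def
proof
  have "\<exists>U. openin T U \<and> c \<in> U \<and> U \<subseteq> topspace T - {c \<in> frags M. len c \<le> n}"
    if c: "c \<in> topspace T - {c \<in> frags M. len c \<le> n}" for c
  proof -
    let ?K = "Poly_Mapping.keys c"
    have K: "?K \<subseteq> M" "len c > n" using c topspace_T by (auto simp: frags_def)
    obtain r0 where r0: "r0 > 0" "\<And>x y. x \<in> ?K \<Longrightarrow> y \<in> ?K \<Longrightarrow> x \<noteq> y \<Longrightarrow> r0 \<le> d x y"
      using separating_radius[OF finite_keys K(1)] by metis
    \<comment> \<open>Half of the separation makes the tents disjoint, so their sum is at most 1 at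
      every point of \<open>M\<close>.\<close>
    define r where "r = r0 / 2"
    have r: "r > 0" using r0 by (simp add: r_def)
    have disj: "x = y" if "x \<in> ?K" "y \<in> ?K" "z \<in> M" "bump x r z \<noteq> 0" "bump y r z \<noteq> 0" for x y z
    proof (rule ccontr)
      assume "x \<noteq> y"
      have "d x z < r" "d y z < r" using that bump_eq_0[OF r] by force+
      then have "d x y < r0"
        using triangle[of x z y] commute[of y z] subsetD[OF K(1) that(1)] subsetD[OF K(1) that(2)] that(3)
        by (simp add: r_def)
      then show False using r0(2)[of x y] that \<open>x \<noteq> y\<close> by simp
    qed
    have sum_le_1: "(\<Sum>x\<in>?K. bump x r z) \<le> 1" if z: "z \<in> M" for z
    proof (cases "\<exists>x\<in>?K. bump x r z \<noteq> 0")
      case True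
      then obtain x where x: "x \<in> ?K" "bump x r z \<noteq> 0" by blast
      then have "(\<Sum>x\<in>?K. bump x r z) = (\<Sum>x\<in>{x}. bump x r z)"
        using disj z by (intro sum.mono_neutral_right) auto
      then show ?thesis using bump_bounds[OF r] by simp
    qed simp
    let ?N = "\<lambda>c'. \<Sum>x\<in>?K. \<bar>ev (bump x r) c'\<bar>"
    have cont: "continuous_map T euclideanreal ?N"
      using K r by (intro continuous_map_sum abs_ev_bump_continuous) auto
    have "?N c = len c"
    proof -
      have "\<bar>ev (bump x r) c\<bar> = nat \<bar>Poly_Mapping.lookup c x\<bar>" if "x \<in> ?K" for x
      proof -
        have "ev (bump x r) c = Poly_Mapping.lookup c x"
        proof (rule ev_indicator)
          show "bump x r y = 0" if "y \<in> ?K" "y \<noteq> x" for y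
            using r0 r_def that \<open>x \<in> ?K\<close> by (intro bump_eq_0) force+
        qed (use that K bump_center in auto)
        then show ?thesis by simp
      qed
      then show ?thesis by (simp add: len_def)
    qed
    moreover have "?N c' \<le> len c'" if c': "c' \<in> frags M" for c'
    proof -
      let ?K' = "Poly_Mapping.keys c'"
      have "?N c' \<le> (\<Sum>x\<in>?K. \<Sum>z\<in>?K'. \<bar>real_of_int (Poly_Mapping.lookup c' z)\<bar> * bump x r z)"
        unfolding ev_def using bump_bounds[OF r]
        by (intro sum_mono order_trans[OF sum_abs]) (simp add: abs_mult)
      also have "\<dots> = (\<Sum>z\<in>?K'. \<bar>real_of_int (Poly_Mapping.lookup c' z)\<bar> * (\<Sum>x\<in>?K. bump x r z))"
        by (subst sum.swap) (simp add: sum_distrib_left)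
      also have "\<dots> \<le> (\<Sum>z\<in>?K'. \<bar>real_of_int (Poly_Mapping.lookup c' z)\<bar> * 1)"
        using c' sum_le_1 by (intro sum_mono mult_left_mono) (auto simp: frags_def)
      also have "\<dots> = len c'" by (simp add: len_def)
      finally show ?thesis .
    qed
    ultimately show ?thesis
      using openin_continuous_map_preimage[OF cont, of "{real n<..}"] K c topspace_T
      by (intro exI[of _ "{c \<in> topspace T. ?N c \<in> {real n<..}}"]) force
  qed
  then show "openin T (topspace T - {c \<in> frags M. len c \<le> n})"
    by (subst openin_subopen) blast
qed (use topspace_T in auto)

end

section \<open>Necessity\<close>

context Metric_space
begin

text \<open>Take a sequence in \<open>S\<close> without a subsequence converging in
  \<open>S\<close>. If every ball around \<open>x\<close> contained terms of infinitely many
  indices, radii \<open>1 / Suc n\<close> would select a subsequence converging to \<open>x\<close>,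
  which lies in the closed set \<open>S\<close>. Indices are counted, not values, so no value occurs
  infinitely often.\<close>

lemma noncompact_sequence:
  assumes S: "closedin mtopology S" "\<not> compactin mtopology S"
  shows "\<exists>\<sigma> :: nat \<Rightarrow> 'a. range \<sigma> \<subseteq> S \<and> (\<forall>x\<in>M. \<exists>\<delta>>0. finite {n. \<sigma> n \<in> mball x \<delta>})"
proof -
  have SM: "S \<subseteq> M" using closedin_subset[OF S(1)] by simp
  then obtain \<sigma> :: "nat \<Rightarrow> 'a" where \<sigma>: "range \<sigma> \<subseteq> S"
    and no: "\<And>l r. l \<in> S \<Longrightarrow> strict_mono r \<Longrightarrow> \<not> limitin mtopology (\<sigma> \<circ> r) l sequentially"
    using S(2) unfolding compactin_sequentially by blast
  show ?thesis
  proof (rule exI[of _ \<sigma>], intro conjI ballI, rule \<sigma>, rule ccontr)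
    fix x assume x: "x \<in> M" and "\<not> (\<exists>\<delta>>0. finite {n. \<sigma> n \<in> mball x \<delta>})"
    then have inf: "infinite {n. \<sigma> n \<in> mball x \<delta>}" if "\<delta> > 0" for \<delta>
      using that by blast
    have "\<exists>r. \<forall>n. \<sigma> (r n) \<in> mball x (1 / Suc n) \<and> r n < r (Suc n)"
    proof (rule dependent_nat_choice)
      show "\<exists>k. \<sigma> k \<in> mball x (1 / Suc 0)"
        using infinite_imp_nonempty[OF inf[of "1 / Suc 0"]] by auto
      show "\<exists>k'. \<sigma> k' \<in> mball x (1 / Suc (Suc n)) \<and> k < k'" for k n
        using inf[of "1 / Suc (Suc n)"] unfolding infinite_nat_iff_unbounded by auto
    qed
    then obtain r where r: "\<And>n. \<sigma> (r n) \<in> mball x (1 / Suc n)" "strict_mono r"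
      by (metis strict_mono_Suc_iff)
    have lim: "limitin mtopology (\<sigma> \<circ> r) x sequentially"
      unfolding limitin_metric
    proof (intro conjI allI impI x)
      fix \<epsilon> :: real assume "\<epsilon> > 0"
      then obtain N where N: "1 / Suc N < \<epsilon>" using nat_approx_posE by blast
      show "\<forall>\<^sub>F n in sequentially. (\<sigma> \<circ> r) n \<in> M \<and> d ((\<sigma> \<circ> r) n) x < \<epsilon>"
      proof (rule eventually_sequentiallyI)
        fix n assume "n \<ge> N"
        then have "1 / Suc n \<le> 1 / Suc N" by (simp add: frac_le)
        then show "(\<sigma> \<circ> r) n \<in> M \<and> d ((\<sigma> \<circ> r) n) x < \<epsilon>"
          using r(1)[of n] N commute by auto
      qed
    qed
    have "x \<in> S"
      by (rule limitin_closedin[OF lim S(1)]) (use \<sigma> in \<open>auto simp: image_subset_iff\<close>)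
    then show False using no r(2) lim by blast
  qed
qed

text \<open>For all but finitely many \<open>n\<close> the radius is below
  \<open>\<delta> / 2\<close>, and then a ball that meets \<open>mball x (\<delta> / 2)\<close> has
  its centre in \<open>mball x \<delta>\<close>.\<close>

lemma shrinking_balls_locally_finite:
  assumes \<sigma>: "\<And>x. x \<in> M \<Longrightarrow> \<exists>\<delta>>0. finite {n::nat. \<sigma> n \<in> mball x \<delta>}" and x: "x \<in> M"
  shows "\<exists>\<delta>>0. finite {n. mball x \<delta> \<inter> mball (\<sigma> n) (1 / Suc n) \<noteq> {}}"
proof -
  obtain \<delta> where \<delta>: "\<delta> > 0" "finite {n::nat. \<sigma> n \<in> mball x \<delta>}" using \<sigma>[OF x] by blast
  obtain N where N: "1 / Suc N < \<delta> / 2" using nat_approx_posE[of "\<delta> / 2"] \<delta>(1) by auto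
  have "{n. mball x (\<delta>/2) \<inter> mball (\<sigma> n) (1 / Suc n) \<noteq> {}} \<subseteq> {n. \<sigma> n \<in> mball x \<delta>} \<union> {..N}"
  proof clarify
    fix n assume n: "mball x (\<delta>/2) \<inter> mball (\<sigma> n) (1 / Suc n) \<noteq> {}" "\<not> n \<le> N"
    then obtain z where z: "z \<in> mball x (\<delta>/2)" "z \<in> mball (\<sigma> n) (1 / Suc n)" by blast
    have "1 / Suc n \<le> 1 / Suc N" using n by (simp add: frac_le)
    then have "d z (\<sigma> n) < \<delta> / 2" using z N commute by auto
    then have "d x (\<sigma> n) < \<delta>" using triangle[of x z "\<sigma> n"] z by auto
    then show "\<sigma> n \<in> mball x \<delta>" using z by auto
  qed
  then have "finite {n. mball x (\<delta>/2) \<inter> mball (\<sigma> n) (1 / Suc n) \<noteq> {}}"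
    by (rule finite_subset) (use \<delta> in auto)
  then show ?thesis using \<delta>(1) by (intro exI[of _ "\<delta>/2"]) auto
qed

text \<open>Zorn's lemma gives maximal \<open>\<epsilon>\<close>-separated subsets of
  \<open>S\<close>; by maximality every point of \<open>S\<close> is closer than
  \<open>\<epsilon>\<close> to such a set. If those for \<open>1 / Suc n\<close> were all countable,
  their union would be countable and dense in \<open>S\<close>.\<close>

lemma nonseparable_separated_subset:
  assumes S: "S \<subseteq> M" "\<not> separable_space (subtopology mtopology S)"
  obtains E \<epsilon> where "E \<subseteq> S" "uncountable E" "\<epsilon> > 0"
    "\<And>x y. x \<in> E \<Longrightarrow> y \<in> E \<Longrightarrow> x \<noteq> y \<Longrightarrow> \<epsilon> \<le> d x y"
proof -
  define sep where "sep \<epsilon> = {E. E \<subseteq> S \<and> (\<forall>x\<in>E. \<forall>y\<in>E. x \<noteq> y \<longrightarrow> \<epsilon> \<le> d x y)}" for \<epsilon>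
  have "\<exists>E\<in>sep \<epsilon>. \<forall>F\<in>sep \<epsilon>. E \<subseteq> F \<longrightarrow> F = E" for \<epsilon>
  proof (rule subset_Zorn_nonempty)
    have "{} \<in> sep \<epsilon>" by (simp add: sep_def)
    then show "sep \<epsilon> \<noteq> {}" by blast
    fix \<C> assume "\<C> \<noteq> {}" and chain: "subset.chain (sep \<epsilon>) \<C>"
    then have sub: "\<C> \<subseteq> sep \<epsilon>" and lin: "\<And>E F. E \<in> \<C> \<Longrightarrow> F \<in> \<C> \<Longrightarrow> E \<subseteq> F \<or> F \<subseteq> E"
      unfolding subset_chain_def by auto
    have "\<epsilon> \<le> d x y" if EF: "E \<in> \<C>" "F \<in> \<C>" "x \<in> E" "y \<in> F" "x \<noteq> y" for E F x y
    proof -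
      obtain G where "G \<in> \<C>" "x \<in> G" "y \<in> G" using lin[of E F] EF by blast
      then show ?thesis using sub EF by (auto simp: sep_def)
    qed
    then show "\<Union>\<C> \<in> sep \<epsilon>" using sub unfolding sep_def by auto
  qed
  then obtain E where E: "\<And>\<epsilon>. E \<epsilon> \<in> sep \<epsilon>" "\<And>\<epsilon> F. F \<in> sep \<epsilon> \<Longrightarrow> E \<epsilon> \<subseteq> F \<Longrightarrow> F = E \<epsilon>"
    by metis
  have "\<exists>n. uncountable (E (1 / Suc n))"
  proof (rule ccontr)
    assume "\<nexists>n. uncountable (E (1 / Suc n))"
    then have cnt: "countable (\<Union>n. E (1 / Suc n))" by auto
    have sub: "(\<Union>n. E (1 / Suc n)) \<subseteq> S" using E(1) by (auto simp: sep_def)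
    have "x \<in> mtopology closure_of (\<Union>n. E (1 / Suc n))" if x: "x \<in> S" for x
      unfolding metric_closure_of
    proof (intro CollectI conjI allI impI)
      show "x \<in> M" using x S by blast
      fix r :: real assume "r > 0"
      then obtain n where n: "1 / Suc n < r" using nat_approx_posE by blast
      show "\<exists>y\<in>\<Union>n. E (1 / Suc n). y \<in> mball x r"
      proof (rule ccontr)
        assume no: "\<not> ?thesis"
        have far: "1 / Suc n \<le> d x y" if "y \<in> E (1 / Suc n)" for y
        proof -
          have "y \<in> M" using that sub S by blast
          then show ?thesis using no that n x S by force
        qed
        then have "insert x (E (1 / Suc n)) \<in> sep (1 / Suc n)"
          using E(1)[of "1 / Suc n"] x commute by (auto simp: sep_def)
        then have "x \<in> E (1 / Suc n)" using E(2) by blast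
        then have "x \<in> (\<Union>n. E (1 / Suc n))" by blast
        moreover have "x \<in> mball x r" using x S \<open>r > 0\<close> by auto
        ultimately show False using no by blast
      qed
    qed
    then have "separable_space (subtopology mtopology S)"
      unfolding separable_space_def using cnt sub S(1)
      by (intro exI[of _ "\<Union>n. E (1 / Suc n)"])
        (auto simp: closure_of_subtopology Int_absorb1 topspace_subtopology)
    then show False using S by simp
  qed
  then obtain n where "uncountable (E (1 / Suc n))" by blast
  then show thesis
    using E(1)[of "1 / Suc n"] by (intro that[of "E (1 / Suc n)" "1 / Suc n"]) (auto simp: sep_def)
qed

lemma non_isolated_near:
  assumes "x \<in> non_isolated mtopology" "\<epsilon> > 0"
  shows "\<exists>y. y \<in> M \<and> y \<noteq> x \<and> d x y < \<epsilon>"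
proof -
  have x: "x \<in> M" "\<not> openin mtopology {x}" using assms by (auto simp: non_isolated_def)
  have "mball x \<epsilon> \<noteq> {x}" using x(2) openin_mball by metis
  then show ?thesis using x assms by fastforce
qed

lemma closedin_non_isolated: "closedin mtopology (non_isolated mtopology)"
proof -
  have "openin mtopology (\<Union>{{x} |x. openin mtopology {x}})" by blast
  moreover have "M - non_isolated mtopology = \<Union>{{x} |x. openin mtopology {x}}"
    using openin_subset[of mtopology] by (auto simp: non_isolated_def)
  ultimately show ?thesis unfolding closedin_def by (auto simp: non_isolated_def)
qed

end

text \<open>Cardinals are comparable: either \<open>E\<close> embeds into the reals, or the reals
  embed into \<open>E\<close> and the image with the inverse map serves.\<close>

lemma uncountable_injects_into_reals:
  assumes "uncountable E"
  obtains F and g :: "'a \<Rightarrow> real" where "F \<subseteq> E" "uncountable F" "inj_on g F"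
  using one_set_greater[of E "UNIV :: real set"]
proof (elim disjE exE conjE)
  fix f :: "'a \<Rightarrow> real" assume "inj_on f E"
  then show thesis using that assms by blast
next
  fix f :: "real \<Rightarrow> 'a" assume f: "f ` UNIV \<subseteq> E" "inj_on f UNIV"
  have "uncountable (range f)"
    using f(2) uncountable_UNIV_real countable_image_inj_on by blast
  moreover have "inj_on (inv_into UNIV f) (range f)" by (simp add: inj_on_inv_into)
  ultimately show thesis using that f(1) by blast
qed

text \<open>One function \<open>F\<close> refutes both properties, since in a k-space too continuity
  on compact sets implies continuity. The terms are non-negative, so nothing cancels and
  \<open>F (e j)\<close> is at least \<open>f j (e j)\<close>.\<close>

lemma (in additive_topological_group) not_k_space_not_kR_space:
  fixes f :: "'j \<Rightarrow> 'b \<Rightarrow> real"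
  assumes S: "S \<subseteq> topspace T" "0 \<in> S"
    and f: "\<And>j. j \<in> J \<Longrightarrow> continuous_map T euclideanreal (f j)"
      "\<And>j c. j \<in> J \<Longrightarrow> f j c \<ge> 0" "\<And>j. j \<in> J \<Longrightarrow> f j 0 = 0"
    and e: "\<And>j. j \<in> J \<Longrightarrow> e j \<in> S" "\<And>j. j \<in> J \<Longrightarrow> f j (e j) \<ge> 1"
    and cl: "\<And>U. openin T U \<Longrightarrow> 0 \<in> U \<Longrightarrow> \<exists>j\<in>J. e j \<in> U"
    and fin: "\<And>L. compactin T L \<Longrightarrow> finite {j \<in> J. \<exists>c\<in>L. f j c \<noteq> 0}"
  shows "\<not> k_space (subtopology T S)" "\<not> kR_space (subtopology T S)"
proof -
  define F where "F c = (\<Sum>j | j \<in> J \<and> f j c \<noteq> 0. f j c)" for c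
  have onK: "continuous_map (subtopology (subtopology T S) K) euclideanreal F"
    if K: "compactin (subtopology T S) K" for K
  proof -
    let ?J = "{j \<in> J. \<exists>c\<in>K. f j c \<noteq> 0}"
    have "compactin T K" using K by (simp add: compactin_subtopology)
    then have fJ: "finite ?J" by (rule fin)
    have "continuous_map (subtopology (subtopology T S) K) euclideanreal (\<lambda>c. \<Sum>j\<in>?J. f j c)"
      using fJ f(1) by (intro continuous_map_sum) (auto intro: continuous_map_from_subtopology)
    then show ?thesis
    proof (rule continuous_map_eq)
      fix c assume "c \<in> topspace (subtopology (subtopology T S) K)"
      then have "c \<in> K" by simp
      then show "(\<Sum>j\<in>?J. f j c) = F c"
        unfolding F_def using fJ by (intro sum.mono_neutral_right) auto
    qed
  qed
  have not: "\<not> continuous_map (subtopology T S) euclideanreal F"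
  proof
    assume "continuous_map (subtopology T S) euclideanreal F"
    then have "openin (subtopology T S) {c \<in> topspace (subtopology T S). F c \<in> {..<1}}"
      by (rule openin_continuous_map_preimage) simp
    then obtain U where U: "openin T U" "{c \<in> topspace (subtopology T S). F c \<in> {..<1}} = U \<inter> S"
      unfolding openin_subtopology by blast
    have "F 0 = 0" unfolding F_def using f(3) by (intro sum.neutral) auto
    then have "0 \<in> U" using U(2) S zero_in by auto
    then obtain j where j: "j \<in> J" "e j \<in> U" using cl[OF U(1)] by blast
    then have "F (e j) < 1" using U(2) e(1) by auto
    moreover have "f j (e j) \<le> F (e j)"
      unfolding F_def
    proof (rule member_le_sum)
      \<comment> \<open>A sum over an infinite index set would be 0 by default; \<open>fin\<close>
        for a singleton excludes this.\<close>
      have "compactin T {e j}" using j e(1) S by auto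
      then show "finite {j' \<in> J. f j' (e j) \<noteq> 0}" using fin by fastforce
      show "j \<in> {j' \<in> J. f j' (e j) \<noteq> 0}" using j e(2)[of j] by auto
    qed (use f(2) in auto)
    ultimately show False using e(2)[OF j(1)] by simp
  qed
  show "\<not> k_space (subtopology T S)"
    using continuous_map_from_k_space[of "subtopology T S" euclideanreal F] onK not by blast
  show "\<not> kR_space (subtopology T S)"
    using onK not unfolding kR_space_def by blast
qed

section \<open>Supports of the elements of a compact set, and the two counterexamples\<close>

context free_abelian_metric
begin

text \<open>Serves to pass from tents whose radius \<open>r\<close> depends on a pair of indices to
  the larger balls, of radius \<open>s\<close>, of a locally finite family.\<close>

lemma ev_bump_nonzero:
  assumes "ev (bump x r) c \<noteq> 0" "r > 0" "r \<le> s" "x \<in> M" "c \<in> frags M"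
  shows "Poly_Mapping.keys c \<inter> mball x s \<noteq> {}"
proof -
  obtain y where y: "y \<in> Poly_Mapping.keys c" "bump x r y \<noteq> 0"
    using assms(1) ev_eq_0[of c "bump x r"] by metis
  then have "d x y < s" using bump_eq_0[OF assms(2), of x y] assms(3) by linarith
  moreover have "y \<in> M" using y(1) assms(5) by (auto simp: frags_def)
  ultimately have "y \<in> mball x s" using assms(4) by simp
  then show ?thesis using y(1) by blast
qed

text \<open>Otherwise there are infinitely many witnesses \<open>c n\<close> in \<open>L\<close>,
  each with a key in its own \<open>B (h n)\<close>. A tent around that key, inside
  \<open>B (h n)\<close> and too narrow to reach other keys of \<open>c n\<close>, has non-zero
  evaluation at \<open>c n\<close>. A weighted sum of these evaluations is continuous, yet unbounded
  on the compact set \<open>L\<close>.\<close>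

lemma compact_supports_locally_finite:
  fixes B :: "'i \<Rightarrow> 'a set"
  assumes L: "compactin T L" and B: "\<And>i. i \<in> I \<Longrightarrow> openin mtopology (B i)"
    and fin: "\<And>y. y \<in> M \<Longrightarrow> \<exists>\<delta>>0. finite {i \<in> I. mball y \<delta> \<inter> B i \<noteq> {}}"
  shows "finite {i \<in> I. \<exists>c\<in>L. Poly_Mapping.keys c \<inter> B i \<noteq> {}}"
proof (rule ccontr)
  assume inf: "infinite {i \<in> I. \<exists>c\<in>L. Poly_Mapping.keys c \<inter> B i \<noteq> {}}"
  obtain h :: "nat \<Rightarrow> 'i" where h: "inj h" "range h \<subseteq> {i \<in> I. \<exists>c\<in>L. Poly_Mapping.keys c \<inter> B i \<noteq> {}}"
    using infinite_countable_subset[OF inf] by (elim exE conjE)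
  have hI: "h n \<in> I" and hL: "\<exists>c\<in>L. Poly_Mapping.keys c \<inter> B (h n) \<noteq> {}" for n
    using subsetD[OF h(2) rangeI, of n] by simp_all
  have L_sub: "L \<subseteq> frags M" using compactin_subset_topspace[OF L] topspace_T by simp
  have "\<exists>c x r. c \<in> L \<and> x \<in> M \<and> r > 0 \<and> mball x r \<subseteq> B (h n) \<and> ev (bump x r) c \<noteq> 0" for n
  proof -
    obtain c x where c: "c \<in> L" "x \<in> Poly_Mapping.keys c" "x \<in> B (h n)" using hL[of n] by blast
    obtain r1 where r1: "r1 > 0" "mball x r1 \<subseteq> B (h n)"
      using B[OF hI] c(3) unfolding openin_mtopology by blast
    have sub: "Poly_Mapping.keys c \<subseteq> M" using c L_sub by (auto simp: frags_def)
    obtain r2 where r2: "r2 > 0"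
      "\<And>x y. x \<in> Poly_Mapping.keys c \<Longrightarrow> y \<in> Poly_Mapping.keys c \<Longrightarrow> x \<noteq> y \<Longrightarrow> r2 \<le> d x y"
      using separating_radius[OF finite_keys sub] by metis
    have "ev (bump x (min r1 r2)) c = Poly_Mapping.lookup c x"
    proof (rule ev_indicator)
      show "bump x (min r1 r2) y = 0" if "y \<in> Poly_Mapping.keys c" "y \<noteq> x" for y
        using r1 r2(1) r2(2)[OF c(2) that(1)] that by (intro bump_eq_0) auto
    qed (use sub c bump_center in auto)
    then have "ev (bump x (min r1 r2)) c \<noteq> 0" using c(2) by (simp add: in_keys_iff)
    moreover have "mball x (min r1 r2) \<subseteq> B (h n)" using r1(2) by auto
    ultimately show ?thesis using c sub r1 r2 by (intro exI[of _ c] exI[of _ x] exI[of _ "min r1 r2"]) auto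
  qed
  then obtain c x r where *: "\<And>n. c n \<in> L" "\<And>n. x n \<in> M" "\<And>n. r n > 0"
    "\<And>n. mball (x n) (r n) \<subseteq> B (h n)" "\<And>n. ev (bump (x n) (r n)) (c n) \<noteq> 0"
    by metis
  define w where "w n = real n / \<bar>ev (bump (x n) (r n)) (c n)\<bar>" for n
  have lf: "\<exists>\<delta>>0. finite {n \<in> UNIV. mball y \<delta> \<inter> mball (x n) (r n) \<noteq> {}}" if y: "y \<in> M" for y
  proof -
    obtain \<delta> where \<delta>: "\<delta> > 0" "finite {i \<in> I. mball y \<delta> \<inter> B i \<noteq> {}}" using fin[OF y] by blast
    have "finite (h -` {i \<in> I. mball y \<delta> \<inter> B i \<noteq> {}})" using \<delta>(2) h(1) by (rule finite_vimageI)
    moreover have "{n \<in> UNIV. mball y \<delta> \<inter> mball (x n) (r n) \<noteq> {}} \<subseteq> h -` {i \<in> I. mball y \<delta> \<inter> B i \<noteq> {}}"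
      using *(4) hI by fastforce
    ultimately show ?thesis using \<delta>(1) finite_subset by blast
  qed
  let ?N = "\<lambda>c. \<Sum>i | i \<in> UNIV \<and> ev (bump (x i) (r i)) c \<noteq> 0. w i * \<bar>ev (bump (x i) (r i)) c\<bar>"
  have w: "w n \<ge> 0" for n by (simp add: w_def)
  have "continuous_map T euclideanreal ?N"
    by (rule weighted_bumps_continuous(1)) (use * lf w in auto)
  then have "compactin euclideanreal (?N ` L)" using L image_compactin by blast
  then have "bounded (?N ` L)" by (simp add: compact_imp_bounded)
  then obtain b where b: "\<And>c. c \<in> L \<Longrightarrow> \<bar>?N c\<bar> \<le> b" unfolding bounded_real by blast
  have "real n \<le> b" for n
  proof -
    have "finite {i \<in> UNIV. ev (bump (x i) (r i)) (c n) \<noteq> 0}"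
      by (rule weighted_bumps_continuous(2)[of _ x r w]) (use * lf w L_sub in auto)
    then have "w n * \<bar>ev (bump (x n) (r n)) (c n)\<bar> \<le> ?N (c n)"
      using w *(5) by (intro member_le_sum[of n _ "\<lambda>i. w i * \<bar>ev (bump (x i) (r i)) (c n)\<bar>"]) auto
    then show ?thesis using b[OF *(1)[of n]] *(5)[of n] by (simp add: w_def)
  qed
  then show False using reals_Archimedean2[of b] by (metis linorder_not_less)
qed

abbreviation bounded_length :: "nat \<Rightarrow> ('a \<Rightarrow>\<^sub>0 int) topology" where
  "bounded_length n \<equiv> subtopology T {c \<in> frags M. len c \<le> n}"

text \<open>The bounds on the radii keep the tent at \<open>p j\<close> away from the other three
  points, and likewise the tent at \<open>b j\<close>; so the evaluations at the element of index
  \<open>j\<close> are 1 and -1. The product is essential for \<open>fin\<close>: in both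
  applications a point serves infinitely many indices \<open>j\<close>, so that one factor alone
  would not be restricted by a compact set.\<close>

lemma not_k_space_not_kR_space_of_pairs:
  fixes p q a b :: "'j \<Rightarrow> 'a" and r s :: "'j \<Rightarrow> real"
  assumes M: "\<And>j. j \<in> J \<Longrightarrow> p j \<in> M \<and> q j \<in> M \<and> a j \<in> M \<and> b j \<in> M"
    and r: "\<And>j. j \<in> J \<Longrightarrow> r j > 0 \<and> r j \<le> d (p j) (q j) \<and> r j \<le> d (p j) (a j) \<and> r j \<le> d (p j) (b j)"
    and s: "\<And>j. j \<in> J \<Longrightarrow> s j > 0 \<and> s j \<le> d (b j) (q j) \<and> s j \<le> d (b j) (a j) \<and> s j \<le> d (b j) (p j)"
    and fin: "\<And>L. compactin T L \<Longrightarrow>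
      finite {j \<in> J. \<exists>c\<in>L. ev (bump (p j) (r j)) c \<noteq> 0 \<and> ev (bump (b j) (s j)) c \<noteq> 0}"
    and cl: "\<And>U. openin T U \<Longrightarrow> 0 \<in> U \<Longrightarrow>
      \<exists>j\<in>J. frag_of (p j) - frag_of (q j) \<in> U \<and> frag_of (a j) - frag_of (b j) \<in> U"
  shows "\<not> k_space (bounded_length 4)" "\<not> kR_space (bounded_length 4)"
proof -
  let ?e = "\<lambda>j. (frag_of (p j) - frag_of (q j)) + (frag_of (a j) - frag_of (b j))"
  let ?f = "\<lambda>j c. \<bar>ev (bump (p j) (r j)) c\<bar> * \<bar>ev (bump (b j) (s j)) c\<bar>"
  have e: "?e j \<in> {c \<in> frags M. len c \<le> 4}" if j: "j \<in> J" for j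
    using M[OF j] len_diff[of "frag_of (p j)" "frag_of (q j)"] len_diff[of "frag_of (a j)" "frag_of (b j)"]
      len_add[of "frag_of (p j) - frag_of (q j)" "frag_of (a j) - frag_of (b j)"] by simp
  have fe: "?f j (?e j) \<ge> 1" if j: "j \<in> J" for j
  proof -
    have "ev (bump (p j) (r j)) (?e j) = 1" "ev (bump (b j) (s j)) (?e j) = -1"
      using M[OF j] r[OF j] s[OF j] by (simp_all add: bump_center bump_eq_0)
    then show ?thesis by (simp only: abs_minus abs_one)
  qed
  have fc: "continuous_map T euclideanreal (?f j)" if j: "j \<in> J" for j
    using M[OF j] r[OF j] s[OF j] by (intro continuous_map_real_mult abs_ev_bump_continuous) auto
  have cl': "\<exists>j\<in>J. ?e j \<in> U" if U: "openin T U" "0 \<in> U" for U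
  proof -
    obtain V where V: "openin T V" "0 \<in> V" "\<And>x y. x \<in> V \<Longrightarrow> y \<in> V \<Longrightarrow> x + y \<in> U"
      using open_symmetric_nbhd[OF U] by metis
    show ?thesis using cl[OF V(1,2)] V(3) by blast
  qed
  have fin': "finite {j \<in> J. \<exists>c\<in>L. ?f j c \<noteq> 0}" if "compactin T L" for L
    using fin[OF that] by simp
  show "\<not> k_space (bounded_length 4)"
    by (rule not_k_space_not_kR_space(1)[where f = ?f and e = ?e and J = J])
      (use e fe fc cl' fin' topspace_T in auto)
  show "\<not> kR_space (bounded_length 4)"
    by (rule not_k_space_not_kR_space(2)[where f = ?f and e = ?e and J = J])
      (use e fe fc cl' fin' topspace_T in auto)
qed

text \<open>The index is a pair \<open>(n, k)\<close>: \<open>p n\<close> is a locally finite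
  sequence inside a ball around \<open>z\<close> whose radius shrinks with \<open>n\<close>, and
  \<open>y n k\<close> approaches the non-isolated point \<open>a n\<close> as \<open>k\<close>
  grows. A compact set meets the tents at finitely many \<open>a n\<close>, and for each such
  \<open>n\<close> at finitely many \<open>p n k\<close>. Conversely, given a neighbourhood of 0, a
  large \<open>n\<close> brings all \<open>p n k\<close> close to \<open>z\<close>, and a large
  \<open>k\<close>, depending on \<open>n\<close>, brings \<open>y n k\<close> close to
  \<open>a n\<close>.\<close>

lemma not_locally_compact_imp_not_k_space:
  assumes nlc: "\<not> locally_compact_space mtopology" and nc: "\<not> compactin mtopology (non_isolated mtopology)"
  shows "\<not> k_space (bounded_length 4)" "\<not> kR_space (bounded_length 4)"
proof -
  obtain z where z: "z \<in> M" and nz: "\<And>U K. openin mtopology U \<Longrightarrow> compactin mtopology K \<Longrightarrow> z \<in> U \<Longrightarrow> \<not> U \<subseteq> K"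
    using nlc unfolding locally_compact_space_def by auto
  obtain a0 :: "nat \<Rightarrow> 'a" where a0: "range a0 \<subseteq> non_isolated mtopology"
    "\<And>x. x \<in> M \<Longrightarrow> \<exists>\<delta>>0. finite {n. a0 n \<in> mball x \<delta>}"
    using noncompact_sequence[OF closedin_non_isolated nc] by metis
  obtain \<delta> where \<delta>: "\<delta> > 0" "finite {n. a0 n \<in> mball z \<delta>}" using a0(2)[OF z] by blast
  obtain N where N: "\<And>n. a0 n \<in> mball z \<delta> \<Longrightarrow> n < N"
    using \<delta>(2) finite_nat_set_iff_bounded by auto
  \<comment> \<open>Without the first \<open>N\<close> terms every \<open>a n\<close> has distance
    at least \<open>\<delta>\<close> from \<open>z\<close>. The points \<open>p n k\<close> will
    stay within \<open>\<delta> / 4\<close> of \<open>z\<close> and \<open>y n k\<close> within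
    \<open>\<delta> / 4\<close> of \<open>a n\<close>, which leaves a gap of at least
    \<open>\<delta> / 4\<close> between the two groups.\<close>
  define a where "a n = a0 (n + N)" for n
  have aNI: "a n \<in> non_isolated mtopology" for n using a0(1) by (auto simp: a_def)
  have aM: "a n \<in> M" for n using aNI by (auto simp: non_isolated_def)
  have az: "\<delta> \<le> d z (a n)" for n using N[of "n + N"] z aM[of n] unfolding a_def by force
  have a: "\<exists>\<delta>>0. finite {n. a n \<in> mball x \<delta>}" if x: "x \<in> M" for x
  proof -
    obtain \<epsilon> where \<epsilon>: "\<epsilon> > 0" "finite {n. a0 n \<in> mball x \<epsilon>}" using a0(2)[OF x] by blast
    have "finite ((\<lambda>n. n + N) -` {n. a0 n \<in> mball x \<epsilon>})"
      using \<epsilon>(2) by (rule finite_vimageI) simp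
    then show ?thesis using \<epsilon>(1) by (intro exI[of _ \<epsilon>]) (simp add: a_def vimage_def)
  qed
  have "\<exists>\<sigma> :: nat \<Rightarrow> 'a. range \<sigma> \<subseteq> mcball z (\<delta> / (4 * Suc n)) \<and> (\<forall>x\<in>M. \<exists>\<delta>>0. finite {k. \<sigma> k \<in> mball x \<delta>})" for n
  proof -
    have "z \<in> mball z (\<delta> / (4 * Suc n))" using z \<delta>(1) by simp
    then have "\<not> compactin mtopology (mcball z (\<delta> / (4 * Suc n)))"
      using nz[OF openin_mball] mball_subset_mcball by blast
    then show ?thesis by (rule noncompact_sequence[OF closedin_mcball])
  qed
  then obtain p :: "nat \<Rightarrow> nat \<Rightarrow> 'a" where p: "\<And>n. range (p n) \<subseteq> mcball z (\<delta> / (4 * Suc n))"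
    "\<And>n x. x \<in> M \<Longrightarrow> \<exists>\<delta>>0. finite {k. p n k \<in> mball x \<delta>}"
    by metis
  have pM: "p n k \<in> M" and pz: "d z (p n k) \<le> \<delta> / (4 * Suc n)" for n k
    using subsetD[OF p(1) rangeI, of n k] by simp_all
  have pz4: "d z (p n k) \<le> \<delta> / 4" for n k
  proof -
    have "\<delta> / (4 * Suc n) \<le> \<delta> / 4" using \<delta>(1) by (intro divide_left_mono) auto
    then show ?thesis using pz[of n k] by linarith
  qed
  have "\<exists>y. y \<in> M \<and> y \<noteq> a n \<and> d (a n) y < \<delta> / (4 * Suc k)" for n k
    using \<delta>(1) by (intro non_isolated_near[OF aNI]) simp
  then obtain y where y: "\<And>n k. y n k \<in> M" "\<And>n k. y n k \<noteq> a n" "\<And>n k. d (a n) (y n k) < \<delta> / (4 * Suc k)"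
    by metis
  have y4: "d (a n) (y n k) < \<delta> / 4" for n k
  proof -
    have "\<delta> / (4 * Suc k) \<le> \<delta> / 4" using \<delta>(1) by (intro divide_left_mono) auto
    then show ?thesis using y(3)[of n k] by linarith
  qed
  have pa: "\<delta> / 4 \<le> d (p n k) (a m)" for n k m
    using triangle[OF z pM[of n k] aM[of m]] az[of m] pz4[of n k] \<delta>(1) by linarith
  have py: "\<delta> / 4 \<le> d (p n k) (y m l)" for n k m l
    using triangle[OF pM[of n k] y(1)[of m l] aM[of m]] y4[of m l] commute[of "y m l" "a m"]
      triangle[OF z pM[of n k] aM[of m]] az[of m] pz4[of n k] \<delta>(1) by linarith
  \<comment> \<open>For each \<open>n\<close> the sequence \<open>p n\<close> may hit
    \<open>z\<close> itself, but only for finitely many \<open>k\<close>; these indices are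
    discarded.\<close>
  define J where "J = {(n, k). p n k \<noteq> z}"
  \<comment> \<open>\<open>1 / Suc k\<close> makes the balls around \<open>p n k\<close> locally
    finite for fixed \<open>n\<close>, the distance to \<open>z\<close> excludes \<open>z\<close>
    from the tent, and \<open>\<delta> / 4\<close> excludes \<open>a n\<close> and
    \<open>y n k\<close>. The three bounds in \<open>s\<close> have the same roles around
    \<open>a n\<close>.\<close>
  define r where "r n k = min (1 / Suc k) (min (d (p n k) z) (\<delta> / 4))" for n k
  define s where "s n k = min (1 / Suc n) (min (d (a n) (y n k)) (\<delta> / 4))" for n k
  have fin: "finite {j \<in> J. \<exists>c\<in>L. ev (bump (p (fst j) (snd j)) (r (fst j) (snd j))) c \<noteq> 0 \<and>
      ev (bump (a (fst j)) (s (fst j) (snd j))) c \<noteq> 0}" (is "finite ?A") if L: "compactin T L" for L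
  proof -
    have L_sub: "L \<subseteq> frags M" using compactin_subset_topspace[OF L] topspace_T by simp
    let ?N = "{n \<in> UNIV. \<exists>c\<in>L. Poly_Mapping.keys c \<inter> mball (a n) (1 / Suc n) \<noteq> {}}"
    let ?K = "\<lambda>n. {k \<in> UNIV. \<exists>c\<in>L. Poly_Mapping.keys c \<inter> mball (p n k) (1 / Suc k) \<noteq> {}}"
    have "finite ?N"
      by (rule compact_supports_locally_finite[OF L]) (use shrinking_balls_locally_finite[OF a] in auto)
    moreover have "finite (?K n)" for n
      by (rule compact_supports_locally_finite[OF L]) (use shrinking_balls_locally_finite[OF p(2)] in auto)
    ultimately have "finite (Sigma ?N ?K)" by blast
    moreover have "?A \<subseteq> Sigma ?N ?K"
    proof
      fix j assume "j \<in> ?A"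
      then obtain n k c where jnk: "j = (n, k)" and j: "(n, k) \<in> J" "c \<in> L"
        "ev (bump (p n k) (r n k)) c \<noteq> 0" "ev (bump (a n) (s n k)) c \<noteq> 0"
        by (cases j) auto
      have "r n k > 0" using j(1) \<delta>(1) pM z by (auto simp: r_def J_def)
      moreover have "s n k > 0" using \<delta>(1) aM[of n] y(1,2)[of n k] by (auto simp: s_def)
      moreover have "r n k \<le> 1 / Suc k" "s n k \<le> 1 / Suc n" by (auto simp: r_def s_def)
      ultimately have "Poly_Mapping.keys c \<inter> mball (p n k) (1 / Suc k) \<noteq> {}"
        "Poly_Mapping.keys c \<inter> mball (a n) (1 / Suc n) \<noteq> {}"
        using ev_bump_nonzero[OF j(3), of "1 / Suc k"] ev_bump_nonzero[OF j(4), of "1 / Suc n"]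
          subsetD[OF L_sub j(2)] pM aM by simp_all
      then show "j \<in> Sigma ?N ?K" unfolding jnk using j(2) by blast
    qed
    ultimately show ?thesis by (rule finite_subset[rotated])
  qed
  have cl: "\<exists>j\<in>J. frag_of (p (fst j) (snd j)) - frag_of z \<in> U \<and>
      frag_of (y (fst j) (snd j)) - frag_of (a (fst j)) \<in> U"
    if U: "openin T U" "0 \<in> U" for U
  proof -
    obtain r1 where r1: "r1 > 0" "\<And>x. x \<in> mball z r1 \<Longrightarrow> frag_of x - frag_of z \<in> U"
      using frag_of_near[OF U z] by metis
    obtain n where n: "1 / Suc n < r1 * 4 / \<delta>" using nat_approx_posE[of "r1 * 4 / \<delta>"] r1 \<delta>(1) by auto
    then have n': "\<delta> / (4 * Suc n) < r1" using \<delta>(1) by (simp add: field_simps)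
    obtain r2 where r2: "r2 > 0" "\<And>x. x \<in> mball (a n) r2 \<Longrightarrow> frag_of x - frag_of (a n) \<in> U"
      using frag_of_near[OF U aM[of n]] by metis
    obtain k0 where k0: "1 / Suc k0 < r2 * 4 / \<delta>" using nat_approx_posE[of "r2 * 4 / \<delta>"] r2 \<delta>(1) by auto
    obtain \<eta> where \<eta>: "\<eta> > 0" "finite {k. p n k \<in> mball z \<eta>}" using p(2)[OF z] by blast
    then obtain k1 where k1: "\<And>k. p n k \<in> mball z \<eta> \<Longrightarrow> k < k1"
      using finite_nat_set_iff_bounded by auto
    define k where "k = max k0 k1"
    have "p n k \<noteq> z" using k1[of k] \<eta>(1) z by (auto simp: k_def)
    moreover have "p n k \<in> mball z r1" using pz[of n k] n' pM z by auto
    moreover have "y n k \<in> mball (a n) r2"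
    proof -
      have "1 / Suc k \<le> 1 / Suc k0" by (simp add: k_def frac_le)
      then have "1 / Suc k < r2 * 4 / \<delta>" using k0 by linarith
      then have "\<delta> / (4 * Suc k) < r2" using \<delta>(1) by (simp add: field_simps)
      then show ?thesis using y(1,3)[of n k] aM by auto
    qed
    ultimately show ?thesis using r1(2) r2(2) by (intro bexI[of _ "(n, k)"]) (auto simp: J_def)
  qed
  have r: "r n k > 0 \<and> r n k \<le> d (p n k) z \<and> r n k \<le> d (p n k) (y n k) \<and> r n k \<le> d (p n k) (a n)"
    if "(n, k) \<in> J" for n k
    using that \<delta>(1) pM[of n k] z pa[of n k n] py[of n k n k] by (auto simp: r_def J_def min_def)
  have s: "s n k > 0 \<and> s n k \<le> d (a n) z \<and> s n k \<le> d (a n) (y n k) \<and> s n k \<le> d (a n) (p n k)" for n k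
    using \<delta>(1) aM[of n] y(1,2)[of n k] az[of n] pa[of n k n] commute[of "a n" "p n k"] commute[of "a n" z]
    by (auto simp: s_def min_def)
  have "p (fst j) (snd j) \<in> M \<and> z \<in> M \<and> y (fst j) (snd j) \<in> M \<and> a (fst j) \<in> M" if "j \<in> J" for j
    using pM z y(1) aM by simp
  note not_k = not_k_space_not_kR_space_of_pairs[of J "\<lambda>j. p (fst j) (snd j)" "\<lambda>_. z"
      "\<lambda>j. y (fst j) (snd j)" "\<lambda>j. a (fst j)" "\<lambda>j. r (fst j) (snd j)" "\<lambda>j. s (fst j) (snd j)",
      OF this r s fin cl]
  show "\<not> k_space (bounded_length 4)"
    by (rule not_k(1)) simp_all
  show "\<not> kR_space (bounded_length 4)"
    by (rule not_k(2)) simp_all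
qed

text \<open>Any uncountable set of reals contains two points at distance below \<open>1/m\<close>; this replaces the
  combinatorics of \<open>\<omega>\<^sub>1\<close> in showing that \<open>0\<close> lies in the closure of the elements
  \<open>(\<alpha> - \<alpha>\<^sub>k) + (\<beta>\<^sub>k - \<beta>)\<close>, where \<open>k\<close> is about \<open>1/\<bar>g \<alpha> - g \<beta>\<bar>\<close> for an injection \<open>g\<close> into the reals.\<close>

lemma not_separable_imp_not_k_space:
  assumes ns: "\<not> separable_space (subtopology mtopology (non_isolated mtopology))"
  shows "\<not> k_space (bounded_length 4)" "\<not> kR_space (bounded_length 4)"
proof -
  have NI: "non_isolated mtopology \<subseteq> M" by (auto simp: non_isolated_def)
  obtain E0 \<epsilon> where E0: "E0 \<subseteq> non_isolated mtopology" "uncountable E0" "\<epsilon> > 0"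
    "\<And>x y. x \<in> E0 \<Longrightarrow> y \<in> E0 \<Longrightarrow> x \<noteq> y \<Longrightarrow> \<epsilon> \<le> d x y"
    using nonseparable_separated_subset[OF NI ns] by metis
  obtain E and g :: "'a \<Rightarrow> real" where E: "E \<subseteq> E0" "uncountable E" "inj_on g E"
    using uncountable_injects_into_reals[OF E0(2)] by metis
  have EM: "x \<in> M" if "x \<in> E" for x using that E E0 NI by blast
  have Esep: "\<epsilon> \<le> d x y" if "x \<in> E" "y \<in> E" "x \<noteq> y" for x y using that E E0(4) by blast
  have "\<exists>y. y \<in> M \<and> y \<noteq> x \<and> d x y < min (\<epsilon> / 4) (1 / Suc n)" if "x \<in> E" for x n
  proof -
    have "x \<in> non_isolated mtopology" using that E E0 by blast
    then show ?thesis using E0(3) by (intro non_isolated_near) auto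
  qed
  then obtain y where y0: "\<And>x n. x \<in> E \<Longrightarrow> y x n \<in> M \<and> y x n \<noteq> x \<and> d x (y x n) < min (\<epsilon> / 4) (1 / Suc n)"
    by metis
  have y: "y x n \<in> M" "y x n \<noteq> x" "d x (y x n) < \<epsilon> / 4" "d x (y x n) < 1 / Suc n" if "x \<in> E" for x n
    using y0[OF that, of n] by auto
  define J where "J = {(\<alpha>, \<beta>). \<alpha> \<in> E \<and> \<beta> \<in> E \<and> \<alpha> \<noteq> \<beta>}"
  define k where "k j = nat \<lceil>1 / \<bar>g (fst j) - g (snd j)\<bar>\<rceil>" for j
  define r where "r j = d (fst j) (y (fst j) (k j))" for j
  define s where "s j = d (snd j) (y (snd j) (k j))" for j
  \<comment> \<open>A ball of radius \<open>\<epsilon> / 4\<close> around \<open>z\<close> meets at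
    most one of these balls: the centres of two of them would both be closer than
    \<open>\<epsilon> / 2\<close> to \<open>z\<close>, hence closer than \<open>\<epsilon>\<close>
    to each other.\<close>
  have ball: "finite {x \<in> E. \<exists>c\<in>L. Poly_Mapping.keys c \<inter> mball x (\<epsilon> / 4) \<noteq> {}}" if L: "compactin T L" for L
  proof (rule compact_supports_locally_finite[OF L, where I = E and B = "\<lambda>x. mball x (\<epsilon> / 4)"])
    fix z assume z: "z \<in> M"
    have "x = x'" if xx: "x \<in> E" "x' \<in> E" "mball z (\<epsilon>/4) \<inter> mball x (\<epsilon>/4) \<noteq> {}" "mball z (\<epsilon>/4) \<inter> mball x' (\<epsilon>/4) \<noteq> {}" for x x'
    proof (rule ccontr)
      have near: "d x z < \<epsilon> / 2" if x: "x \<in> E" "mball z (\<epsilon>/4) \<inter> mball x (\<epsilon>/4) \<noteq> {}" for x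
      proof -
        obtain u where u: "u \<in> mball z (\<epsilon>/4)" "u \<in> mball x (\<epsilon>/4)" using x by blast
        have "d x z \<le> d x u + d u z" using u z by (intro triangle) auto
        then show ?thesis using u commute[of u z] by auto
      qed
      assume "x \<noteq> x'"
      then have "\<epsilon> \<le> d x x'" using Esep xx by blast
      also have "\<dots> \<le> d x z + d x' z" using triangle[OF EM[OF xx(1)] z EM[OF xx(2)]] commute[of z x'] by simp
      finally show False using near[OF xx(1,3)] near[OF xx(2,4)] by linarith
    qed
    then have "\<exists>x. {x \<in> E. mball z (\<epsilon>/4) \<inter> mball x (\<epsilon>/4) \<noteq> {}} \<subseteq> {x}" by blast
    then have "finite {x \<in> E. mball z (\<epsilon>/4) \<inter> mball x (\<epsilon>/4) \<noteq> {}}"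
      using finite_subset by blast
    then show "\<exists>\<delta>>0. finite {x \<in> E. mball z \<delta> \<inter> mball x (\<epsilon>/4) \<noteq> {}}"
      using E0(3) by (intro exI[of _ "\<epsilon>/4"]) auto
  qed auto
  have fin: "finite {j \<in> J. \<exists>c\<in>L. ev (bump (fst j) (r j)) c \<noteq> 0 \<and> ev (bump (snd j) (s j)) c \<noteq> 0}"
    (is "finite ?A") if L: "compactin T L" for L
  proof -
    let ?F = "{x \<in> E. \<exists>c\<in>L. Poly_Mapping.keys c \<inter> mball x (\<epsilon> / 4) \<noteq> {}}"
    have L_sub: "L \<subseteq> frags M" using compactin_subset_topspace[OF L] topspace_T by simp
    have "?A \<subseteq> ?F \<times> ?F"
    proof
      fix j assume "j \<in> ?A"
      then obtain \<alpha> \<beta> c where jab: "j = (\<alpha>, \<beta>)" and j: "(\<alpha>, \<beta>) \<in> J" "c \<in> L"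
        "ev (bump \<alpha> (r (\<alpha>, \<beta>))) c \<noteq> 0" "ev (bump \<beta> (s (\<alpha>, \<beta>))) c \<noteq> 0"
        by (cases j) auto
      have "r (\<alpha>, \<beta>) > 0" "s (\<alpha>, \<beta>) > 0" "r (\<alpha>, \<beta>) \<le> \<epsilon> / 4" "s (\<alpha>, \<beta>) \<le> \<epsilon> / 4" "\<alpha> \<in> E" "\<beta> \<in> E"
        using j(1) y(1,2,3)[of \<alpha> "k (\<alpha>, \<beta>)"] y(1,2,3)[of \<beta> "k (\<alpha>, \<beta>)"] EM
        by (auto simp: J_def r_def s_def)
      then have "Poly_Mapping.keys c \<inter> mball \<alpha> (\<epsilon> / 4) \<noteq> {}" "Poly_Mapping.keys c \<inter> mball \<beta> (\<epsilon> / 4) \<noteq> {}"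
        using ev_bump_nonzero[OF j(3), of "\<epsilon> / 4"] ev_bump_nonzero[OF j(4), of "\<epsilon> / 4"]
          subsetD[OF L_sub j(2)] EM by simp_all
      then show "j \<in> ?F \<times> ?F"
        unfolding jab using j(2) \<open>\<alpha> \<in> E\<close> \<open>\<beta> \<in> E\<close> by blast
    qed
    moreover have "finite (?F \<times> ?F)" using ball[OF L] by simp
    ultimately show ?thesis by (rule finite_subset)
  qed
  have cl: "\<exists>j\<in>J. frag_of (fst j) - frag_of (y (fst j) (k j)) \<in> U \<and>
      frag_of (y (snd j) (k j)) - frag_of (snd j) \<in> U" if U0: "openin T U" "0 \<in> U" for U
  proof -
    obtain V where V: "openin T V" "0 \<in> V" "V \<subseteq> U" "\<And>x. x \<in> V \<Longrightarrow> - x \<in> V"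
      using open_symmetric_nbhd[OF U0] by metis
    have "\<exists>m. \<forall>n\<ge>m. frag_of (y x n) - frag_of x \<in> V" if x: "x \<in> E" for x
    proof -
      obtain \<rho> where \<rho>: "\<rho> > 0" "\<And>z. z \<in> mball x \<rho> \<Longrightarrow> frag_of z - frag_of x \<in> V"
        using frag_of_near[OF V(1,2) EM[OF x]] by metis
      obtain m where m: "1 / Suc m < \<rho>" using nat_approx_posE[OF \<rho>(1)] by blast
      have "y x n \<in> mball x \<rho>" if "n \<ge> m" for n
      proof -
        have "1 / Suc n \<le> 1 / Suc m" using that by (simp add: frac_le)
        then show ?thesis using y(1,4)[OF x, of n] m EM[OF x] by auto
      qed
      then show ?thesis using \<rho>(2) by blast
    qed
    then obtain m where m: "\<And>x n. x \<in> E \<Longrightarrow> n \<ge> m x \<Longrightarrow> frag_of (y x n) - frag_of x \<in> V" by metis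
    \<comment> \<open>Each point of \<open>E\<close> has its own threshold \<open>m x\<close>; since
      \<open>E\<close> is uncountable, one value \<open>i\<close> is shared by uncountably many
      points.\<close>
    have "\<not> countable (\<Union>i. {x \<in> E. m x = i})"
      using E(2) by (auto dest: countable_subset[of E, rotated])
    then obtain i where i: "uncountable {x \<in> E. m x = i}" by auto
    \<comment> \<open>The floors take countably many values, so two points of the class share one.
      Their labels then differ by less than \<open>1 / Suc i\<close>, which makes
      \<open>k (\<alpha>, \<beta>)\<close> at least the common threshold \<open>i\<close>.\<close>
    have "\<not> inj_on (\<lambda>x. \<lfloor>g x * Suc i\<rfloor>) {x \<in> E. m x = i}"
      using i countable_image_inj_on[OF countableI_type] by blast
    then obtain \<alpha> \<beta> where ab: "\<alpha> \<in> E" "\<beta> \<in> E" "m \<alpha> = i" "m \<beta> = i" "\<alpha> \<noteq> \<beta>" "\<lfloor>g \<alpha> * Suc i\<rfloor> = \<lfloor>g \<beta> * Suc i\<rfloor>"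
      unfolding inj_on_def by blast
    have "g \<alpha> \<noteq> g \<beta>" using ab E(3) by (meson inj_onD)
    have "\<bar>g \<alpha> * Suc i - g \<beta> * Suc i\<bar> < 1" using ab(6) by linarith
    then have "\<bar>g \<alpha> - g \<beta>\<bar> * Suc i < 1"
      by (metis abs_mult abs_of_nat left_diff_distrib)
    then have "Suc i < 1 / \<bar>g \<alpha> - g \<beta>\<bar>" using \<open>g \<alpha> \<noteq> g \<beta>\<close> by (simp add: field_simps)
    then have "real i \<le> real (k (\<alpha>, \<beta>))" unfolding k_def by simp linarith
    then have k: "i \<le> k (\<alpha>, \<beta>)" by simp
    have "frag_of (y \<alpha> (k (\<alpha>, \<beta>))) - frag_of \<alpha> \<in> V" "frag_of (y \<beta> (k (\<alpha>, \<beta>))) - frag_of \<beta> \<in> V"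
      using m ab k by auto
    then have "- (frag_of (y \<alpha> (k (\<alpha>, \<beta>))) - frag_of \<alpha>) \<in> U" "frag_of (y \<beta> (k (\<alpha>, \<beta>))) - frag_of \<beta> \<in> U"
      using V by blast+
    then show ?thesis using ab by (intro bexI[of _ "(\<alpha>, \<beta>)"]) (auto simp: J_def)
  qed
  have far: "\<epsilon> / 4 \<le> d x (y x' n)" if "x \<in> E" "x' \<in> E" "x \<noteq> x'" for x x' n
    using Esep[OF that] triangle[OF EM[OF that(1)] y(1)[OF that(2), of n] EM[OF that(2)]]
      y(3)[OF that(2), of n] commute[of x' "y x' n"] E0(3) by linarith
  have r: "r j > 0 \<and> r j \<le> d (fst j) (y (fst j) (k j)) \<and> r j \<le> d (fst j) (y (snd j) (k j)) \<and> r j \<le> d (fst j) (snd j)"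
    and s: "s j > 0 \<and> s j \<le> d (snd j) (y (fst j) (k j)) \<and> s j \<le> d (snd j) (y (snd j) (k j)) \<and> s j \<le> d (snd j) (fst j)"
    if jJ: "j \<in> J" for j
  proof -
    obtain \<alpha> \<beta> where j: "j = (\<alpha>, \<beta>)" "\<alpha> \<in> E" "\<beta> \<in> E" "\<alpha> \<noteq> \<beta>" using jJ by (auto simp: J_def)
    show "r j > 0 \<and> r j \<le> d (fst j) (y (fst j) (k j)) \<and> r j \<le> d (fst j) (y (snd j) (k j)) \<and> r j \<le> d (fst j) (snd j)"
      using y[OF j(2), of "k j"] EM[OF j(2)] far[OF j(2,3,4), of "k j"] Esep[OF j(2,3,4)] E0(3)
      unfolding r_def j(1) by (auto simp: mdist_pos_less)
    show "s j > 0 \<and> s j \<le> d (snd j) (y (fst j) (k j)) \<and> s j \<le> d (snd j) (y (snd j) (k j)) \<and> s j \<le> d (snd j) (fst j)"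
      using y[OF j(3), of "k j"] EM[OF j(3)] far[OF j(3,2), of "k j"] j(4) Esep[OF j(3,2)] E0(3)
      unfolding s_def j(1) by (auto simp: mdist_pos_less)
  qed
  have JM: "fst j \<in> M \<and> y (fst j) (k j) \<in> M \<and> y (snd j) (k j) \<in> M \<and> snd j \<in> M" if "j \<in> J" for j
    using that y(1) EM by (auto simp: J_def)
  note not_k = not_k_space_not_kR_space_of_pairs[of J fst "\<lambda>j. y (fst j) (k j)"
      "\<lambda>j. y (snd j) (k j)" snd r s, OF JM r s fin cl]
  show "\<not> k_space (bounded_length 4)"
    by (rule not_k(1))
  show "\<not> kR_space (bounded_length 4)"
    by (rule not_k(2))
qed

end

section \<open>Sufficiency\<close>

context free_abelian_metric
begin

lemma kR_space_if_k_space: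
  assumes "k_space (subtopology T S)"
  shows "kR_space (subtopology T S)"
  unfolding kR_space_def
proof (intro conjI allI impI)
  fix f :: "_ \<Rightarrow> real"
  assume "\<forall>K. compactin (subtopology T S) K \<longrightarrow>
    continuous_map (subtopology (subtopology T S) K) euclideanreal f"
  then show "continuous_map (subtopology T S) euclideanreal f"
    by (intro continuous_map_from_k_space[OF assms]) blast
qed (rule Tychonoff_subtopology)

text \<open>\<open>A(X)\<close> for a \<open>k\<^sub>\<omega>\<close>-space \<open>X\<close>: the sets \<open>signed_sums (Y n) n\<close> are compact, and the sets whose trace on
  each of them is open form a filter base at \<open>0\<close> as in \<open>filter_base_nbhd\<close>.\<close>

fun signed_sums :: "'a set \<Rightarrow> nat \<Rightarrow> ('a \<Rightarrow>\<^sub>0 int) set" where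
  "signed_sums Z 0 = {0}"
| "signed_sums Z (Suc n) =
    {a + b |a b. a \<in> signed_sums Z n \<and> b \<in> {0} \<union> frag_of ` Z \<union> uminus ` frag_of ` Z}"

declare signed_sums.simps(2) [simp del]

lemma sums_compact:
  assumes "compactin mtopology Z"
  shows "compactin T (signed_sums Z n)"
proof (induction n)
  case 0
  then show ?case using zero_in by simp
next
  case (Suc n)
  have "compactin T (frag_of ` Z)"
    using assms frag_of_continuous image_compactin by blast
  moreover have "continuous_map T T uminus"
    using continuous_uminus[of T "\<lambda>x. x"] by simp
  ultimately have "compactin T ({0} \<union> frag_of ` Z \<union> uminus ` frag_of ` Z)"
    using zero_in image_compactin[of T "frag_of ` Z" T uminus] by (intro compactin_Un) auto
  then have "compactin (prod_topology T T) (signed_sums Z n \<times> ({0} \<union> frag_of ` Z \<union> uminus ` frag_of ` Z))"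
    using Suc by (simp add: compactin_Times)
  moreover have "continuous_map (prod_topology T T) T (\<lambda>(a, b). a + b)"
    unfolding case_prod_beta' by (intro continuous_add continuous_map_fst continuous_map_snd)
  ultimately have "compactin T ((\<lambda>(a, b). a + b) ` (signed_sums Z n \<times> ({0} \<union> frag_of ` Z \<union> uminus ` frag_of ` Z)))"
    by (rule image_compactin)
  moreover have "{a + b |a b. a \<in> A \<and> b \<in> B} = (\<lambda>(a, b). a + b) ` (A \<times> B)"
    for A B :: "('a \<Rightarrow>\<^sub>0 int) set"
    by force
  ultimately show ?case by (simp only: signed_sums.simps)
qed

lemma sums_Suc: "signed_sums Z n \<subseteq> signed_sums Z (Suc n)"
proof
  fix a assume "a \<in> signed_sums Z n"
  then have "a + 0 \<in> signed_sums Z (Suc n)" unfolding signed_sums.simps by blast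
  then show "a \<in> signed_sums Z (Suc n)" by simp
qed

lemma sums_mono: "Z \<subseteq> Z' \<Longrightarrow> m \<le> n \<Longrightarrow> signed_sums Z m \<subseteq> signed_sums Z' n"
proof -
  assume *: "Z \<subseteq> Z'" "m \<le> n"
  have "signed_sums Z m \<subseteq> signed_sums Z' m"
  proof (induction m)
    case (Suc m)
    then show ?case using *(1) unfolding signed_sums.simps by blast
  qed simp
  also have "\<dots> \<subseteq> signed_sums Z' n"
    using lift_Suc_mono_le[of "signed_sums Z'", OF sums_Suc *(2)] .
  finally show ?thesis .
qed

lemma add_in_sums: "a \<in> signed_sums Z m \<Longrightarrow> b \<in> signed_sums Z n \<Longrightarrow> a + b \<in> signed_sums Z (m + n)"
proof (induction n arbitrary: b)
  case (Suc n)
  then obtain b' t where b: "b = b' + t" "b' \<in> signed_sums Z n" "t \<in> {0} \<union> frag_of ` Z \<union> uminus ` frag_of ` Z"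
    unfolding signed_sums.simps by blast
  have "(a + b') + t \<in> signed_sums Z (Suc (m + n))"
    unfolding signed_sums.simps using Suc.IH[OF Suc.prems(1) b(2)] b(3) by blast
  then show ?case using b(1) by (simp add: add.assoc)
qed simp

lemma uminus_in_sums: "a \<in> signed_sums Z n \<Longrightarrow> - a \<in> signed_sums Z n"
proof (induction n arbitrary: a)
  case (Suc n)
  then obtain b t where b: "a = b + t" "b \<in> signed_sums Z n" "t \<in> {0} \<union> frag_of ` Z \<union> uminus ` frag_of ` Z"
    unfolding signed_sums.simps by blast
  have "- t \<in> {0} \<union> frag_of ` Z \<union> uminus ` frag_of ` Z" using b(3) by auto
  then have "(- b) + (- t) \<in> signed_sums Z (Suc n)"
    unfolding signed_sums.simps using Suc.IH[OF b(2)] by blast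
  then show ?case using b(1) by simp
qed simp

lemma diff_in_sums:
  assumes "a \<in> signed_sums Z m" "b \<in> signed_sums Z n"
  shows "a - b \<in> signed_sums Z (m + n)"
  using add_in_sums[OF assms(1) uminus_in_sums[OF assms(2)]] by simp

lemma frag_of_in_sums:
  assumes "x \<in> Z"
  shows "frag_of x \<in> signed_sums Z (Suc 0)"
proof -
  have "0 + frag_of x \<in> signed_sums Z (Suc 0)"
    unfolding signed_sums.simps using assms by blast
  then show ?thesis by simp
qed

text \<open>By \<open>cover\<close> every point has a ball inside some \<open>Y n\<close>, where
  traces on the sets \<open>K n\<close> control \<open>frag_of\<close>, or is isolated. The hard
  axiom of the filter base is the one on differences.\<close>

lemma k_space_of_exhaustion:
  fixes Y :: "nat \<Rightarrow> 'a set"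
  assumes comp: "\<And>n. compactin mtopology (Y n)" and Ymono: "\<And>n. Y n \<subseteq> Y (Suc n)"
    and cover: "\<And>x. x \<in> M \<Longrightarrow> \<exists>r>0. (\<exists>n. mball x r \<subseteq> Y n) \<or> mball x r = {x}"
  shows "k_space T"
proof -
  define K where "K n = signed_sums (Y n) n" for n
  have Ycomp: "compactin T (K n)" for n unfolding K_def by (rule sums_compact[OF comp])
  then have Ksub: "K n \<subseteq> topspace T" for n by (rule compactin_subset_topspace)
  have Ymono': "Y m \<subseteq> Y n" if "m \<le> n" for m n
    using lift_Suc_mono_le[of Y, OF Ymono that] .
  have Kmono: "K m \<subseteq> K n" if "m \<le> n" for m n
    unfolding K_def by (rule sums_mono[OF Ymono'[OF that] that])
  have Kdiff: "a - b \<in> K (n + n)" if "a \<in> K n" "b \<in> K n" for a b n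
    using diff_in_sums[of a "Y n" n b n] sums_mono[OF Ymono'[of n "n + n"], of "n + n" "n + n"] that
    unfolding K_def by auto
  \<comment> \<open>Nothing is required of \<open>W\<close> outside the union of the
    \<open>K n\<close>. That union itself belongs to \<open>B\<close>, hence is a neighbourhood of
    0.\<close>
  define B where "B = {W. 0 \<in> W \<and> (\<forall>n. openin (subtopology T (K n)) (W \<inter> K n))}"
  have diff: "\<exists>V\<in>B. \<forall>x\<in>V. \<forall>y\<in>V. x - y \<in> W" if W: "W \<in> B" for W
  proof -
    \<comment> \<open>\<open>P (Suc n)\<close> will be a compact neighbourhood of \<open>P n\<close>
      within \<open>K (Suc n)\<close>. The union of all \<open>P n\<close> then has open traces, and
      any two of its points lie in a common \<open>P n\<close>, whose differences belong to
      \<open>W\<close>.\<close>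
    define good where "good n P \<longleftrightarrow> compactin T P \<and> P \<subseteq> K n \<and> 0 \<in> P \<and> (\<forall>x\<in>P. \<forall>y\<in>P. x - y \<in> W)" for n P
    have "\<exists>P. \<forall>n. good n (P n) \<and> (\<exists>G. openin T G \<and> P n \<subseteq> G \<and> G \<inter> K (Suc n) \<subseteq> P (Suc n))"
    proof (rule dependent_nat_choice)
      show "\<exists>P. good 0 P"
        using W zero_in by (intro exI[of _ "{0}"]) (auto simp: good_def K_def B_def)
    next
      fix P n assume P: "good n P"
      let ?Z = "subtopology T (K (Suc n))"
      have Zcomp: "compact_space ?Z" using Ycomp by (simp add: compact_space_subtopology)
      have Zhaus: "Hausdorff_space ?Z" using Hausdorff by (rule Hausdorff_space_subtopology)
      have Ztop: "topspace ?Z = K (Suc n)" using topspace_subtopology_subset[OF Ksub] .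
      have PK: "P \<subseteq> K (Suc n)" using P Kmono[of n "Suc n"] by (auto simp: good_def)
      then have Pcomp: "compactin ?Z P" using P by (simp add: good_def compactin_subtopology)
      \<comment> \<open>Differences leave \<open>K (Suc n)\<close> but stay in
        \<open>K (Suc n + Suc n)\<close>, where the trace of \<open>W\<close> is open as
        well.\<close>
      have "continuous_map (prod_topology ?Z ?Z) (subtopology T (K (Suc n + Suc n))) (\<lambda>(x, y). x - y)"
        unfolding continuous_map_in_subtopology
      proof
        show "continuous_map (prod_topology ?Z ?Z) T (\<lambda>(x, y). x - y)"
          unfolding case_prod_beta'
          by (intro continuous_diff continuous_map_compose[OF continuous_map_fst continuous_map_from_subtopology[of T T id], unfolded o_def id_def]
             continuous_map_compose[OF continuous_map_snd continuous_map_from_subtopology[of T T id], unfolded o_def id_def])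
            auto
        show "(\<lambda>(x, y). x - y) \<in> topspace (prod_topology ?Z ?Z) \<rightarrow> K (Suc n + Suc n)"
          using Kdiff[of _ "Suc n"] by (auto simp: Ztop)
      qed
      moreover have "openin (subtopology T (K (Suc n + Suc n))) (W \<inter> K (Suc n + Suc n))"
        using W unfolding B_def by blast
      ultimately have "openin (prod_topology ?Z ?Z) {z \<in> topspace (prod_topology ?Z ?Z).
          (case z of (x, y) \<Rightarrow> x - y) \<in> W \<inter> K (Suc n + Suc n)}" (is "openin _ ?D")
        by (rule openin_continuous_map_preimage)
      moreover have "P \<times> P \<subseteq> ?D"
      proof
        fix z assume "z \<in> P \<times> P"
        then obtain x y where z: "z = (x, y)" and xy: "x \<in> P" "y \<in> P" by blast
        then have "x \<in> K (Suc n)" "y \<in> K (Suc n)" "x - y \<in> W" using P PK by (auto simp: good_def)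
        then show "z \<in> ?D"
          unfolding z using Kdiff[of x "Suc n" y] by (simp add: Ztop del: add_Suc add_Suc_right topspace_subtopology)
      qed
      ultimately obtain U1 U2 where U: "openin ?Z U1" "openin ?Z U2" "P \<subseteq> U1" "P \<subseteq> U2" "U1 \<times> U2 \<subseteq> ?D"
        by (rule Wallace_theorem_prod_topology[OF Pcomp Pcomp])
      \<comment> \<open>Wallace's theorem has provided open sets around \<open>P\<close> with
        differences in \<open>W\<close>; normality shrinks their intersection to a \<open>V\<close>
        whose closure still lies in it. The closure becomes the next set, since Wallace's theorem
        will again need a compact one.\<close>
      have "normal_space ?Z" using compact_Hausdorff_or_regular_imp_normal_space[of ?Z] Zcomp Zhaus by blast
      moreover have "closedin ?Z P" using compactin_imp_closedin[OF Zhaus Pcomp] .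
      ultimately obtain V where V: "openin ?Z V" "P \<subseteq> V" "?Z closure_of V \<subseteq> U1 \<inter> U2"
        using U(1-4) unfolding normal_space_alt by (meson Int_subset_iff openin_Int)
      have P': "compactin ?Z (?Z closure_of V)"
        by (rule closedin_compact_space[OF Zcomp closedin_closure_of])
      have VP': "V \<subseteq> ?Z closure_of V" by (rule closure_of_subset) (use V(1) openin_subset in blast)
      obtain G where G: "openin T G" "V = G \<inter> K (Suc n)" using V(1) unfolding openin_subtopology by blast
      have "good (Suc n) (?Z closure_of V)"
        unfolding good_def
      proof (intro conjI ballI)
        show "compactin T (?Z closure_of V)" "?Z closure_of V \<subseteq> K (Suc n)"
          using P' unfolding compactin_subtopology by auto
        show "0 \<in> ?Z closure_of V" using P V(2) VP' by (auto simp: good_def)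
        show "x - y \<in> W" if "x \<in> ?Z closure_of V" "y \<in> ?Z closure_of V" for x y
        proof -
          have "x \<in> U1" "y \<in> U2" using that V(3) by auto
          from subsetD[OF U(5) SigmaI[OF this]] show ?thesis by simp
        qed
      qed
      then show "\<exists>P'. good (Suc n) P' \<and> (\<exists>G. openin T G \<and> P \<subseteq> G \<and> G \<inter> K (Suc n) \<subseteq> P')"
        using G V(2) VP' by (intro exI[of _ "?Z closure_of V"] exI[of _ G] conjI) auto
    qed
    then obtain P where "\<forall>n. good n (P n) \<and> (\<exists>G. openin T G \<and> P n \<subseteq> G \<and> G \<inter> K (Suc n) \<subseteq> P (Suc n))"
      by (elim exE)
    then have P: "\<And>n. good n (P n)" "\<And>n. \<exists>G. openin T G \<and> P n \<subseteq> G \<and> G \<inter> K (Suc n) \<subseteq> P (Suc n)"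
      by simp_all
    have PK: "P n \<subseteq> K n" and P0: "0 \<in> P n" for n
      using P(1)[of n] by (auto simp: good_def)
    have PSuc: "P n \<subseteq> P (Suc n)" for n
    proof -
      obtain G where "P n \<subseteq> G" "G \<inter> K (Suc n) \<subseteq> P (Suc n)" using P(2)[of n] by auto
      then show ?thesis using PK[of n] Kmono[of n "Suc n"] by auto
    qed
    have Pmono: "P m \<subseteq> P n" if "m \<le> n" for m n
      using lift_Suc_mono_le[of P, OF PSuc that] .
    have "openin (subtopology T (K n)) ((\<Union>m. P m) \<inter> K n)" for n
      unfolding openin_subopen[of _ "(\<Union>m. P m) \<inter> K n"]
    proof
      fix x assume "x \<in> (\<Union>m. P m) \<inter> K n"
      then obtain m where m: "x \<in> P m" "x \<in> K n" by blast
      \<comment> \<open>The stage is raised to at least \<open>n\<close>, because a neighbourhood of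
        \<open>P l\<close> is controlled only inside \<open>K (Suc l)\<close>.\<close>
      obtain G where G: "openin T G" "P (max m n) \<subseteq> G" "G \<inter> K (Suc (max m n)) \<subseteq> P (Suc (max m n))"
        using P(2)[of "max m n"] by auto
      have "x \<in> G" using m Pmono[of m "max m n"] G(2) by auto
      moreover have "K n \<subseteq> K (Suc (max m n))" by (rule Kmono) simp
      then have "G \<inter> K n \<subseteq> P (Suc (max m n))" using G(3) by auto
      then have "G \<inter> K n \<subseteq> (\<Union>m. P m) \<inter> K n" by auto
      ultimately show "\<exists>U. openin (subtopology T (K n)) U \<and> x \<in> U \<and> U \<subseteq> (\<Union>m. P m) \<inter> K n"
        using openin_subtopology_Int[OF G(1), of "K n"] m(2) by (intro exI[of _ "G \<inter> K n"] conjI) auto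
    qed
    then have "(\<Union>m. P m) \<in> B" using P0 by (auto simp: B_def)
    moreover have "x - y \<in> W" if "x \<in> (\<Union>m. P m)" "y \<in> (\<Union>m. P m)" for x y
    proof -
      from that obtain m m' where "x \<in> P m" "y \<in> P m'" by auto
      then have "x \<in> P (max m m')" "y \<in> P (max m m')"
        using Pmono[of m "max m m'"] Pmono[of m' "max m m'"] by auto
      then show ?thesis using P(1)[of "max m m'"] by (auto simp: good_def)
    qed
    ultimately show ?thesis by blast
  qed
  have near: "\<exists>r>0. \<forall>y\<in>mball x r. frag_of y - frag_of x \<in> W" if W: "W \<in> B" and x: "x \<in> M" for W x
  proof -
    obtain r where r: "r > 0" "(\<exists>n. mball x r \<subseteq> Y n) \<or> mball x r = {x}" using cover[OF x] by blast
    from r(2) show ?thesis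
    proof
      assume "mball x r = {x}"
      then show ?thesis using r(1) W by (intro exI[of _ r]) (auto simp: B_def)
    next
      assume "\<exists>n. mball x r \<subseteq> Y n"
      then obtain n where n: "mball x r \<subseteq> Y n" by blast
      have xn: "x \<in> Y n" using n x r(1) by auto
      let ?Z = "subtopology mtopology (Y n)"
      have inK: "frag_of y - frag_of x \<in> K (n + 2)" if "y \<in> Y n" for y
      proof -
        have "frag_of y - frag_of x \<in> signed_sums (Y n) (Suc 0 + Suc 0)"
          using that xn by (intro diff_in_sums frag_of_in_sums)
        also have "\<dots> \<subseteq> K (n + 2)" unfolding K_def by (intro sums_mono Ymono') auto
        finally show ?thesis .
      qed
      have "continuous_map ?Z (subtopology T (K (n + 2))) (\<lambda>y. frag_of y - frag_of x)"
        unfolding continuous_map_in_subtopology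
        using inK x topspace_T continuous_map_from_subtopology[OF frag_of_continuous]
        by (auto intro!: continuous_diff)
      moreover have "openin (subtopology T (K (n + 2))) (W \<inter> K (n + 2))" using W unfolding B_def by blast
      ultimately have "openin ?Z {y \<in> topspace ?Z. frag_of y - frag_of x \<in> W \<inter> K (n + 2)}"
        by (rule openin_continuous_map_preimage)
      then obtain G where G: "openin mtopology G" "{y \<in> topspace ?Z. frag_of y - frag_of x \<in> W \<inter> K (n + 2)} = G \<inter> Y n"
        unfolding openin_subtopology by blast
      have "x \<in> {y \<in> topspace ?Z. frag_of y - frag_of x \<in> W \<inter> K (n + 2)}"
        using x xn inK[OF xn] W by (auto simp: B_def)
      then have "x \<in> G" using G(2) by blast
      then obtain r' where r': "r' > 0" "mball x r' \<subseteq> G" using G(1) unfolding openin_mtopology by blast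
      have "frag_of y - frag_of x \<in> W" if "y \<in> mball x (min r r')" for y
      proof -
        have "y \<in> G \<inter> Y n" using that r'(2) n by auto
        then show ?thesis unfolding G(2)[symmetric] by blast
      qed
      then show ?thesis using r(1) r'(1) by (intro exI[of _ "min r r'"]) auto
    qed
  qed
  have inter: "\<exists>Q\<in>B. Q \<subseteq> V \<inter> W" if "V \<in> B" "W \<in> B" for V W
  proof -
    have "V \<inter> W \<inter> K n = (V \<inter> K n) \<inter> (W \<inter> K n)" for n by blast
    then have "V \<inter> W \<in> B" using that by (auto simp: B_def intro: openin_Int)
    then show ?thesis by blast
  qed
  have zero: "0 \<in> W" if "W \<in> B" for W using that by (simp add: B_def)
  show ?thesis
    unfolding k_space
  proof (intro allI impI, elim conjE)
    fix S assume S: "S \<subseteq> topspace T" "\<forall>K. compactin T K \<longrightarrow> closedin (subtopology T K) (K \<inter> S)"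
    have "\<exists>U. openin T U \<and> g \<in> U \<and> U \<subseteq> topspace T - S" if "g \<in> topspace T - S" for g
    proof -
      have g: "g \<in> topspace T" "g \<notin> S" using that by auto
      \<comment> \<open>The complement of \<open>S\<close> translated by \<open>- g\<close>. As the
        translate of \<open>K n\<close> by \<open>g\<close> is compact, the hypothesis on
        \<open>S\<close> makes the trace of \<open>W\<close> on \<open>K n\<close> open.\<close>
      define W where "W = {h. h + g \<notin> S}"
      have "openin (subtopology T (K n)) (W \<inter> K n)" for n
      proof -
        let ?L = "(\<lambda>h. h + g) ` K n"
        have cont: "continuous_map T T (\<lambda>h. h + g)" using g by (intro continuous_add) auto
        then have "compactin T ?L" using Ycomp image_compactin by blast
        then have "closedin (subtopology T ?L) (?L \<inter> S)" using S(2) by blast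
        moreover have "continuous_map (subtopology T (K n)) (subtopology T ?L) (\<lambda>h. h + g)"
          using cont by (auto simp: continuous_map_in_subtopology intro: continuous_map_from_subtopology)
        ultimately have cl: "closedin (subtopology T (K n)) {h \<in> topspace (subtopology T (K n)). h + g \<in> ?L \<inter> S}"
          by (intro closedin_continuous_map_preimage)
        have top: "topspace (subtopology T (K n)) = K n" using topspace_subtopology_subset[OF Ksub] .
        have "W \<inter> K n = K n - {h \<in> K n. h + g \<in> ?L \<inter> S}" by (auto simp: W_def)
        then show ?thesis using openin_diff[OF openin_topspace cl] unfolding top by simp
      qed
      then have "W \<in> B" using g(2) by (auto simp: B_def W_def)
      obtain U where U: "openin T U" "0 \<in> U" "U \<subseteq> W"
      proof (rule filter_base_nbhd[of B W])
        show "0 \<in> V" if "V \<in> B" for V by (rule zero[OF that])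
        show "\<exists>Q\<in>B. Q \<subseteq> V \<inter> V'" if "V \<in> B" "V' \<in> B" for V V' by (rule inter[OF that])
        show "\<exists>V'\<in>B. \<forall>x\<in>V'. \<forall>y\<in>V'. x - y \<in> V" if "V \<in> B" for V by (rule diff[OF that])
        show "\<exists>r>0. \<forall>y\<in>mball x r. frag_of y - frag_of x \<in> V" if "V \<in> B" "x \<in> M" for V x
          by (rule near[OF that])
      qed (use \<open>W \<in> B\<close> in blast)+
      have "{h \<in> topspace T. h - g \<in> U} \<subseteq> topspace T - S" using U(3) by (force simp: W_def)
      then show ?thesis using openin_translate[OF U(1) g(1)] g U(2)
        by (intro exI[of _ "{h \<in> topspace T. h - g \<in> U}"]) auto
    qed
    then show "closedin T S"
      unfolding closedin_def using S(1) by (subst openin_subopen) blast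
  qed
qed

text \<open>The compact ones among the closed balls of radius \<open>1 / Suc k\<close> about a
  countable dense subset of NI(X) are countably many, and finite unions of them form the exhaustion.
  For a non-isolated \<open>x\<close>, a point \<open>q\<close> of the dense set closer than
  \<open>1 / Suc n\<close> to \<open>x\<close>, with \<open>1 / Suc n\<close> below half the radius
  of a ball inside a compact neighbourhood of \<open>x\<close>, yields a compact ball that has
  \<open>x\<close> in its interior.\<close>

lemma locally_compact_imp_k_space:
  assumes lc: "locally_compact_space mtopology"
    and sep: "separable_space (subtopology mtopology (non_isolated mtopology))"
  shows "k_space T"
proof -
  have NI: "non_isolated mtopology \<subseteq> M" by (auto simp: non_isolated_def)
  obtain C where C: "countable C" "C \<subseteq> non_isolated mtopology"
    "subtopology mtopology (non_isolated mtopology) closure_of C = non_isolated mtopology"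
    using sep topspace_subtopology_subset[of "non_isolated mtopology" mtopology] NI
    unfolding separable_space_def by auto
  define Q where "Q = {(q, n::nat). q \<in> C \<and> compactin mtopology (mcball q (1 / Suc n))}"
  have Qc: "countable Q"
    by (rule countable_subset[of _ "C \<times> UNIV"]) (use C(1) in \<open>auto simp: Q_def\<close>)
  define Y where "Y n = (\<Union>(q, k)\<in>{p \<in> Q. to_nat_on Q p \<le> n}. mcball q (1 / Suc k))" for n
  have fin: "finite {p \<in> Q. to_nat_on Q p \<le> n}" for n
  proof -
    have "finite (to_nat_on Q ` {p \<in> Q. to_nat_on Q p \<le> n})"
      by (rule finite_subset[of _ "{..n}"]) auto
    moreover have "inj_on (to_nat_on Q) {p \<in> Q. to_nat_on Q p \<le> n}"
      using inj_on_to_nat_on[OF Qc] by (rule inj_on_subset) auto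
    ultimately show ?thesis by (rule finite_imageD)
  qed
  have inY: "mcball q (1 / Suc k) \<subseteq> Y (to_nat_on Q (q, k))" if "(q, k) \<in> Q" for q k
    using that unfolding Y_def by blast
  show ?thesis
  proof (rule k_space_of_exhaustion)
    show "compactin mtopology (Y n)" for n
      unfolding Y_def using fin by (intro compactin_Union) (auto simp: Q_def)
    show "Y n \<subseteq> Y (Suc n)" for n unfolding Y_def by force
    show "\<exists>r>0. (\<exists>n. mball x r \<subseteq> Y n) \<or> mball x r = {x}" if x: "x \<in> M" for x
    proof (cases "x \<in> non_isolated mtopology")
      case False
      then have "openin mtopology {x}" using x by (auto simp: non_isolated_def)
      then obtain r where "r > 0" "mball x r \<subseteq> {x}" unfolding openin_mtopology by blast
      then show ?thesis using x by (intro exI[of _ r]) auto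
    next
      case True
      obtain U K where U: "openin mtopology U" "compactin mtopology K" "x \<in> U" "U \<subseteq> K"
        using lc x unfolding locally_compact_space_def by auto
      obtain r where r: "r > 0" "mball x r \<subseteq> U" using U(1,3) unfolding openin_mtopology by blast
      obtain n where n: "1 / Suc n < r / 2" using nat_approx_posE[of "r / 2"] r(1) by auto
      have "x \<in> mtopology closure_of C"
        using C(3) True closure_of_subtopology_subset[of mtopology "non_isolated mtopology" C] by blast
      moreover have "1 / Suc n > 0" by simp
      ultimately obtain q where q: "q \<in> C" "q \<in> mball x (1 / Suc n)"
        unfolding metric_closure_of by blast
      have "mcball q (1 / Suc n) \<subseteq> K"
      proof
        fix y assume y: "y \<in> mcball q (1 / Suc n)"
        then have "d x y \<le> d x q + d q y" using q x by (intro triangle) auto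
        then have "y \<in> mball x r" using y q x n by auto
        then show "y \<in> K" using r U by blast
      qed
      then have "compactin mtopology (mcball q (1 / Suc n))"
        using U(2) closed_compactin closedin_mcball by blast
      then have "(q, n) \<in> Q" using q by (simp add: Q_def)
      moreover have "x \<in> mball q (1 / Suc n)" using q commute by auto
      ultimately show ?thesis
        using inY[of q n] openin_mball[of q "1 / Suc n"] mball_subset_mcball[of q "1 / Suc n"]
        unfolding openin_mtopology by (meson order_trans)
    qed
  qed
qed

end

text \<open>When \<open>K = NI(X)\<close> is compact, the sets of pairs of small \<open>\<rho>\<close>-distance, where
  \<open>\<rho> x y = d x y + max (d x K) (d y K)\<close> for \<open>x \<noteq> y\<close>, form a base of the neighbourhoods of the
  diagonal. Pairs \<open>(x, z), (z, y)\<close> of a representation \<open>\<Sum> (x\<^sub>j - y\<^sub>j)\<close> can be merged into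
  \<open>(x, y)\<close> without increasing \<open>\<Sum> \<rho> x\<^sub>j y\<^sub>j\<close>; hence an element of length at most \<open>2 n\<close> needs
  only \<open>n\<close> pairs, and the bounded part of \<open>A(X)\<close> is first countable.\<close>

context free_abelian_metric
begin

definition kap :: "'a \<Rightarrow> real" where
  "kap x = Inf (insert 1 (d x ` non_isolated mtopology))"

definition rho :: "'a \<Rightarrow> 'a \<Rightarrow> real" where
  "rho x y = (if x = y then 0 else d x y + max (kap x) (kap y))"

definition pair_sum :: "('a \<times> 'a) multiset \<Rightarrow> 'a \<Rightarrow>\<^sub>0 int" where
  "pair_sum P = (\<Sum>p\<in>#P. frag_of (fst p) - frag_of (snd p))"

definition cost :: "('a \<times> 'a) multiset \<Rightarrow> real" where
  "cost P = (\<Sum>p\<in>#P. rho (fst p) (snd p))"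

lemma kap_bdd: "bdd_below (insert 1 (d x ` non_isolated mtopology))"
  by (rule bdd_belowI[of _ 0]) auto

lemma kap_nonneg: "0 \<le> kap x"
  unfolding kap_def by (rule cInf_greatest) auto

lemma kap_le: "z \<in> non_isolated mtopology \<Longrightarrow> kap x \<le> d x z"
  unfolding kap_def by (rule cInf_lower[OF _ kap_bdd]) auto

text \<open>The element 1 inserted into the infimum caps \<open>kap\<close> and covers an empty
  NI(X); \<open>\<epsilon> \<le> 1\<close> guarantees that the witness is a real distance and not
  this element.\<close>

lemma kap_less: "kap x < \<epsilon> \<Longrightarrow> \<epsilon> \<le> 1 \<Longrightarrow> \<exists>z\<in>non_isolated mtopology. d x z < \<epsilon>"
  unfolding kap_def by (drule cInf_lessD[rotated]) auto

lemma rho_nonneg: "0 \<le> rho x y"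
  using kap_nonneg[of x] by (simp add: rho_def le_max_iff_disj)

lemma rho_commute: "rho x y = rho y x"
  by (simp add: rho_def commute max.commute)

lemma rho_triangle:
  assumes "x \<in> M" "y \<in> M" "z \<in> M"
  shows "rho x z \<le> rho x y + rho y z"
  using triangle[OF assms] kap_nonneg[of x] kap_nonneg[of y] kap_nonneg[of z] nonneg[of x y] nonneg[of y z]
  unfolding rho_def by (auto simp: max_def)

text \<open>At a non-isolated \<open>x\<close> both values of \<open>kap\<close> are bounded by the
  distance to \<open>x\<close>; an isolated \<open>x\<close> is alone in a small ball, and
  \<open>rho x x = 0\<close>.\<close>

lemma rho_small_near:
  assumes x: "x \<in> M" and \<epsilon>: "\<epsilon> > 0"
  shows "\<exists>r>0. \<forall>y\<in>mball x r. rho y x < \<epsilon>"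
proof (cases "x \<in> non_isolated mtopology")
  case True
  have "rho y x < \<epsilon>" if "y \<in> mball x (\<epsilon> / 2)" for y
    using that kap_le[OF True, of y] kap_le[OF True, of x] x commute[of x y] \<epsilon>
    unfolding rho_def by (auto simp: max_def)
  then show ?thesis using \<epsilon> by (intro exI[of _ "\<epsilon> / 2"]) auto
next
  case False
  then have "openin mtopology {x}" using x by (auto simp: non_isolated_def)
  then obtain r where "r > 0" "mball x r \<subseteq> {x}" unfolding openin_mtopology by blast
  then show ?thesis using \<epsilon> by (intro exI[of _ r]) (auto simp: rho_def)
qed

lemma pair_sum_simps [simp]: "pair_sum {#} = 0"
  "pair_sum (add_mset (x, y) P) = frag_of x - frag_of y + pair_sum P"
  "pair_sum (P + Q) = pair_sum P + pair_sum Q"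
  by (simp_all add: pair_sum_def)

lemma cost_simps [simp]: "cost {#} = 0" "cost (add_mset (x, y) P) = rho x y + cost P"
  "cost (P + Q) = cost P + cost Q"
  by (simp_all add: cost_def)

lemma cost_nonneg: "0 \<le> cost P"
  by (induction P) (auto simp: rho_nonneg)

lemma cost_swap: "cost (image_mset prod.swap P) = cost P"
  by (induction P) (auto simp: rho_commute)

lemma pair_sum_swap: "pair_sum (image_mset prod.swap P) = - pair_sum P"
  by (induction P) auto

lemma ev_le_len:
  assumes "\<And>x. \<bar>u x\<bar> \<le> 1"
  shows "ev u c \<le> len c"
proof -
  have "ev u c \<le> (\<Sum>x\<in>Poly_Mapping.keys c. \<bar>real_of_int (Poly_Mapping.lookup c x)\<bar> * 1)"
    unfolding ev_def
  proof (rule sum_mono)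
    fix x
    have "real_of_int (Poly_Mapping.lookup c x) * u x \<le> \<bar>real_of_int (Poly_Mapping.lookup c x)\<bar> * \<bar>u x\<bar>"
      by (metis abs_ge_self abs_mult)
    also have "\<dots> \<le> \<bar>real_of_int (Poly_Mapping.lookup c x)\<bar> * 1"
      using assms by (intro mult_left_mono) auto
    finally show "real_of_int (Poly_Mapping.lookup c x) * u x \<le> \<bar>real_of_int (Poly_Mapping.lookup c x)\<bar> * 1" .
  qed
  then show ?thesis by (simp add: len_def)
qed

lemma short_pair_sum:
  assumes "set_mset P \<subseteq> M \<times> M"
  shows "\<exists>Q. set_mset Q \<subseteq> M \<times> M \<and> pair_sum Q = pair_sum P \<and> cost Q \<le> cost P \<and> 2 * size Q \<le> len (pair_sum P)"
  using assms
proof (induction "size P" arbitrary: P rule: less_induct)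
  case less
  show ?case
  proof (cases "fst ` set_mset P \<inter> snd ` set_mset P = {}")
    case True
    \<comment> \<open>No point is both a first and a second component, so each pair contributes
      exactly 2 to \<open>ev u\<close>. Since \<open>ev u\<close> is at most the length, the
      representation is already short.\<close>
    define u :: "'a \<Rightarrow> real" where
      "u x = (if x \<in> fst ` set_mset P then 1 else if x \<in> snd ` set_mset P then -1 else 0)" for x
    have "ev u (pair_sum R) = 2 * size R" if "R \<subseteq># P" for R
      using that
    proof (induction R)
      case (add p R)
      obtain x y where p: "p = (x, y)" by (cases p)
      have "p \<in># P" using add.prems by (rule mset_subset_eq_insertD[THEN conjunct1])
      then have "x \<in> fst ` set_mset P" "y \<in> snd ` set_mset P" using p by force+
      then have "u x = 1" "u y = -1" using True by (auto simp: u_def)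
      moreover have "R \<subseteq># P" using add.prems by (meson mset_subset_eq_insertD subset_mset.less_imp_le)
      ultimately show ?case using add.IH by (simp add: p)
    qed simp
    then have "2 * real (size P) \<le> len (pair_sum P)"
      using ev_le_len[of u "pair_sum P"] by (simp add: u_def)
    then show ?thesis using less.prems by (intro exI[of _ P]) auto
  next
    case False
    then obtain z a b where z: "(z, b) \<in># P" "(a, z) \<in># P" by auto
    \<comment> \<open>The two pairs may be one and the same occurrence, namely
      \<open>(z, z)\<close>, which is dropped at no cost; otherwise they are different members and
      can be merged through \<open>z\<close>.\<close>
    have "\<exists>P'. size P' < size P \<and> set_mset P' \<subseteq> M \<times> M \<and> pair_sum P' = pair_sum P \<and> cost P' \<le> cost P"
    proof (cases "(z, z) \<in># P")
      case True
      then obtain P' where P': "P = add_mset (z, z) P'" by (rule mset_add)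
      then show ?thesis using less.prems by (intro exI[of _ P']) (auto simp: rho_def)
    next
      case zz: False
      obtain P1 where P1: "P = add_mset (z, b) P1" using z(1) by (rule mset_add)
      then have "(a, z) \<in># P1" using z zz by auto
      then obtain P2 where P2: "P1 = add_mset (a, z) P2" by (rule mset_add)
      have "rho a b \<le> rho a z + rho z b"
        using less.prems P1 P2 by (intro rho_triangle) auto
      then show ?thesis
        using less.prems P1 P2 by (intro exI[of _ "add_mset (a, b) P2"]) auto
    qed
    then obtain P' where P': "size P' < size P" "set_mset P' \<subseteq> M \<times> M" "pair_sum P' = pair_sum P" "cost P' \<le> cost P"
      by blast
    from less.hyps[OF P'(1,2)] P'(3,4) show ?thesis by (metis order_trans)
  qed
qed

text \<open>The number of pairs is unrestricted here, which is what makes these sets a filter base: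
  the difference of two sums is again a sum, with the pairs of the second swapped, and the costs add
  up.\<close>

lemma cost_nbhd:
  assumes "\<epsilon> > 0"
  obtains U where "openin T U" "0 \<in> U"
    "\<And>c. c \<in> U \<Longrightarrow> \<exists>P. set_mset P \<subseteq> M \<times> M \<and> pair_sum P = c \<and> cost P < \<epsilon>"
proof -
  define R where "R \<epsilon> = {pair_sum P |P. set_mset P \<subseteq> M \<times> M \<and> cost P < \<epsilon>}" for \<epsilon>
  have Rmono: "R a \<subseteq> R b" if "a \<le> b" for a b using that unfolding R_def by force
  have "R \<epsilon> \<in> R ` {0<..}" using assms by simp
  then obtain U where "openin T U" "0 \<in> U" "U \<subseteq> R \<epsilon>"
  proof (rule filter_base_nbhd[rotated 4])
    show "0 \<in> W" if "W \<in> R ` {0<..}" for W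
      using that unfolding R_def by (auto intro!: exI[of _ "{#}"])
    show "\<exists>Q\<in>R ` {0<..}. Q \<subseteq> V \<inter> W" if VW: "V \<in> R ` {0<..}" "W \<in> R ` {0<..}" for V W
    proof -
      obtain a b where "a > 0" "b > 0" "V = R a" "W = R b" using VW by auto
      then show ?thesis using Rmono[of "min a b" a] Rmono[of "min a b" b]
        by (intro bexI[of _ "R (min a b)"]) auto
    qed
    show "\<exists>V\<in>R ` {0<..}. \<forall>x\<in>V. \<forall>y\<in>V. x - y \<in> W" if "W \<in> R ` {0<..}" for W
    proof -
      obtain a where a: "a > 0" "W = R a" using \<open>W \<in> R ` {0<..}\<close> by auto
      have "x - y \<in> R a" if "x \<in> R (a/2)" "y \<in> R (a/2)" for x y
      proof -
        obtain P Q where P: "set_mset P \<subseteq> M \<times> M" "cost P < a/2" "x = pair_sum P"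
          and Q: "set_mset Q \<subseteq> M \<times> M" "cost Q < a/2" "y = pair_sum Q"
          using \<open>x \<in> R (a/2)\<close> \<open>y \<in> R (a/2)\<close> unfolding R_def by blast
        have "set_mset (P + image_mset prod.swap Q) \<subseteq> M \<times> M" using P Q by auto
        moreover have "cost (P + image_mset prod.swap Q) < a" using P Q by (simp add: cost_swap)
        moreover have "x - y = pair_sum (P + image_mset prod.swap Q)" using P Q by (simp add: pair_sum_swap)
        ultimately show ?thesis unfolding R_def by blast
      qed
      then show ?thesis using a by (intro bexI[of _ "R (a/2)"]) auto
    qed
    show "\<exists>r>0. \<forall>y\<in>mball x r. frag_of y - frag_of x \<in> W" if "W \<in> R ` {0<..}" "x \<in> M" for W x
    proof -
      obtain a where a: "a > 0" "W = R a" using \<open>W \<in> R ` {0<..}\<close> by auto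
      obtain r where r: "r > 0" "\<And>y. y \<in> mball x r \<Longrightarrow> rho y x < a"
        using rho_small_near[OF \<open>x \<in> M\<close> a(1)] by blast
      have "frag_of y - frag_of x \<in> W" if "y \<in> mball x r" for y
        unfolding a(2) R_def using r(2)[OF that] that \<open>x \<in> M\<close>
        by (intro CollectI exI[of _ "{#(y, x)#}"]) auto
      then show ?thesis using r(1) by blast
    qed
  qed
  then show thesis by (intro that[of U]) (auto simp: R_def)
qed

text \<open>For \<open>x \<noteq> y\<close> a small \<open>rho x y\<close> forces \<open>x\<close>
  close to the compact set NI(X), where a Lebesgue number gives uniformity; away from NI(X) the
  summand with \<open>kap\<close> keeps \<open>rho\<close> large. Both points then lie in one ball
  around some \<open>z\<close>, and the difference is taken through \<open>z\<close>.\<close>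

lemma rho_uniform:
  assumes comp: "compactin mtopology (non_isolated mtopology)" and V: "openin T V" "0 \<in> V"
  shows "\<exists>\<epsilon>>0. \<forall>x\<in>M. \<forall>y\<in>M. rho x y < \<epsilon> \<longrightarrow> frag_of x - frag_of y \<in> V"
proof -
  have NI: "non_isolated mtopology \<subseteq> M" by (auto simp: non_isolated_def)
  obtain W where W: "openin T W" "0 \<in> W" "\<And>x y. x \<in> W \<Longrightarrow> y \<in> W \<Longrightarrow> x - y \<in> V"
    using open_diff_nbhd[OF V] by metis
  have "\<exists>r>0. \<forall>y\<in>mball z r. frag_of y - frag_of z \<in> W" if "z \<in> non_isolated mtopology" for z
  proof -
    have "z \<in> M" using that NI by blast
    then obtain r where "r > 0" "\<And>y. y \<in> mball z r \<Longrightarrow> frag_of y - frag_of z \<in> W"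
      using frag_of_near[OF W(1,2)] by metis
    then show ?thesis by (intro exI[of _ r]) simp
  qed
  then obtain r where r: "\<And>z. z \<in> non_isolated mtopology \<Longrightarrow> r z > 0"
    "\<And>z y. z \<in> non_isolated mtopology \<Longrightarrow> y \<in> mball z (r z) \<Longrightarrow> frag_of y - frag_of z \<in> W"
    by metis
  have "\<exists>\<epsilon>>0. \<forall>x\<in>non_isolated mtopology. \<exists>U\<in>(\<lambda>z. mball z (r z)) ` non_isolated mtopology. mball x \<epsilon> \<subseteq> U"
    by (rule lebesgue_number[OF comp]) (use r(1) NI in force)+
  then obtain \<epsilon> where \<epsilon>: "\<epsilon> > 0"
    "\<And>x. x \<in> non_isolated mtopology \<Longrightarrow> \<exists>z\<in>non_isolated mtopology. mball x \<epsilon> \<subseteq> mball z (r z)"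
    by blast
  have "frag_of x - frag_of y \<in> V" if xy: "x \<in> M" "y \<in> M" "rho x y < min 1 (\<epsilon> / 2)" for x y
  proof (cases "x = y")
    case True
    then show ?thesis using V by simp
  next
    case False
    then have "d x y + kap x < min 1 (\<epsilon> / 2)" using xy(3) by (auto simp: rho_def)
    then have "kap x < min 1 (\<epsilon> / 2)" "d x y < \<epsilon> / 2"
      using kap_nonneg[of x] nonneg[of x y] by linarith+
    then obtain w where w: "w \<in> non_isolated mtopology" "d x w < \<epsilon> / 2"
      using kap_less[of x "min 1 (\<epsilon> / 2)"] by auto
    have wM: "w \<in> M" using w NI by blast
    have "d w y \<le> d x w + d x y" using triangle[OF wM xy(1,2)] commute[of w x] by simp
    then have "x \<in> mball w \<epsilon>" "y \<in> mball w \<epsilon>"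
      using w \<open>d x y < \<epsilon> / 2\<close> xy wM commute[of w x] \<epsilon>(1) by auto
    then obtain z where z: "z \<in> non_isolated mtopology" "x \<in> mball z (r z)" "y \<in> mball z (r z)"
      using \<epsilon>(2)[OF w(1)] by blast
    have "(frag_of x - frag_of z) - (frag_of y - frag_of z) \<in> V"
      using W(3) r(2) z by blast
    then show ?thesis by simp
  qed
  then show ?thesis using \<epsilon>(1) by (intro exI[of _ "min 1 (\<epsilon> / 2)"]) auto
qed

text \<open>Each pair uses up one shrinking of the neighbourhood, so \<open>\<epsilon>\<close>
  depends on the bound \<open>n\<close> for the number of pairs.\<close>

lemma short_pair_sum_small:
  assumes comp: "compactin mtopology (non_isolated mtopology)" and V: "openin T V" "0 \<in> V"
  shows "\<exists>\<epsilon>>0. \<forall>P. set_mset P \<subseteq> M \<times> M \<and> size P \<le> n \<and> cost P < \<epsilon> \<longrightarrow> pair_sum P \<in> V"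
  using V
proof (induction n arbitrary: V)
  case 0
  then show ?case by (intro exI[of _ 1]) auto
next
  case (Suc n)
  obtain W where W: "openin T W" "0 \<in> W" "\<And>x y. x \<in> W \<Longrightarrow> y \<in> W \<Longrightarrow> x + y \<in> V"
    using open_symmetric_nbhd[OF Suc.prems] by metis
  obtain a where a: "a > 0" "\<And>P. set_mset P \<subseteq> M \<times> M \<Longrightarrow> size P \<le> n \<Longrightarrow> cost P < a \<Longrightarrow> pair_sum P \<in> W"
    using Suc.IH[OF W(1,2)] by blast
  obtain b where b: "b > 0" "\<And>x y. x \<in> M \<Longrightarrow> y \<in> M \<Longrightarrow> rho x y < b \<Longrightarrow> frag_of x - frag_of y \<in> W"
    using rho_uniform[OF comp W(1,2)] by blast
  have "pair_sum P \<in> V" if P: "set_mset P \<subseteq> M \<times> M" "size P \<le> Suc n" "cost P < min a b" for P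
  proof (cases P)
    case empty
    then show ?thesis using Suc.prems by simp
  next
    case (add p Q)
    obtain x y where p: "p = (x, y)" by (cases p)
    have "frag_of x - frag_of y \<in> W"
      using P add p cost_nonneg[of Q] by (intro b(2)) auto
    moreover have "pair_sum Q \<in> W"
      using P add p rho_nonneg[of x y] by (intro a(2)) auto
    ultimately show ?thesis using W(3) add p by simp
  qed
  then show ?case using a(1) b(1) by (intro exI[of _ "min a b"]) auto
qed

text \<open>If \<open>g\<close> outside \<open>S\<close> were in the closure of \<open>S\<close>,
  elements \<open>c k\<close> of \<open>S\<close> with \<open>c k - g\<close> of cost below
  \<open>1 / Suc k\<close> would exist by \<open>cost_nbhd\<close>. They converge to
  \<open>g\<close>, and the compact set formed by the sequence and \<open>g\<close> contradicts the
  choice of \<open>S\<close>.\<close>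

lemma compact_non_isolated_imp_k_space:
  assumes comp: "compactin mtopology (non_isolated mtopology)"
  shows "k_space (bounded_length n)"
  unfolding k_space
proof (intro allI impI, elim conjE)
  let ?A = "bounded_length n"
  have topA: "topspace ?A = {c \<in> frags M. len c \<le> n}"
    using topspace_T by auto
  fix S assume S: "S \<subseteq> topspace ?A" "\<forall>K. compactin ?A K \<longrightarrow> closedin (subtopology ?A K) (K \<inter> S)"
  have "\<exists>U. openin ?A U \<and> g \<in> U \<and> U \<subseteq> topspace ?A - S" if "g \<in> topspace ?A - S" for g
  proof -
    have g: "g \<in> frags M" "len g \<le> n" "g \<notin> S" using that topA by auto
    have gT: "g \<in> topspace T" using g topspace_T by simp
    have "\<exists>U. openin T U \<and> 0 \<in> U \<and> (\<forall>c\<in>S. c - g \<notin> U)"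
    proof (rule ccontr)
      assume no: "\<not> ?thesis"
      have "\<exists>c P. c \<in> S \<and> set_mset P \<subseteq> M \<times> M \<and> pair_sum P = c - g \<and> cost P < 1 / Suc k" for k
      proof -
        obtain U where U: "openin T U" "0 \<in> U"
          "\<And>c. c \<in> U \<Longrightarrow> \<exists>P. set_mset P \<subseteq> M \<times> M \<and> pair_sum P = c \<and> cost P < 1 / Suc k"
          using cost_nbhd[of "1 / Suc k"] by auto
        then obtain c where "c \<in> S" "c - g \<in> U" using no by blast
        then show ?thesis using U(3) by blast
      qed
      then obtain c P where c: "\<And>k. c k \<in> S" "\<And>k. set_mset (P k) \<subseteq> M \<times> M"
        "\<And>k. pair_sum (P k) = c k - g" "\<And>k. cost (P k) < 1 / Suc k" by metis
      have cA: "c k \<in> frags M" "len (c k) \<le> n" for k using S(1) c(1)[of k] topA by auto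
      have "limitin T c g sequentially"
        unfolding limitin_def
      proof (intro conjI allI impI gT)
        fix U assume U: "openin T U \<and> g \<in> U"
        let ?V = "{h \<in> topspace T. h - (- g) \<in> U}"
        have "openin T ?V" "0 \<in> ?V"
          using U openin_translate[of U "- g"] minus_in[OF gT] zero_in by auto
        then obtain \<epsilon> where \<epsilon>: "\<epsilon> > 0"
          "\<And>P. set_mset P \<subseteq> M \<times> M \<Longrightarrow> size P \<le> n \<Longrightarrow> cost P < \<epsilon> \<Longrightarrow> pair_sum P \<in> ?V"
          using short_pair_sum_small[OF comp, of ?V n] by blast
        obtain N where N: "1 / Suc N < \<epsilon>" using nat_approx_posE[OF \<epsilon>(1)] by blast
        show "\<forall>\<^sub>F k in sequentially. c k \<in> U"
        proof (rule eventually_sequentiallyI)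
          fix k assume "k \<ge> N"
          then have k: "1 / Suc k \<le> 1 / Suc N" by (simp add: frac_le)
          \<comment> \<open>\<open>P k\<close> is cheap but may be long. As \<open>c k - g\<close>
            has length at most \<open>2 * n\<close>, it also has a representation by at most
            \<open>n\<close> pairs that is no more expensive.\<close>
          obtain Q where Q: "set_mset Q \<subseteq> M \<times> M" "pair_sum Q = c k - g" "cost Q \<le> cost (P k)"
            "2 * size Q \<le> len (c k - g)"
            using short_pair_sum[OF c(2)[of k]] unfolding c(3) by blast
          have "size Q \<le> n" using Q(4) len_diff[of "c k" g] cA(2)[of k] g(2) by linarith
          then have "pair_sum Q \<in> ?V" using Q c(4)[of k] k N by (intro \<epsilon>(2)) auto
          then show "c k \<in> U" unfolding Q(2) by simp
        qed
      qed
      then have lim: "limitin ?A c g sequentially"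
        using g cA by (simp add: limitin_subtopology)
      let ?K = "insert g (range c)"
      have "compactin ?A ?K"
        by (rule compactin_sequence_with_limit[OF lim]) (use c(1) S(1) in auto)
      then have cl: "closedin (subtopology ?A ?K) (?K \<inter> S)" using S(2) by blast
      have "limitin (subtopology ?A ?K) c g sequentially"
        unfolding limitin_subtopology[of ?A] using lim by simp
      then have "g \<in> ?K \<inter> S"
        by (rule limitin_closedin[OF _ cl]) (use c(1) in auto)
      then show False using g by blast
    qed
    then obtain U where U: "openin T U" "0 \<in> U" "\<And>c. c \<in> S \<Longrightarrow> c - g \<notin> U" by blast
    have "openin ?A ({h \<in> topspace T. h - g \<in> U} \<inter> {c \<in> frags M. len c \<le> n})"
      using openin_translate[OF U(1) gT] by (auto simp: openin_subtopology)
    moreover have "{h \<in> topspace T. h - g \<in> U} \<inter> {c \<in> frags M. len c \<le> n} \<subseteq> topspace ?A - S"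
      using U(3) topA by auto
    moreover have "g \<in> {h \<in> topspace T. h - g \<in> U} \<inter> {c \<in> frags M. len c \<le> n}"
      using g gT U(2) by auto
    ultimately show ?thesis by blast
  qed
  then show "closedin ?A S"
    unfolding closedin_def using S(1) by (subst openin_subopen) blast
qed

lemma k_space_kR_space_bounded_length:
  fixes n :: nat
  assumes "(locally_compact_space mtopology \<and> separable_space (subtopology mtopology (non_isolated mtopology))) \<or>
    compactin mtopology (non_isolated mtopology)"
  shows "k_space (bounded_length n)" "kR_space (bounded_length n)"
proof -
  show *: "k_space (bounded_length n)"
    using assms
  proof
    assume "locally_compact_space mtopology \<and> separable_space (subtopology mtopology (non_isolated mtopology))"
    then show ?thesis
      using locally_compact_imp_k_space closedin_bounded_length k_space_closed_subtopology by blast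
  qed (rule compact_non_isolated_imp_k_space)
  show "kR_space (bounded_length n)" by (rule kR_space_if_k_space[OF *])
qed

end

section \<open>Transfer to an arbitrary free Abelian topological group\<close>

lemma homeomorphic_kR_space_imp:
  assumes "Y homeomorphic_space Z" "kR_space Y"
  shows "kR_space Z"
proof -
  obtain f g where fg: "homeomorphic_maps Y Z f g"
    using assms(1) by (auto simp: homeomorphic_space_def)
  then have f: "continuous_map Y Z f" and g: "continuous_map Z Y g"
    and fg_id: "\<And>z. z \<in> topspace Z \<Longrightarrow> f (g z) = z"
    by (auto simp: homeomorphic_maps_def)
  have "Tychonoff_space Z"
    using assms homeomorphic_completely_regular_space[OF assms(1)] homeomorphic_t1_space[OF assms(1)]
    by (simp add: kR_space_def Tychonoff_space_def)
  moreover have "continuous_map Z euclideanreal h"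
    if h: "\<forall>K. compactin Z K \<longrightarrow> continuous_map (subtopology Z K) euclideanreal h" for h :: "'b \<Rightarrow> real"
  proof -
    have "continuous_map (subtopology Y K) euclideanreal (h \<circ> f)" if K: "compactin Y K" for K
    proof -
      have "compactin Z (f ` K)" using K f by (rule image_compactin)
      then have "continuous_map (subtopology Z (f ` K)) euclideanreal h" using h by blast
      moreover have "continuous_map (subtopology Y K) (subtopology Z (f ` K)) f"
        using f by (auto simp: continuous_map_in_subtopology intro: continuous_map_from_subtopology)
      ultimately show ?thesis by (rule continuous_map_compose[rotated])
    qed
    then have "continuous_map Y euclideanreal (h \<circ> f)"
      using assms(2) unfolding kR_space_def by blast
    then have "continuous_map Z euclideanreal (h \<circ> f \<circ> g)"
      by (rule continuous_map_compose[OF g])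
    then show ?thesis
      by (rule continuous_map_eq) (simp add: fg_id)
  qed
  ultimately show ?thesis unfolding kR_space_def by blast
qed

lemma homeomorphic_kR_space: "Y homeomorphic_space Z \<Longrightarrow> kR_space Y \<longleftrightarrow> kR_space Z"
  using homeomorphic_kR_space_imp[of Y Z] homeomorphic_kR_space_imp[of Z Y] homeomorphic_space_sym[of Y Z]
  by blast

lemma carrier_free_Abelian_group: "carrier (free_Abelian_group M) = frags M"
  by (auto simp: frags_def)

lemma abelian_topological_group_frags:
  "abelian_topological_group (free_Abelian_group M) S \<longleftrightarrow>
    topspace S = frags M \<and> continuous_map (prod_topology S S) S (\<lambda>(x, y). x - y)"
proof (intro iffI conjI)
  assume A: "abelian_topological_group (free_Abelian_group M) S"
  then show top: "topspace S = frags M"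
    by (simp only: abelian_topological_group_def carrier_free_Abelian_group)
  have "continuous_map S S (\<lambda>x. inv\<^bsub>free_Abelian_group M\<^esub> x)"
    using A by (simp add: abelian_topological_group_def)
  then have minus: "continuous_map S S uminus"
    by (rule continuous_map_eq) (simp add: top frags_def)
  have "continuous_map (prod_topology S S) (prod_topology S S) (\<lambda>(x, y). (x, - y))"
    using minus by (simp add: continuous_map_prod_top)
  moreover have "continuous_map (prod_topology S S) S (\<lambda>(x, y). x + y)"
    using A by (simp add: abelian_topological_group_def)
  ultimately have "continuous_map (prod_topology S S) S ((\<lambda>(x, y). x + y) \<circ> (\<lambda>(x, y). (x, - y)))"
    by (rule continuous_map_compose)
  then show "continuous_map (prod_topology S S) S (\<lambda>(x, y). x - y)"
    by (rule continuous_map_eq) auto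
next
  assume A: "topspace S = frags M \<and> continuous_map (prod_topology S S) S (\<lambda>(x, y). x - y)"
  then interpret additive_topological_group S
    by unfold_locales auto
  have "continuous_map (prod_topology S S) S (\<lambda>(x, y). x + y)"
    unfolding case_prod_beta' by (intro continuous_add continuous_map_fst continuous_map_snd)
  moreover have "continuous_map S S (\<lambda>x. inv\<^bsub>free_Abelian_group M\<^esub> x)"
  proof (rule continuous_map_eq)
    show "continuous_map S S uminus" using continuous_uminus[of S "\<lambda>x. x"] by simp
  qed (use A in \<open>simp add: frags_def\<close>)
  ultimately show "abelian_topological_group (free_Abelian_group M) S"
    using A by (simp add: abelian_topological_group_def abelian_free_Abelian_group carrier_free_Abelian_group)
qed

text \<open>\<open>T'\<close> is pulled back along the canonical homomorphism \<open>\<phi>\<close>.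
  The universal property is used twice: with a competing group topology as target it shows that
  \<open>T'\<close> is finest, and with \<open>T'\<close> as target it supplies the continuous
  inverse of \<open>\<phi>\<close>. Uniqueness of the reduced form turns
  \<open>reduced_length\<close> into \<open>len\<close>.\<close>

lemma free_abelian_topological_group_concrete:
  assumes X: "Metric_space M d" "X = Metric_space.mtopology M d"
    and A: "free_abelian_topological_group X G T i"
  obtains T' where "free_abelian_metric M d T'"
    "\<And>n. subtopology T' {c \<in> frags M. len c \<le> n} homeomorphic_space A_sub X G T i n"
proof -
  interpret Metric_space M d by (rule X(1))
  have topX: "topspace X = M" using X(2) by simp
  let ?F = "free_Abelian_group M"
  interpret G: comm_group G
    using A by (simp add: free_abelian_topological_group_def abelian_topological_group_def)
  interpret F: comm_group ?F by (rule abelian_free_Abelian_group)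
  have atg: "abelian_topological_group G T" and i: "continuous_map X T i"
    and gen: "generate G (i ` topspace X) = carrier G"
    using A by (auto simp: free_abelian_topological_group_def)
  have spT: "topspace T = carrier G" using atg by (simp add: abelian_topological_group_def)
  have iM: "i ` M \<subseteq> carrier G"
    using continuous_map_image_subset_topspace[OF i] spT topX by simp
  obtain \<phi> where \<phi>: "\<phi> \<in> hom ?F G" and \<phi>i: "\<And>x. x \<in> M \<Longrightarrow> \<phi> (frag_of x) = i x"
    using G.free_Abelian_group_universal[OF iM] by metis
  have comb: "combination G i c = \<phi> c" if "c \<in> frags M" for c
    using hom_eq_combination[OF G.comm_group_axioms \<phi> \<phi>i] that by (simp add: frags_def)
  have \<phi>_closed: "\<phi> c \<in> carrier G" if "c \<in> frags M" for c
    using \<phi> that by (auto simp: hom_def frags_def)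
  define T' where "T' = pullback_topology (carrier ?F) \<phi> T"
  have atg': "abelian_topological_group ?F T'"
    unfolding T'_def by (rule abelian_topological_group_pullback[OF abelian_free_Abelian_group atg \<phi>])
  then have spT': "topspace T' = frags M"
    by (simp only: abelian_topological_group_def carrier_free_Abelian_group)
  have frag': "continuous_map X T' frag_of"
    unfolding T'_def
  proof (rule continuous_map_pullback')
    show "continuous_map X T (\<phi> \<circ> frag_of)"
      using i by (rule continuous_map_eq) (simp add: \<phi>i topX)
  qed (auto simp: topX)
  have \<phi>_cont: "continuous_map T' T \<phi>"
    unfolding T'_def using continuous_map_pullback[of T T id "carrier ?F" \<phi>] by simp
  have inverse: "k (\<phi> c) = c" if k: "k \<in> hom G ?F" "\<And>x. x \<in> M \<Longrightarrow> frag_of x = k (i x)"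
    and c: "c \<in> frags M" for k c
  proof -
    interpret \<phi>: group_hom ?F G \<phi>
      using \<phi> by (simp add: group_hom_def group_hom_axioms_def F.is_group G.is_group)
    interpret k: group_hom G ?F k
      using k by (simp add: group_hom_def group_hom_axioms_def F.is_group G.is_group)
    have "Poly_Mapping.keys c \<subseteq> M" using c by (simp add: frags_def)
    then show ?thesis
    proof (rule free_Abelian_group_induct)
      show "k (\<phi> 0) = 0" using \<phi>.hom_one k.hom_one by simp
    next
      fix x y
      assume xy: "Poly_Mapping.keys x \<subseteq> M" "Poly_Mapping.keys y \<subseteq> M" "k (\<phi> x) = x" "k (\<phi> y) = y"
      then have car: "x \<in> carrier ?F" "y \<in> carrier ?F" by auto
      then have "k (\<phi> (x \<otimes>\<^bsub>?F\<^esub> inv\<^bsub>?F\<^esub> y)) = k (\<phi> x) \<otimes>\<^bsub>?F\<^esub> inv\<^bsub>?F\<^esub> (k (\<phi> y))"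
        by (simp only: \<phi>.hom_mult k.hom_mult \<phi>.hom_inv k.hom_inv F.inv_closed \<phi>.hom_closed G.inv_closed)
      then show "k (\<phi> (x - y)) = x - y" using xy by simp
    qed (use \<phi>i k(2) in simp)
  qed
  have finest: "openin T' U"
    if S: "topspace S = frags M" "continuous_map (prod_topology S S) S (\<lambda>(x, y). x - y)"
      "continuous_map X S frag_of" and U: "openin S U" for S U
  proof -
    have atgS: "abelian_topological_group ?F S" using S by (simp add: abelian_topological_group_frags)
    obtain k where k: "k \<in> hom G ?F" "continuous_map T S k" "\<And>x. x \<in> M \<Longrightarrow> frag_of x = k (i x)"
      using free_abelian_topological_group_universal[OF A atgS S(3)] topX by metis
    \<comment> \<open>This composition is the identity on \<open>frags M\<close>, so its continuity
      says that \<open>T'\<close> is finer than \<open>S\<close>.\<close>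
    have "continuous_map T' S (k \<circ> \<phi>)" using \<phi>_cont k(2) by (rule continuous_map_compose)
    then have "continuous_map T' S id"
      by (rule continuous_map_eq) (use inverse[OF k(1,3)] in \<open>auto simp: spT'\<close>)
    then have "openin T' {x \<in> topspace T'. id x \<in> U}" using U by (rule openin_continuous_map_preimage)
    moreover have "{x \<in> topspace T'. id x \<in> U} = U" using openin_subset[OF U] S(1) spT' by auto
    ultimately show ?thesis by simp
  qed
  have "free_abelian_metric M d T'"
    using atg' frag' finest unfolding abelian_topological_group_frags
    by unfold_locales (auto simp: X(2))
  moreover obtain k where k: "k \<in> hom G ?F" "continuous_map T T' k" "\<And>x. x \<in> M \<Longrightarrow> frag_of x = k (i x)"
    using free_abelian_topological_group_universal[OF A atg' frag'] topX by metis
  have form: "\<exists>c. c \<in> frags M \<and> \<phi> c = g" if "g \<in> carrier G" for g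
    using ex1_implies_ex[OF reduced_form_ex1[OF A that]] comb by (auto simp: topX frags_def)
  have maps: "homeomorphic_maps T' T \<phi> k"
    unfolding homeomorphic_maps_def
  proof (intro conjI ballI \<phi>_cont k(2))
    show "k (\<phi> c) = c" if "c \<in> topspace T'" for c
      using inverse[OF k(1,3)] that spT' by simp
    show "\<phi> (k g) = g" if g: "g \<in> topspace T" for g
      using form[of g] g spT inverse[OF k(1,3)] by force
  qed
  have length: "reduced_length X G i (\<phi> c) = len c" if c: "c \<in> frags M" for c
  proof -
    have "reduced_form X G i (\<phi> c) = c"
      unfolding reduced_form_def
      using c comb[OF c] topX
      by (intro the1_equality[OF reduced_form_ex1[OF A \<phi>_closed[OF c]]]) (auto simp: frags_def)
    then show ?thesis by (simp add: reduced_length_def len_def)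
  qed
  have "subtopology T' {c \<in> frags M. len c \<le> n} homeomorphic_space A_sub X G T i n" for n
  proof -
    have "\<phi> ` (topspace T' \<inter> {c \<in> frags M. len c \<le> n}) =
        topspace T \<inter> {g \<in> carrier G. reduced_length X G i g \<le> n}"
    proof (intro equalityI subsetI)
      fix g assume "g \<in> topspace T \<inter> {g \<in> carrier G. reduced_length X G i g \<le> n}"
      then show "g \<in> \<phi> ` (topspace T' \<inter> {c \<in> frags M. len c \<le> n})"
        using form[of g] length spT' by auto
    qed (use \<phi>_closed length spT spT' in auto)
    then show ?thesis
      unfolding A_sub_def homeomorphic_space_def using homeomorphic_maps_subtopologies[OF maps] by blast
  qed
  ultimately show thesis by (rule that)
qed

theorem theorem4p11:
  fixes X :: "'a topology"
    and G :: "('g, 'm) monoid_scheme" and T :: "'g topology" and i :: "'a \<Rightarrow> 'g"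
  assumes "metrizable_space X" and "topspace X \<noteq> {}"
    and "free_abelian_topological_group X G T i"
  shows "((\<forall>n::nat. n \<ge> 1 \<longrightarrow> k_space (A_sub X G T i n)) \<longleftrightarrow> k_space (A_sub X G T i 4)) \<and>
         (k_space (A_sub X G T i 4) \<longleftrightarrow> (\<forall>n::nat. n \<ge> 1 \<longrightarrow> kR_space (A_sub X G T i n))) \<and>
         ((\<forall>n::nat. n \<ge> 1 \<longrightarrow> kR_space (A_sub X G T i n)) \<longleftrightarrow> kR_space (A_sub X G T i 4)) \<and>
         (kR_space (A_sub X G T i 4) \<longleftrightarrow>
            (locally_compact_space X \<and> separable_space (subtopology X (non_isolated X))) \<or>
            compactin X (non_isolated X))"
proof -
  obtain M d where X: "Metric_space M d" "X = Metric_space.mtopology M d"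
    using assms(1) unfolding metrizable_space_def by metis
  obtain T' where T': "free_abelian_metric M d T'"
    and homeo: "\<And>n. subtopology T' {c \<in> frags M. len c \<le> n} homeomorphic_space A_sub X G T i n"
    using free_abelian_topological_group_concrete[OF X assms(3)] by metis
  interpret free_abelian_metric M d T' by (rule T')
  let ?P = "(locally_compact_space X \<and> separable_space (subtopology X (non_isolated X))) \<or>
            compactin X (non_isolated X)"
  have k: "k_space (A_sub X G T i n) \<longleftrightarrow> k_space (bounded_length n)"
    and kR: "kR_space (A_sub X G T i n) \<longleftrightarrow> kR_space (bounded_length n)" for n
    using homeomorphic_k_space[OF homeo] homeomorphic_kR_space[OF homeo] by simp_all
  have "k_space (A_sub X G T i n) \<and> kR_space (A_sub X G T i n)" if ?P for n
    using k_space_kR_space_bounded_length[of n] that unfolding k kR unfolding X(2) by blast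
  \<comment> \<open>If condition (5) fails, NI(X) is not compact, and local compactness of X or
    separability of NI(X) fails; each alternative has its counterexample.\<close>
  moreover have "\<not> k_space (A_sub X G T i 4) \<and> \<not> kR_space (A_sub X G T i 4)" if "\<not> ?P"
    using not_locally_compact_imp_not_k_space not_separable_imp_not_k_space that
    unfolding k kR unfolding X(2) by blast
  ultimately have "k_space (A_sub X G T i 4) \<longleftrightarrow> ?P" "kR_space (A_sub X G T i 4) \<longleftrightarrow> ?P"
    "(\<forall>n::nat. n \<ge> 1 \<longrightarrow> k_space (A_sub X G T i n)) \<longleftrightarrow> ?P"
    "(\<forall>n::nat. n \<ge> 1 \<longrightarrow> kR_space (A_sub X G T i n)) \<longleftrightarrow> ?P"
    by (metis one_le_numeral)+
  then show ?thesis by simp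
qed

end
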